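(* MLCM-P\_PATH is fixed-parameter tractable with respect to the multiplicity $k$ of the line set: it can be solved in $O(k^3 2^k |V|)$ time, where $|V|=n$ is the number of stations.
   Context: Stations $1,\dots,n$ lie on a horizontal line, joined by edges $(i,i+1)$. A line is $[i,j]$ with $1\le i<j\le n$, travelling along edges $(i,i+1),\dots,(j-1,j)$; $\mathcal L$ is a finite set of pairwise distinct lines; $\mathcal L_{i,i+1}$ is the set of lines traversing edge $(i,i+1)$; $[a,b]$ passes through station $i$ if $a<i<b$. The multiplicity of $\mathcal L$ is $k=\max_{1\le i<n}|\mathcal L_{i,i+1}|$. A layout specifies, for every edge, a top-to-bottom order of its lines at each of its two ends; two lines cross on an edge if their orders differ at the two ends; the crossing number counts (pair, edge) crossings. Admissible: lines passing through station $i$ keep the same relative order at the station-$i$ ends of edges $(i-1,i)$ and $(i,i+1)$. Periphery condition: each line $[a,b]$ is above all or below all lines passing through $a$ at the station-$a$ end of $(a,a+1)$, and above all or below all lines passing through $b$ at the station-$b$ end of $(b-1,b)$. MLCM-P\_PATH: given $n$ and $\mathcal L$, find an admissible layout satisfying the periphery condition with minimum crossing number. *)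

theory Defs
  imports Main
begin

section \<open>Lines on a path\<close>

text \<open>Stations are \<open>1, \<dots>, n\<close>; edge \<open>i\<close> stands for \<open>(i, i + 1)\<close> with \<open>1 \<le> i < n\<close>;
  the pair \<open>(a, b)\<close> stands for the line \<open>[a, b]\<close>.\<close>

type_synonym line = "nat \<times> nat"

definition line_set :: "nat \<Rightarrow> line set \<Rightarrow> bool" where
  "line_set n L \<longleftrightarrow> (\<forall>(a, b) \<in> L. 1 \<le> a \<and> a < b \<and> b \<le> n)"

definition lines_on :: "line set \<Rightarrow> nat \<Rightarrow> line set" where
  "lines_on L i = {(a, b) \<in> L. a \<le> i \<and> i + 1 \<le> b}"

definition passing :: "line set \<Rightarrow> nat \<Rightarrow> line set" where
  "passing L i = {(a, b) \<in> L. a < i \<and> i < b}"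

text \<open>The inserted \<open>0\<close> only matters for \<open>n = 1\<close>, where there are no edges.\<close>

definition multiplicity :: "nat \<Rightarrow> line set \<Rightarrow> nat" where
  "multiplicity n L = Max (insert 0 ((\<lambda>i. card (lines_on L i)) ` {1..<n}))"


section \<open>Layouts\<close>

text \<open>A layout maps edge \<open>i\<close> to the top-to-bottom orders of its lines at the station-\<open>i\<close> end
  and at the station-\<open>(i + 1)\<close> end. Values outside \<open>{1..<n}\<close> are irrelevant.\<close>

type_synonym layout = "nat \<Rightarrow> line list \<times> line list"

abbreviation left_order :: "layout \<Rightarrow> nat \<Rightarrow> line list" where
  "left_order \<pi> i \<equiv> fst (\<pi> i)"

abbreviation right_order :: "layout \<Rightarrow> nat \<Rightarrow> line list" where
  "right_order \<pi> i \<equiv> snd (\<pi> i)"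

definition is_layout :: "nat \<Rightarrow> line set \<Rightarrow> layout \<Rightarrow> bool" where
  "is_layout n L \<pi> \<longleftrightarrow> (\<forall>i \<in> {1..<n}.
     distinct (left_order \<pi> i) \<and> set (left_order \<pi> i) = lines_on L i \<and>
     distinct (right_order \<pi> i) \<and> set (right_order \<pi> i) = lines_on L i)"

definition above :: "'a list \<Rightarrow> 'a \<Rightarrow> 'a \<Rightarrow> bool" where
  "above xs x y \<longleftrightarrow> (\<exists>p q. p < q \<and> q < length xs \<and> xs ! p = x \<and> xs ! q = y)"

definition cross_on :: "layout \<Rightarrow> nat \<Rightarrow> line \<Rightarrow> line \<Rightarrow> bool" where
  "cross_on \<pi> i x y \<longleftrightarrow> above (left_order \<pi> i) x y \<noteq> above (right_order \<pi> i) x y"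

definition crossing_number :: "nat \<Rightarrow> line set \<Rightarrow> layout \<Rightarrow> nat" where
  "crossing_number n L \<pi> =
     (\<Sum>i \<in> {1..<n}. card {{x, y} | x y.
        x \<in> lines_on L i \<and> y \<in> lines_on L i \<and> x \<noteq> y \<and> cross_on \<pi> i x y})"

definition admissible :: "nat \<Rightarrow> line set \<Rightarrow> layout \<Rightarrow> bool" where
  "admissible n L \<pi> \<longleftrightarrow> (\<forall>i. 1 < i \<and> i < n \<longrightarrow> (\<forall>x \<in> passing L i. \<forall>y \<in> passing L i.
     above (right_order \<pi> (i - 1)) x y \<longleftrightarrow> above (left_order \<pi> i) x y))"

definition periphery :: "line set \<Rightarrow> layout \<Rightarrow> bool" where
  "periphery L \<pi> \<longleftrightarrow> (\<forall>(a, b) \<in> L.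
     ((\<forall>y \<in> passing L a. above (left_order \<pi> a) (a, b) y) \<or>
      (\<forall>y \<in> passing L a. above (left_order \<pi> a) y (a, b))) \<and>
     ((\<forall>y \<in> passing L b. above (right_order \<pi> (b - 1)) (a, b) y) \<or>
      (\<forall>y \<in> passing L b. above (right_order \<pi> (b - 1)) y (a, b))))"

definition feasible :: "nat \<Rightarrow> line set \<Rightarrow> layout \<Rightarrow> bool" where
  "feasible n L \<pi> \<longleftrightarrow> is_layout n L \<pi> \<and> admissible n L \<pi> \<and> periphery L \<pi>"

definition optimal :: "nat \<Rightarrow> line set \<Rightarrow> layout \<Rightarrow> bool" where
  "optimal n L \<pi> \<longleftrightarrow> feasible n L \<pi> \<and>
     (\<forall>\<pi>'. feasible n L \<pi>' \<longrightarrow> crossing_number n L \<pi> \<le> crossing_number n L \<pi>')"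


section \<open>Unit-cost random access machine\<close>

text \<open>Structured programs over numbered registers and an indirectly addressable memory. The only
  arithmetic is addition and truncated subtraction, so that after \<open>t\<close> steps numbers have grown by
  at most \<open>O(t)\<close> bits; unit-cost multiplication is deliberately absent.\<close>

datatype exp =
    Lit nat
  | Reg nat
  | Mem exp
  | Plus exp exp
  | Minus exp exp

datatype com =
    Skip
  | Assign nat exp
  | Store exp exp \<comment> \<open>address, value\<close>
  | Seq com com
  | IfLess exp exp com com
  | WhileLess exp exp com

text \<open>Register contents and memory contents.\<close>

type_synonym state = "(nat \<Rightarrow> nat) \<times> (nat \<Rightarrow> nat)"

fun val :: "exp \<Rightarrow> state \<Rightarrow> nat" where
  "val (Lit c) s = c"
| "val (Reg r) s = fst s r"
| "val (Mem e) s = snd s (val e s)"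
| "val (Plus e f) s = val e s + val f s"
| "val (Minus e f) s = val e s - val f s"

fun cost :: "exp \<Rightarrow> nat" where
  "cost (Lit c) = 1"
| "cost (Reg r) = 1"
| "cost (Mem e) = 1 + cost e"
| "cost (Plus e f) = 1 + cost e + cost f"
| "cost (Minus e f) = 1 + cost e + cost f"

text \<open>\<open>exec P s t s'\<close>: program \<open>P\<close> started in \<open>s\<close> halts in \<open>s'\<close> after \<open>t\<close> steps.\<close>

inductive exec :: "com \<Rightarrow> state \<Rightarrow> nat \<Rightarrow> state \<Rightarrow> bool" where
  Skip: "exec Skip s 1 s"
| Assign: "exec (Assign r e) s (1 + cost e) ((fst s)(r := val e s), snd s)"
| Store: "exec (Store e f) s (1 + cost e + cost f) (fst s, (snd s)(val e s := val f s))"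
| Seq: "exec P s t s' \<Longrightarrow> exec Q s' u s'' \<Longrightarrow> exec (Seq P Q) s (t + u) s''"
| IfTrue: "val e s < val f s \<Longrightarrow> exec P s t s' \<Longrightarrow>
    exec (IfLess e f P Q) s (1 + cost e + cost f + t) s'"
| IfFalse: "\<not> val e s < val f s \<Longrightarrow> exec Q s t s' \<Longrightarrow>
    exec (IfLess e f P Q) s (1 + cost e + cost f + t) s'"
| WhileFalse: "\<not> val e s < val f s \<Longrightarrow>
    exec (WhileLess e f P) s (1 + cost e + cost f) s"
| WhileTrue: "val e s < val f s \<Longrightarrow> exec P s t s' \<Longrightarrow> exec (WhileLess e f P) s' u s'' \<Longrightarrow>
    exec (WhileLess e f P) s (1 + cost e + cost f + t + u) s''"

inductive_cases SkipE: "exec Skip s t s'"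
inductive_cases AssignE: "exec (Assign r e) s t s'"
inductive_cases StoreE: "exec (Store e f) s t s'"
inductive_cases SeqE: "exec (Seq P Q) s t s'"
inductive_cases IfE: "exec (IfLess e f P Q) s t s'"
inductive_cases WhileE: "exec (WhileLess e f P) s t s'"

lemma exec_deterministic:
  "exec P s t s' \<Longrightarrow> exec P s u s'' \<Longrightarrow> u = t \<and> s'' = s'"
proof (induction arbitrary: u s'' rule: exec.induct)
  case (Skip s)
  then show ?case by (elim SkipE) simp
next
  case (Assign r e s)
  then show ?case by (elim AssignE) simp
next
  case (Store e f s)
  then show ?case by (elim StoreE) simp
next
  case (Seq P s t s' Q v s3)
  from Seq.prems obtain t' s1 v' where
    "u = t' + v'" and P: "exec P s t' s1" and Q: "exec Q s1 v' s''"
    by (elim SeqE) simp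
  moreover have "t' = t" "s1 = s'" using Seq.IH(1)[OF P] by simp_all
  moreover have "v' = v" "s'' = s3" using Seq.IH(2) Q \<open>s1 = s'\<close> by simp_all
  ultimately show ?case by simp
next
  case (IfTrue e s f P t s' Q)
  from IfTrue.prems IfTrue.hyps obtain t' where
    "u = 1 + cost e + cost f + t'" "exec P s t' s''"
    by (elim IfE) simp_all
  then show ?case using IfTrue.IH by simp
next
  case (IfFalse e s f Q t s' P)
  from IfFalse.prems IfFalse.hyps obtain t' where
    "u = 1 + cost e + cost f + t'" "exec Q s t' s''"
    by (elim IfE) simp_all
  then show ?case using IfFalse.IH by simp
next
  case (WhileFalse e s f P)
  from WhileFalse.prems show ?case
    by (rule WhileE) (use WhileFalse.hyps in simp_all)
next
  case (WhileTrue e s f P t s' v s3)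
  from WhileTrue.prems obtain t' s1 v' where
    "u = 1 + cost e + cost f + t' + v'" and P: "exec P s t' s1"
    and Q: "exec (WhileLess e f P) s1 v' s''"
    by (rule WhileE) (use WhileTrue.hyps(1) in simp_all)
  moreover have "t' = t" "s1 = s'" using WhileTrue.IH(1)[OF P] by simp_all
  moreover have "v' = v" "s'' = s3" using WhileTrue.IH(2) Q \<open>s1 = s'\<close> by simp_all
  ultimately show ?case by simp
qed

text \<open>The input word is written to memory from address 0 on; everything else is 0. On termination,
  register 0 holds the start address of the output word.\<close>

definition initial :: "nat list \<Rightarrow> state" where
  "initial w = ((\<lambda>_. 0), (\<lambda>p. if p < length w then w ! p else 0))"

definition outputs :: "state \<Rightarrow> nat list \<Rightarrow> bool" where
  "outputs s w \<longleftrightarrow> (\<forall>p < length w. snd s (fst s 0 + p) = w ! p)"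


section \<open>Search problems and their time complexity\<close>

text \<open>A search problem consists of its instances, an encoding of instances, and a relation between
  instances and encoded solutions.\<close>

type_synonym 'i problem = "'i set \<times> ('i \<Rightarrow> nat list) \<times> ('i \<Rightarrow> nat list \<Rightarrow> bool)"

definition solves_in_time :: "com \<Rightarrow> 'i problem \<Rightarrow> ('i \<Rightarrow> nat) \<Rightarrow> bool" where
  "solves_in_time P \<Pi> T \<longleftrightarrow> (case \<Pi> of (I, enc, sol) \<Rightarrow>
     \<forall>x \<in> I. \<exists>t s'. exec P (initial (enc x)) t s' \<and> t \<le> T x \<and> (\<exists>w. sol x w \<and> outputs s' w))"

definition solvable_in_bigo_time :: "'i problem \<Rightarrow> ('i \<Rightarrow> nat) \<Rightarrow> bool" where
  "solvable_in_bigo_time \<Pi> T \<longleftrightarrow> (\<exists>P c. solves_in_time P \<Pi> (\<lambda>x. c * T x))"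

definition fixed_parameter_tractable ::
    "'i problem \<Rightarrow> ('i \<Rightarrow> nat) \<Rightarrow> ('i \<Rightarrow> nat) \<Rightarrow> bool" where
  "fixed_parameter_tractable \<Pi> sz param \<longleftrightarrow>
     (\<exists>P f d. solves_in_time P \<Pi> (\<lambda>x. f (param x) * sz x ^ d))"


section \<open>The problem MLCM-P on paths\<close>

text \<open>An instance is the number of stations together with an arbitrary enumeration of the lines.\<close>

type_synonym mlcm_instance = "nat \<times> line list"

definition mlcm_instances :: "mlcm_instance set" where
  "mlcm_instances = {(n, ls). 1 \<le> n \<and> distinct ls \<and> line_set n (set ls)}"

definition encode_lines :: "line list \<Rightarrow> nat list" where
  "encode_lines ls = concat (map (\<lambda>(a, b). [a, b]) ls)"

fun encode_instance :: "mlcm_instance \<Rightarrow> nat list" where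
  "encode_instance (n, ls) = n # length ls # encode_lines ls"

text \<open>Edge by edge from left to right: the number of lines on the edge, their order at the left
  end, their order at the right end.\<close>

definition encode_layout :: "nat \<Rightarrow> layout \<Rightarrow> nat list" where
  "encode_layout n \<pi> = concat (map (\<lambda>i. length (left_order \<pi> i) #
     encode_lines (left_order \<pi> i) @ encode_lines (right_order \<pi> i)) [1..<n])"

fun mlcm_solution :: "mlcm_instance \<Rightarrow> nat list \<Rightarrow> bool" where
  "mlcm_solution (n, ls) w \<longleftrightarrow> (\<exists>\<pi>. optimal n (set ls) \<pi> \<and> w = encode_layout n \<pi>)"

definition MLCM_P_PATH :: "mlcm_instance problem" where
  "MLCM_P_PATH = (mlcm_instances, encode_instance, mlcm_solution)"

fun stations :: "mlcm_instance \<Rightarrow> nat" where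
  "stations (n, ls) = n"

fun instance_multiplicity :: "mlcm_instance \<Rightarrow> nat" where
  "instance_multiplicity (n, ls) = multiplicity n (set ls)"

text \<open>The path is an explicit part of the input, so its stations count towards the size although
  the encoding represents the path by the single number \<open>n\<close>.\<close>

fun instance_size :: "mlcm_instance \<Rightarrow> nat" where
  "instance_size (n, ls) = n + length ls"

end

theory Submission
  imports Defs
begin

text \<open>
  Fix for every line whether it starts above or below the lines passing through its first station.
  This determines the order of any two lines at the start of their common part, except for lines
  with the same first station and the same side, whose order stays free. A line \<open>x\<close> ending at
  station \<open>b\<close> then crosses either all lines through \<open>b\<close> that started above it or all that started
  below it, so every feasible layout has at least as many crossings as the sum over all lines of the
  smaller of these two numbers. Conversely, letting every line go to its cheaper side attains this
  sum: of two lines ending at \<open>b\<close> the upper one has fewer lines above and more lines below, so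
  the two do not cross, and lines of the same group are sorted by their ends.

  It remains to minimise the sum over all choices of sides. The cost of the lines ending at station
  \<open>i + 1\<close> depends only on the sides of the at most \<open>k\<close> lines on edge \<open>i\<close>, which gives a dynamic
  program with at most \<open>2 ^ k\<close> states per edge and \<open>O(k\<^sup>2)\<close> time per state. It is written in a small
  language of bounded loops over variables and arrays, which is compiled to the random access machine.
\<close>

section \<open>A language of bounded loops\<close>

text \<open>A line starting at station a gets the key n - a (above) or n + a (below), because a
  later start lies outside all lines passing there. This single key orders the left ends of all
  edges, so admissibility comes for free and only lines about to end leave the common order. In the
  lower bound every pair is charged to the line that ends first, so no pair counts twice, however
  often it crosses. Between two edges only the sides of the lines passing the common station matter:
  a table row has one entry per subset of these, and a transition runs through all subsets of the
  lines on the edge. With addition and truncated subtraction as the only arithmetic, masks are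
  decoded by comparison with powers of two obtained by doubling, lexicographic keys are compared
  componentwise instead of being packed into one number, and sorting is done by counting ranks.
  Memory starts as zero and rows are laid out consecutively without reuse, so 0 can mark unset
  entries and nothing is ever cleared. The work per mask is quadratic in k, so the cubic factor of
  the bound leaves room to spare.\<close>

datatype lexp =
    Num nat
  | Var nat
  | Arr nat lexp
  | Add lexp lexp (infixl "\<oplus>" 65)
  | Sub lexp lexp (infixl "\<ominus>" 65)

datatype lcom =
    Nop
  | SetVar nat lexp (infix "::=" 61)
  | SetArr nat lexp lexp ("_[_] ::= _" [1000, 0, 61] 61)
  | Then lcom lcom (infixr ";;" 60)
  | Cond lexp lexp lcom lcom
  | For nat nat lexp lcom

datatype lstate = State (var: "nat \<Rightarrow> nat") (arr: "nat \<Rightarrow> nat \<Rightarrow> nat")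

definition upd_var :: "nat \<Rightarrow> nat \<Rightarrow> lstate \<Rightarrow> lstate" where
  "upd_var r v s = State ((var s)(r := v)) (arr s)"

definition upd_arr :: "nat \<Rightarrow> nat \<Rightarrow> nat \<Rightarrow> lstate \<Rightarrow> lstate" where
  "upd_arr c i v s = State (var s) ((arr s)(c := (arr s c)(i := v)))"

lemma upd_simps [simp]:
  "var (upd_var r v s) = (var s)(r := v)" "arr (upd_var r v s) = arr s"
  "var (upd_arr c i v s) = var s" "arr (upd_arr c i v s) = (arr s)(c := (arr s c)(i := v))"
  by (simp_all add: upd_var_def upd_arr_def)

primrec lval :: "lexp \<Rightarrow> lstate \<Rightarrow> nat" where
  "lval (Num c) s = c"
| "lval (Var r) s = var s r"
| "lval (Arr c e) s = arr s c (lval e s)"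
| "lval (Add e f) s = lval e s + lval f s"
| "lval (Sub e f) s = lval e s - lval f s"

text \<open>The constants of \<open>Arr\<close> come from the compiled address: five doublings copy
  the index expression 32 times, so the cost of nested accesses multiplies.\<close>

primrec lcost :: "lexp \<Rightarrow> nat" where
  "lcost (Num c) = 1"
| "lcost (Var r) = 1"
| "lcost (Arr c e) = 35 + 32 * lcost e + 1"
| "lcost (Add e f) = 1 + lcost e + lcost f"
| "lcost (Sub e f) = 1 + lcost e + lcost f"

primrec loop :: "nat \<Rightarrow> (lstate \<Rightarrow> lstate) \<Rightarrow> nat \<Rightarrow> lstate \<Rightarrow> lstate" where
  "loop r f 0 s = upd_var r 0 s"
| "loop r f (Suc i) s = upd_var r (Suc i) (f (loop r f i s))"

primrec run :: "lcom \<Rightarrow> lstate \<Rightarrow> lstate" where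
  "run Nop = (\<lambda>s. s)"
| "run (SetVar r e) = (\<lambda>s. upd_var r (lval e s) s)"
| "run (SetArr c e f) = (\<lambda>s. upd_arr c (lval e s) (lval f s) s)"
| "run (Then P Q) = (\<lambda>s. run Q (run P s))"
| "run (Cond e f P Q) = (\<lambda>s. if lval e s < lval f s then run P s else run Q s)"
| "run (For r q e P) = (\<lambda>s. loop r (run P) (lval e s) (upd_var q (lval e s) s))"

text \<open>These are exact running times of the compiled code, not bounds. A loop pays
  \<open>1 + lcost e\<close> for its limit, 2 for clearing the counter and 3 for the failing test;
  each round pays 3 for the test and 4 for the increment.\<close>

primrec time :: "lcom \<Rightarrow> lstate \<Rightarrow> nat" where
  "time Nop = (\<lambda>s. 1)"
| "time (SetVar r e) = (\<lambda>s. 1 + lcost e)"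
| "time (SetArr c e f) = (\<lambda>s. 36 + 32 * lcost e + lcost f)"
| "time (Then P Q) = (\<lambda>s. time P s + time Q (run P s))"
| "time (Cond e f P Q) = (\<lambda>s. 1 + lcost e + lcost f + (if lval e s < lval f s then time P s else time Q s))"
| "time (For r q e P) = (\<lambda>s. 6 + lcost e +
     (\<Sum>i<lval e s. 7 + time P (loop r (run P) i (upd_var q (lval e s) s))))"

primrec written_vars :: "lcom \<Rightarrow> nat set" where
  "written_vars Nop = {}"
| "written_vars (SetVar r e) = {r}"
| "written_vars (SetArr c e f) = {}"
| "written_vars (Then P Q) = written_vars P \<union> written_vars Q"
| "written_vars (Cond e f P Q) = written_vars P \<union> written_vars Q"
| "written_vars (For r q e P) = {r, q} \<union> written_vars P"

primrec written_arrs :: "lcom \<Rightarrow> nat set" where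
  "written_arrs Nop = {}"
| "written_arrs (SetVar r e) = {}"
| "written_arrs (SetArr c e f) = {c}"
| "written_arrs (Then P Q) = written_arrs P \<union> written_arrs Q"
| "written_arrs (Cond e f P Q) = written_arrs P \<union> written_arrs Q"
| "written_arrs (For r q e P) = written_arrs P"

primrec wf_exp :: "lexp \<Rightarrow> bool" where
  "wf_exp (Num c) = True"
| "wf_exp (Var r) = True"
| "wf_exp (Arr c e) = (c < 32 \<and> wf_exp e)"
| "wf_exp (Add e f) = (wf_exp e \<and> wf_exp f)"
| "wf_exp (Sub e f) = (wf_exp e \<and> wf_exp f)"

text \<open>Variable 1 is reserved for the base address of the arrays.\<close>

primrec wf_com :: "lcom \<Rightarrow> bool" where
  "wf_com Nop = True"
| "wf_com (SetVar r e) = (r \<noteq> 1 \<and> wf_exp e)"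
| "wf_com (SetArr c e f) = (c < 32 \<and> wf_exp e \<and> wf_exp f)"
| "wf_com (Then P Q) = (wf_com P \<and> wf_com Q)"
| "wf_com (Cond e f P Q) = (wf_exp e \<and> wf_exp f \<and> wf_com P \<and> wf_com Q)"
| "wf_com (For r q e P) = (r \<noteq> 1 \<and> q \<noteq> 1 \<and> r \<noteq> q \<and> r \<notin> written_vars P \<and> q \<notin> written_vars P \<and> wf_exp e \<and> wf_com P)"

lemma run_frame:
  "(r \<notin> written_vars P \<longrightarrow> var (run P s) r = var s r) \<and> (c \<notin> written_arrs P \<longrightarrow> arr (run P s) c = arr s c)"
proof (induction P arbitrary: s)
  case (For x q e P)
  have "(r \<notin> insert x (written_vars P) \<longrightarrow> var (loop x (run P) i t) r = var t r) \<and>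
     (c \<notin> written_arrs P \<longrightarrow> arr (loop x (run P) i t) c = arr t c)" for i t
    by (induction i) (use For in auto)
  then show ?case by auto
qed auto

lemma run_frame_var [simp]: "r \<notin> written_vars P \<Longrightarrow> var (run P s) r = var s r"
  and run_frame_arr [simp]: "c \<notin> written_arrs P \<Longrightarrow> arr (run P s) c = arr s c"
  using run_frame by blast+

lemma loop_frame_var: "x \<notin> insert r (written_vars P) \<Longrightarrow> var (loop r (run P) i s) x = var s x"
  and loop_frame_arr: "c \<notin> written_arrs P \<Longrightarrow> arr (loop r (run P) i s) c = arr s c"
  by (induction i) auto

lemma loop_counter: "var (loop r f i s) r = i"
  by (induction i) auto

text \<open>The rule behind every loop below. The frame facts offered to \<open>step\<close> cover
  all variables and arrays that the body does not write, so an invariant has to mention only what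
  changes; \<open>T\<close> bounds every single round.\<close>

lemma For_rule:
  assumes r: "r \<noteq> q" "q \<notin> written_vars P" and N: "lval e s = N"
    and init: "Inv 0 (upd_var r 0 (upd_var q N s))"
    and step: "\<And>i t. i < N \<Longrightarrow> Inv i t \<Longrightarrow> var t r = i \<Longrightarrow> var t q = N \<Longrightarrow>
      \<forall>x. x \<notin> insert r (insert q (written_vars P)) \<longrightarrow> var t x = var s x \<Longrightarrow>
      \<forall>c. c \<notin> written_arrs P \<longrightarrow> arr t c = arr s c \<Longrightarrow>
      Inv (Suc i) (upd_var r (Suc i) (run P t)) \<and> time P t \<le> T"
  shows "Inv N (run (For r q e P) s) \<and> time (For r q e P) s \<le> 6 + lcost e + N * (7 + T)"
proof -
  let ?s = "upd_var q N s"
  let ?l = "\<lambda>i. loop r (run P) i ?s"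
  have fr: "\<forall>x. x \<notin> insert r (insert q (written_vars P)) \<longrightarrow> var (?l i) x = var s x"
     "\<forall>c. c \<notin> written_arrs P \<longrightarrow> arr (?l i) c = arr s c" "var (?l i) q = N" "var (?l i) r = i" for i
    using r by (auto simp: loop_frame_var loop_frame_arr loop_counter)
  have I: "i \<le> N \<Longrightarrow> Inv i (?l i)" for i
  proof (induction i)
    case 0 then show ?case using init by simp
  next
    case (Suc i)
    then show ?case using step[of i "?l i"] fr[of i] by simp
  qed
  have "(\<Sum>i<N. 7 + time P (?l i)) \<le> (\<Sum>i<N. 7 + T)"
    by (intro sum_mono) (use step I fr in auto)
  then show ?thesis using I[of N] N by simp
qed

subsection \<open>Compilation\<close>

text \<open>Array \<open>c < 32\<close> occupies the addresses \<open>base + c + 32 * i\<close>. Interleaving makes every array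
  infinite, so no access needs a bound; the factor 32 costs five doublings.\<close>

abbreviation dbl :: "exp \<Rightarrow> exp" where "dbl e \<equiv> Plus e e"

definition addr :: "nat \<Rightarrow> exp \<Rightarrow> exp" where
  "addr c e = Plus (Reg 1) (Plus (Lit c) (dbl (dbl (dbl (dbl (dbl e))))))"

lemma val_addr [simp]: "val (addr c e) s = fst s 1 + (c + 32 * val e s)"
  by (simp add: addr_def)

lemma cost_addr [simp]: "cost (addr c e) = 35 + 32 * cost e"
  by (simp add: addr_def)

primrec compile_exp :: "lexp \<Rightarrow> exp" where
  "compile_exp (Num c) = Lit c"
| "compile_exp (Var r) = Reg r"
| "compile_exp (Arr c e) = Mem (addr c (compile_exp e))"
| "compile_exp (Add e f) = Plus (compile_exp e) (compile_exp f)"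
| "compile_exp (Sub e f) = Minus (compile_exp e) (compile_exp f)"

primrec compile :: "lcom \<Rightarrow> com" where
  "compile Nop = Skip"
| "compile (SetVar r e) = Assign r (compile_exp e)"
| "compile (SetArr c e f) = Store (addr c (compile_exp e)) (compile_exp f)"
| "compile (Then P Q) = Seq (compile P) (compile Q)"
| "compile (Cond e f P Q) = IfLess (compile_exp e) (compile_exp f) (compile P) (compile Q)"
| "compile (For r q e P) = Seq (Assign q (compile_exp e)) (Seq (Assign r (Lit 0))
     (WhileLess (Reg r) (Reg q) (Seq (compile P) (Assign r (Plus (Reg r) (Lit 1))))))"

text \<open>Nothing is said about addresses below the base kept in register 1; the input word stays
  there.\<close>

definition represents :: "state \<Rightarrow> lstate \<Rightarrow> bool" where
  "represents s h \<longleftrightarrow> fst s = var h \<and> (\<forall>c<32. \<forall>i. snd s (var h 1 + (c + 32 * i)) = arr h c i)"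

lemma cost_compile_exp [simp]: "cost (compile_exp e) = lcost e"
  by (induction e) auto

lemma val_compile_exp: "wf_exp e \<Longrightarrow> represents s h \<Longrightarrow> val (compile_exp e) s = lval e h"
  by (induction e) (auto simp: represents_def)

lemma index_inject: "(c::nat) < 32 \<Longrightarrow> d < 32 \<Longrightarrow> c + 32 * i = d + 32 * j \<longleftrightarrow> c = d \<and> i = j"
  by (metis add_right_cancel mod_less mod_mult_self2 mult_left_cancel add_left_cancel zero_neq_numeral)

lemma represents_upd_arr:
  assumes "represents s h" "c < 32"
  shows "represents (fst s, (snd s)(var h 1 + (c + 32 * i) := v)) (upd_arr c i v h)"
  using assms by (auto simp: represents_def index_inject)

lemma represents_upd_var:
  "represents s h \<Longrightarrow> r \<noteq> 1 \<Longrightarrow> represents ((fst s)(r := v), snd s) (upd_var r v h)"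
  by (auto simp: represents_def)

lemma exec_increment:
  "exec (Assign r (Plus (Reg r) (Lit 1))) s 4 ((fst s)(r := Suc (fst s r)), snd s)"
  using exec.Assign[of r "Plus (Reg r) (Lit 1)" s] by (simp add: numeral_eq_Suc)

text \<open>The induction runs over the number of rounds still to come, because
  \<open>WhileTrue\<close> executes the body first and appends the rest of the loop.\<close>

lemma exec_while:
  assumes init: "Inv 0 s"
    and step: "\<And>i s. i < N \<Longrightarrow> Inv i s \<Longrightarrow>
      fst s r < fst s q \<and> (\<exists>s'. exec P s (T i) s' \<and> Inv (Suc i) s')"
    and final: "\<And>s. Inv N s \<Longrightarrow> \<not> fst s r < fst s q"
  shows "\<exists>s'. exec (WhileLess (Reg r) (Reg q) P) s (3 + (\<Sum>i<N. 3 + T i)) s' \<and> Inv N s'"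
proof -
  have "j \<le> N \<Longrightarrow> Inv (N - j) s \<Longrightarrow>
      \<exists>s'. exec (WhileLess (Reg r) (Reg q) P) s (3 + (\<Sum>i=N-j..<N. 3 + T i)) s' \<and> Inv N s'" for j s
  proof (induction j arbitrary: s)
    case 0
    then show ?case using exec.WhileFalse[of "Reg r" s "Reg q" P] final
      by (intro exI[of _ s]) (simp add: numeral_eq_Suc)
  next
    case (Suc j)
    let ?i = "N - Suc j"
    have i: "?i < N" "Suc ?i = N - j" using Suc.prems by auto
    obtain s1 where s1: "exec P s (T ?i) s1" "Inv (N - j) s1"
      using step[OF i(1) Suc.prems(2)] i(2) by auto
    obtain s' where
      s': "exec (WhileLess (Reg r) (Reg q) P) s1 (3 + (\<Sum>i=N-j..<N. 3 + T i)) s'" "Inv N s'"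
      using Suc.IH[OF _ s1(2)] Suc.prems by auto
    have "exec (WhileLess (Reg r) (Reg q) P) s
        (1 + cost (Reg r) + cost (Reg q) + T ?i + (3 + (\<Sum>i=N-j..<N. 3 + T i))) s'"
      by (rule exec.WhileTrue[OF _ s1(1) s'(1)]) (use step[OF i(1) Suc.prems(2)] in simp)
    moreover have "(\<Sum>i=?i..<N. 3 + T i) = 3 + T ?i + (\<Sum>i=N-j..<N. 3 + T i)"
      using i by (simp add: sum.atLeast_Suc_lessThan)
    then have "1 + cost (Reg r) + cost (Reg q) + T ?i + (3 + (\<Sum>i=N-j..<N. 3 + T i)) =
        3 + (\<Sum>i=?i..<N. 3 + T i)" by simp
    ultimately show ?case using s'(2) by metis
  qed
  from this[of N s] show ?thesis using init by (simp add: atLeast0LessThan)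
qed

lemma exec_compile:
  "wf_com P \<Longrightarrow> represents s h \<Longrightarrow> \<exists>s'. exec (compile P) s (time P h) s' \<and> represents s' (run P h)"
proof (induction P arbitrary: s h)
  case Nop
  then show ?case using exec.Skip[of s] by (intro exI[of _ s]) simp
next
  case (SetVar r e)
  then show ?case
    using exec.Assign[of r "compile_exp e" s] represents_upd_var[OF SetVar(2), of r "lval e h"]
    by (intro exI[of _ "((fst s)(r := lval e h), snd s)"]) (simp add: val_compile_exp)
next
  case (SetArr c e f)
  then have "fst s 1 = var h 1" by (simp add: represents_def)
  with SetArr show ?case
    using exec.Store[of "addr c (compile_exp e)" "compile_exp f" s] represents_upd_arr[OF SetArr(2), of c "lval e h" "lval f h"]
    by (intro exI[of _ "(fst s, (snd s)(var h 1 + (c + 32 * lval e h) := lval f h))"])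
      (simp add: val_compile_exp add_ac)
next
  case (Then P Q)
  then obtain s1 where 1: "exec (compile P) s (time P h) s1" "represents s1 (run P h)"
    by (metis wf_com.simps(4))
  with Then obtain s2 where "exec (compile Q) s1 (time Q (run P h)) s2" "represents s2 (run Q (run P h))"
    by (metis wf_com.simps(4))
  then show ?case using exec.Seq[OF 1(1)] by (intro exI[of _ s2]) simp
next
  case (Cond e f P Q)
  have v: "val (compile_exp e) s = lval e h" "val (compile_exp f) s = lval f h" using Cond.prems by (auto simp: val_compile_exp)
  show ?case
  proof (cases "lval e h < lval f h")
    case True
    then obtain s' where "exec (compile P) s (time P h) s'" "represents s' (run P h)"
      using Cond by (metis wf_com.simps(5))
    then show ?thesis using True exec.IfTrue[of "compile_exp e" s "compile_exp f" "compile P" "time P h" s' "compile Q"] v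
      by (intro exI[of _ s']) simp
  next
    case False
    then obtain s' where "exec (compile Q) s (time Q h) s'" "represents s' (run Q h)"
      using Cond by (metis wf_com.simps(5))
    then show ?thesis using False exec.IfFalse[of "compile_exp e" s "compile_exp f" "compile Q" "time Q h" s' "compile P"] v
      by (intro exI[of _ s']) simp
  qed
next
  case (For r q e P)
  define N where "N = lval e h"
  define l where "l i = loop r (run P) i (upd_var q N h)" for i
  have w: "r \<noteq> 1" "q \<noteq> 1" "r \<noteq> q" "r \<notin> written_vars P" "q \<notin> written_vars P" "wf_com P" "wf_exp e" using For.prems by auto
  have lr: "var (l i) r = i" "var (l i) q = N" for i
    using w by (auto simp: l_def loop_frame_var loop_counter)
  define s1 where "s1 = ((fst s)(q := N), snd s)"
  have s1: "exec (Assign q (compile_exp e)) s (1 + lcost e) s1" 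
    using exec.Assign[of q "compile_exp e" s] val_compile_exp[OF w(7) For.prems(2)] by (simp add: s1_def N_def)
  define s2 where "s2 = ((fst s1)(r := 0), snd s1)"
  have s2: "exec (Assign r (Lit 0)) s1 2 s2" 
    using exec.Assign[of r "Lit 0" s1] by (simp add: s2_def numeral_eq_Suc)
  have r2: "represents s2 (l 0)"
    unfolding s2_def s1_def l_def loop.simps using w For.prems by (intro represents_upd_var) auto
  let ?B = "Seq (compile P) (Assign r (Plus (Reg r) (Lit 1)))"
  have body: "\<exists>t'. exec ?B t (time P (l i) + 4) t' \<and> represents t' (l (Suc i))" if rep: "represents t (l i)" for t i
  proof -
    obtain t' where t': "exec (compile P) t (time P (l i)) t'" "represents t' (run P (l i))"
      using For.IH[OF w(6) rep] by blast
    have "fst t' r = i" using t'(2) lr(1)[of i] w by (simp add: represents_def)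
    then have "exec (Assign r (Plus (Reg r) (Lit 1))) t' 4 ((fst t')(r := Suc i), snd t')"
      using exec_increment[of r t'] by simp
    then show ?thesis using t' represents_upd_var[OF t'(2) w(1), of "Suc i"]
      by (intro exI conjI) (rule exec.Seq, assumption+, simp add: l_def)
  qed
  have "\<exists>s'. exec (WhileLess (Reg r) (Reg q) ?B) s2 (3 + (\<Sum>i<N. 3 + (time P (l i) + 4))) s' \<and>
      represents s' (l N)"
  proof (rule exec_while[where Inv = "\<lambda>i t. represents t (l i)"])
    fix i t assume "i < N" "represents t (l i)"
    then show "fst t r < fst t q \<and> (\<exists>s'. exec ?B t (time P (l i) + 4) s' \<and> represents s' (l (Suc i)))"
      using body lr by (simp add: represents_def)
  qed (use r2 lr in \<open>simp_all add: represents_def\<close>)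
  then obtain s3 where s3: "exec (WhileLess (Reg r) (Reg q) ?B) s2 (3 + (\<Sum>i<N. 3 + (time P (l i) + 4))) s3"
    "represents s3 (l N)" by blast
  have "exec (compile (For r q e P)) s ((1 + lcost e) + (2 + (3 + (\<Sum>i<N. 3 + (time P (l i) + 4))))) s3"
    unfolding compile.simps by (intro exec.Seq[OF s1] exec.Seq[OF s2] s3(1))
  moreover have "(1 + lcost e) + (2 + (3 + (\<Sum>i<N. 3 + (time P (l i) + 4)))) = time (For r q e P) h"
    by (simp add: N_def l_def add_ac numeral_eq_Suc)
  moreover have "represents s3 (run (For r q e P) h)" using s3(2) by (simp add: l_def N_def)
  ultimately show ?case by metis
qed

declare run.simps(6) [simp del] time.simps(6) [simp del]

section \<open>Orders given by keys\<close>

lemma above_sorted: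
  assumes "sorted_wrt (<) (map f xs)" "x \<in> set xs" "y \<in> set xs"
  shows "above xs x y \<longleftrightarrow> f x < (f y :: nat)"
proof
  assume "above xs x y"
  then obtain p q where "p < q" "q < length xs" "xs ! p = x" "xs ! q = y" by (auto simp: above_def)
  then show "f x < f y" using sorted_wrt_nth_less[OF assms(1), of p q] by simp
next
  assume less: "f x < f y"
  obtain p q where pq: "p < length xs" "xs ! p = x" "q < length xs" "xs ! q = y"
    using assms(2,3) by (metis in_set_conv_nth)
  have "p < q"
  proof (rule ccontr)
    assume "\<not> p < q"
    then have "q < p \<or> q = p" by auto
    then show False using sorted_wrt_nth_less[OF assms(1), of q p] pq less by auto
  qed
  then show "above xs x y" using pq by (auto simp: above_def)
qed

lemma sorted_wrt_sort_key:
  assumes "distinct xs" "inj_on f (set xs)"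
  shows "sorted_wrt (<) (map (f :: _ \<Rightarrow> nat) (sort_key f xs))"
  using assms by (simp add: strict_sorted_iff distinct_map)

lemma above_sort_key:
  assumes "distinct xs" "inj_on f (set xs)" "x \<in> set xs" "y \<in> set xs"
  shows "above (sort_key f xs) x y \<longleftrightarrow> f x < (f y :: nat)"
  using above_sorted[OF sorted_wrt_sort_key[OF assms(1,2)]] assms by simp

lemma above_trans:
  assumes "distinct xs" "above xs x y" "above xs y z" shows "above xs x z"
proof -
  from assms(2,3) obtain p q q' r where "p < q" "q < length xs" "xs ! p = x" "xs ! q = y"
     "q' < r" "r < length xs" "xs ! q' = y" "xs ! r = z" by (auto simp: above_def)
  moreover from this have "q = q'" using assms(1) nth_eq_iff_index_eq[of xs q q'] by simp
  ultimately show ?thesis unfolding above_def by (intro exI[of _ p] exI[of _ r]) simp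
qed

lemma above_asym:
  assumes "distinct xs" "above xs x y" shows "\<not> above xs y x"
proof
  assume "above xs y x"
  then have "above xs x x" using above_trans assms by metis
  then show False using assms(1) by (auto simp: above_def nth_eq_iff_index_eq)
qed

section \<open>Assignments of line starts\<close>

text \<open>Keys grow from top to bottom, and \<open>\<sigma> x\<close> means that \<open>x\<close>
  starts below. The distance from \<open>n\<close> is the starting station, so later starts are
  further out. Two lines of the instance share a key only if they have the same first station and
  the same side.\<close>

definition start_key :: "nat \<Rightarrow> (line \<Rightarrow> bool) \<Rightarrow> line \<Rightarrow> nat" where
  "start_key n \<sigma> x = (if \<sigma> x then n + fst x else n - fst x)"

definition passing_above :: "nat \<Rightarrow> line set \<Rightarrow> (line \<Rightarrow> bool) \<Rightarrow> line \<Rightarrow> line set" where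
  "passing_above n L \<sigma> x = {y \<in> passing L (snd x). start_key n \<sigma> y < start_key n \<sigma> x}"

definition passing_below :: "nat \<Rightarrow> line set \<Rightarrow> (line \<Rightarrow> bool) \<Rightarrow> line \<Rightarrow> line set" where
  "passing_below n L \<sigma> x = {y \<in> passing L (snd x). start_key n \<sigma> x < start_key n \<sigma> y}"

definition line_cost :: "nat \<Rightarrow> line set \<Rightarrow> (line \<Rightarrow> bool) \<Rightarrow> line \<Rightarrow> nat" where
  "line_cost n L \<sigma> x = min (card (passing_above n L \<sigma> x)) (card (passing_below n L \<sigma> x))"

definition ends_below :: "nat \<Rightarrow> line set \<Rightarrow> (line \<Rightarrow> bool) \<Rightarrow> line \<Rightarrow> bool" where
  "ends_below n L \<sigma> x \<longleftrightarrow> card (passing_below n L \<sigma> x) < card (passing_above n L \<sigma> x)"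

text \<open>Orders lines with equal start keys. Lines leaving at the top get values up to
  \<open>n\<close> by increasing end, lines leaving at the bottom values from \<open>n\<close> on by
  decreasing end, so in either half the first to end is outermost. The halves meet only at
  \<open>n\<close>, where both lines end at station \<open>n\<close>; hence keys separate lines with
  different ends.\<close>

definition end_key :: "nat \<Rightarrow> line set \<Rightarrow> (line \<Rightarrow> bool) \<Rightarrow> line \<Rightarrow> nat" where
  "end_key n L \<sigma> x = (if ends_below n L \<sigma> x then (n + n) - snd x else snd x)"

text \<open>A lexicographic pair packed into one number; the base \<open>2 * n + 1\<close> exceeds
  both components.\<close>

definition left_key :: "nat \<Rightarrow> line set \<Rightarrow> (line \<Rightarrow> bool) \<Rightarrow> line \<Rightarrow> nat" where
  "left_key n L \<sigma> x = start_key n \<sigma> x * (2 * n + 1) + end_key n L \<sigma> x"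

text \<open>As leading component of \<open>right_key\<close> it moves only the lines ending at
  station \<open>i + 1\<close>, to the top (0) or to the bottom (2); within each of the three
  classes the left order is kept.\<close>

definition side_key :: "nat \<Rightarrow> line set \<Rightarrow> (line \<Rightarrow> bool) \<Rightarrow> nat \<Rightarrow> line \<Rightarrow> nat" where
  "side_key n L \<sigma> i x = (if snd x = i + 1 then if ends_below n L \<sigma> x then 2 else 0 else 1)"

definition right_key :: "nat \<Rightarrow> line set \<Rightarrow> (line \<Rightarrow> bool) \<Rightarrow> nat \<Rightarrow> line \<Rightarrow> nat" where
  "right_key n L \<sigma> i x = side_key n L \<sigma> i x * ((2 * n + 1) * (2 * n + 1)) + left_key n L \<sigma> x"

lemma lex_less:
  assumes "(h::nat) < K" "h' < K"
  shows "g * K + h < g' * K + h' \<longleftrightarrow> g < g' \<or> g = g' \<and> h < h'"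
proof -
  have *: "a * K + h < b * K + h'" if "a < b" "h < K" for a b h h'
  proof -
    have "a * K + h < Suc a * K" using that by simp
    also have "\<dots> \<le> b * K" using that by (intro mult_le_mono1) simp
    finally show ?thesis by simp
  qed
  show ?thesis using *[of g g' h h'] *[of g' g h' h] assms
    by (cases g g' rule: linorder_cases) auto
qed

locale path_lines =
  fixes n :: nat and L :: "line set"
  assumes lines: "line_set n L"
begin

lemma line_bounds: "x \<in> L \<Longrightarrow> 1 \<le> fst x \<and> fst x < snd x \<and> snd x \<le> n"
  using lines by (auto simp: line_set_def)

lemma finite_lines: "finite L"
proof -
  have "L \<subseteq> {..n} \<times> {..n}" using line_bounds by fastforce
  then show ?thesis by (rule finite_subset) simp
qed

lemma passing_iff: "x \<in> passing L i \<longleftrightarrow> x \<in> L \<and> fst x < i \<and> i < snd x"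
  by (auto simp: passing_def)

lemma lines_on_iff: "x \<in> lines_on L i \<longleftrightarrow> x \<in> L \<and> fst x \<le> i \<and> i < snd x"
  by (auto simp: lines_on_def)

lemma finite_passing: "finite (passing L i)" and finite_lines_on: "finite (lines_on L i)"
  using finite_lines by (auto intro: finite_subset[of _ L] simp: passing_def lines_on_def)

lemma start_key_eqD:
  "x \<in> L \<Longrightarrow> y \<in> L \<Longrightarrow> start_key n \<sigma> x = start_key n \<sigma> y \<Longrightarrow> fst x = fst y"
  using line_bounds[of x] line_bounds[of y] by (auto simp: start_key_def split: if_splits)

lemma start_key_less: "x \<in> L \<Longrightarrow> start_key n \<sigma> x < 2 * n + 1"
  using line_bounds[of x] by (auto simp: start_key_def)

lemma end_key_less: "x \<in> L \<Longrightarrow> end_key n L \<sigma> x < 2 * n + 1"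
  using line_bounds[of x] by (auto simp: end_key_def)

lemma left_key_less_iff:
  assumes "x \<in> L" "y \<in> L"
  shows "left_key n L \<sigma> x < left_key n L \<sigma> y \<longleftrightarrow> start_key n \<sigma> x < start_key n \<sigma> y \<or>
    start_key n \<sigma> x = start_key n \<sigma> y \<and> end_key n L \<sigma> x < end_key n L \<sigma> y"
  unfolding left_key_def using assms by (intro lex_less end_key_less)

lemma left_key_less: assumes "x \<in> L" shows "left_key n L \<sigma> x < (2 * n + 1) * (2 * n + 1)"
proof -
  have "left_key n L \<sigma> x < (2 * n) * (2 * n + 1) + (2 * n + 1)"
    unfolding left_key_def using start_key_less[OF assms, of \<sigma>] end_key_less[OF assms, of \<sigma>]
    by (intro add_le_less_mono mult_le_mono1) auto
  then show ?thesis by (simp add: algebra_simps)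
qed

lemma right_key_less_iff:
  assumes "x \<in> L" "y \<in> L"
  shows "right_key n L \<sigma> i x < right_key n L \<sigma> i y \<longleftrightarrow> side_key n L \<sigma> i x < side_key n L \<sigma> i y \<or>
    side_key n L \<sigma> i x = side_key n L \<sigma> i y \<and> left_key n L \<sigma> x < left_key n L \<sigma> y"
  unfolding right_key_def using assms by (intro lex_less left_key_less)

lemma inj_left_key: "inj_on (left_key n L \<sigma>) L"
proof (rule inj_onI)
  fix x y assume xy: "x \<in> L" "y \<in> L" "left_key n L \<sigma> x = left_key n L \<sigma> y"
  then have "\<not> left_key n L \<sigma> x < left_key n L \<sigma> y" "\<not> left_key n L \<sigma> y < left_key n L \<sigma> x" by auto
  then have "start_key n \<sigma> x = start_key n \<sigma> y" "end_key n L \<sigma> x = end_key n L \<sigma> y"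
    using left_key_less_iff xy(1,2) by (meson linorder_neqE_nat)+
  then have "fst x = fst y" "snd x = snd y"
    using start_key_eqD[OF xy(1,2)] line_bounds[OF xy(1)] line_bounds[OF xy(2)]
    by (auto simp: end_key_def split: if_splits)
  then show "x = y" by (simp add: prod_eq_iff)
qed

lemma inj_right_key: "inj_on (right_key n L \<sigma> i) L"
proof (rule inj_onI)
  fix x y assume xy: "x \<in> L" "y \<in> L" "right_key n L \<sigma> i x = right_key n L \<sigma> i y"
  then have "\<not> right_key n L \<sigma> i x < right_key n L \<sigma> i y" "\<not> right_key n L \<sigma> i y < right_key n L \<sigma> i x" by auto
  then have "left_key n L \<sigma> x = left_key n L \<sigma> y"
    using right_key_less_iff xy(1,2) by (meson linorder_neqE_nat)
  then show "x = y" using inj_left_key xy by (auto dest: inj_onD)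
qed

lemma lines_on_subset: "lines_on L i \<subseteq> L"
  by (auto simp: lines_on_def)

subsection \<open>The layout of an assignment\<close>

definition canonical :: "(nat \<Rightarrow> line list) \<Rightarrow> (line \<Rightarrow> bool) \<Rightarrow> layout" where
  "canonical el \<sigma> i = (sort_key (left_key n L \<sigma>) (el i), sort_key (right_key n L \<sigma> i) (el i))"

context
  fixes el :: "nat \<Rightarrow> line list" and \<sigma> :: "line \<Rightarrow> bool"
  assumes el: "\<And>i. distinct (el i) \<and> set (el i) = lines_on L i"
begin

lemma above_canonical_left:
  "x \<in> lines_on L i \<Longrightarrow> y \<in> lines_on L i \<Longrightarrow>
    above (left_order (canonical el \<sigma>) i) x y \<longleftrightarrow> left_key n L \<sigma> x < left_key n L \<sigma> y"
  unfolding canonical_def fst_conv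
  by (rule above_sort_key) (use el inj_on_subset[OF inj_left_key lines_on_subset] in auto)

lemma above_canonical_right:
  "x \<in> lines_on L i \<Longrightarrow> y \<in> lines_on L i \<Longrightarrow>
    above (right_order (canonical el \<sigma>) i) x y \<longleftrightarrow> right_key n L \<sigma> i x < right_key n L \<sigma> i y"
  unfolding canonical_def snd_conv
  by (rule above_sort_key) (use el inj_on_subset[OF inj_right_key lines_on_subset] in auto)

text \<open>Left keys do not depend on the edge, and lines passing a station share the middle
  \<open>side_key\<close>, so the orders on both sides of the station are sorted by the same key.
  Lines passing through the first station \<open>a\<close> of a line started earlier, so their keys
  lie strictly between \<open>n - a\<close> and \<open>n + a\<close>.\<close>

lemma canonical_feasible: "feasible n L (canonical el \<sigma>)"
  unfolding feasible_def
proof (intro conjI)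
  show "is_layout n L (canonical el \<sigma>)"
    using el by (auto simp: is_layout_def canonical_def)
  show "admissible n L (canonical el \<sigma>)"
    unfolding admissible_def
  proof (intro allI impI ballI)
    fix i x y assume i: "1 < i \<and> i < n" and xy: "x \<in> passing L i" "y \<in> passing L i"
    then have "x \<in> lines_on L i" "y \<in> lines_on L i" "x \<in> lines_on L (i - 1)" "y \<in> lines_on L (i - 1)"
      by (auto simp: passing_iff lines_on_iff)
    moreover have "side_key n L \<sigma> (i - 1) x = 1" "side_key n L \<sigma> (i - 1) y = 1"
      using xy i by (auto simp: side_key_def passing_iff)
    ultimately show "above (right_order (canonical el \<sigma>) (i - 1)) x y \<longleftrightarrow> above (left_order (canonical el \<sigma>) i) x y"
      using right_key_less_iff[of x y \<sigma> "i - 1"]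
      by (simp add: above_canonical_left above_canonical_right lines_on_iff)
  qed
  show "periphery L (canonical el \<sigma>)"
    unfolding periphery_def
  proof (clarify)
    fix a b assume ab: "(a, b) \<in> L"
    have b: "1 \<le> a" "a < b" "b \<le> n" using line_bounds[OF ab] by auto
    have on: "(a, b) \<in> lines_on L a" "(a, b) \<in> lines_on L (b - 1)" using ab b by (auto simp: lines_on_iff)
    have "if \<sigma> (a, b) then \<forall>y\<in>passing L a. above (left_order (canonical el \<sigma>) a) y (a, b)
          else \<forall>y\<in>passing L a. above (left_order (canonical el \<sigma>) a) (a, b) y"
    proof -
      have "y \<in> lines_on L a \<and> y \<in> L \<and> (if \<sigma> (a, b) then start_key n \<sigma> y < start_key n \<sigma> (a, b)
            else start_key n \<sigma> (a, b) < start_key n \<sigma> y)" if "y \<in> passing L a" for y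
        using that b line_bounds[of y] by (auto simp: passing_iff lines_on_iff start_key_def)
      then show ?thesis using on ab by (simp add: above_canonical_left left_key_less_iff)
    qed
    moreover have "if ends_below n L \<sigma> (a, b)
        then \<forall>y\<in>passing L b. above (right_order (canonical el \<sigma>) (b - 1)) y (a, b)
        else \<forall>y\<in>passing L b. above (right_order (canonical el \<sigma>) (b - 1)) (a, b) y"
    proof -
      have "y \<in> lines_on L (b - 1) \<and> y \<in> L \<and> (if ends_below n L \<sigma> (a, b)
            then side_key n L \<sigma> (b - 1) y < side_key n L \<sigma> (b - 1) (a, b)
            else side_key n L \<sigma> (b - 1) (a, b) < side_key n L \<sigma> (b - 1) y)" if "y \<in> passing L b" for y
        using that b by (auto simp: passing_iff lines_on_iff side_key_def)
      then show ?thesis using on(2) ab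
        by (auto simp: above_canonical_right right_key_less_iff simp del: One_nat_def)
    qed
    ultimately show "((\<forall>y\<in>passing L a. above (left_order (canonical el \<sigma>) a) (a, b) y) \<or>
        (\<forall>y\<in>passing L a. above (left_order (canonical el \<sigma>) a) y (a, b))) \<and>
       ((\<forall>y\<in>passing L b. above (right_order (canonical el \<sigma>) (b - 1)) (a, b) y) \<or>
        (\<forall>y\<in>passing L b. above (right_order (canonical el \<sigma>) (b - 1)) y (a, b)))"
      by (auto split: if_splits)
  qed
qed

lemma ends_below_mono:
  assumes "ends_below n L \<sigma> x" "snd x = snd y" "start_key n \<sigma> x \<le> start_key n \<sigma> y"
  shows "ends_below n L \<sigma> y"
proof -
  have "card (passing_above n L \<sigma> x) \<le> card (passing_above n L \<sigma> y)"
    "card (passing_below n L \<sigma> y) \<le> card (passing_below n L \<sigma> x)"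
    using assms finite_passing by (auto intro!: card_mono simp: passing_above_def passing_below_def)
  then show ?thesis using assms(1) by (simp add: ends_below_def)
qed

definition crossed :: "line \<Rightarrow> line set" where
  "crossed x = (if ends_below n L \<sigma> x then passing_below n L \<sigma> x else passing_above n L \<sigma> x)"

lemma card_crossed: "card (crossed x) = line_cost n L \<sigma> x"
  by (auto simp: crossed_def line_cost_def ends_below_def)

text \<open>Lines with the same start and the same side are sorted so that those ending next lie
  outermost, on the side where they end.\<close>

lemma crossing_pair:
  assumes x: "x \<in> lines_on L i" and y: "y \<in> lines_on L i"
    and l: "left_key n L \<sigma> x < left_key n L \<sigma> y" and r: "right_key n L \<sigma> i y < right_key n L \<sigma> i x"
  shows "(snd x = i + 1 \<and> y \<in> crossed x) \<or> (snd y = i + 1 \<and> x \<in> crossed y)"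
proof -
  have xL: "x \<in> L" "fst x \<le> i" "i < snd x" and yL: "y \<in> L" "fst y \<le> i" "i < snd y"
    using x y by (auto simp: lines_on_iff)
  have g: "start_key n \<sigma> x \<le> start_key n \<sigma> y" 
    and h: "start_key n \<sigma> x = start_key n \<sigma> y \<Longrightarrow> end_key n L \<sigma> x < end_key n L \<sigma> y"
    using l left_key_less_iff[OF xL(1) yL(1)] by auto
  have c: "side_key n L \<sigma> i y < side_key n L \<sigma> i x"
    using r l right_key_less_iff[OF yL(1) xL(1)] by auto
  have ne: "snd x \<noteq> snd y" if "start_key n \<sigma> x = start_key n \<sigma> y"
    using start_key_eqD[OF xL(1) yL(1) that] l prod_eqI[of x y] by auto
  consider (top) "snd y = i + 1" "\<not> ends_below n L \<sigma> y" | (bot) "snd x = i + 1" "ends_below n L \<sigma> x" "snd y > i + 1"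
    using c yL xL by (fastforce simp: side_key_def split: if_splits)
  then show ?thesis
  proof cases
    case top
    \<comment> \<open>If \<open>x\<close> ended here too, it would have to go to the bottom, and
      monotonicity would send the lower line \<open>y\<close> there as well.\<close>
    then have "snd x \<noteq> i + 1" using ends_below_mono[of x y] g c by (auto simp: side_key_def split: if_splits)
    then have "i + 1 < snd x" using xL by auto
    moreover have "start_key n \<sigma> x \<noteq> start_key n \<sigma> y"
    proof
      assume "start_key n \<sigma> x = start_key n \<sigma> y"
      then show False using h top \<open>i + 1 < snd x\<close> line_bounds[OF xL(1)]
        by (auto simp: end_key_def split: if_splits)
    qed
    ultimately show ?thesis using top g xL by (auto simp: crossed_def passing_above_def passing_iff)
  next
    case bot
    moreover have "start_key n \<sigma> x \<noteq> start_key n \<sigma> y"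
    proof
      assume "start_key n \<sigma> x = start_key n \<sigma> y"
      then show False using h bot line_bounds[OF yL(1)] line_bounds[OF xL(1)]
        by (auto simp: end_key_def split: if_splits)
    qed
    ultimately show ?thesis using g yL by (auto simp: crossed_def passing_below_def passing_iff)
  qed
qed

text \<open>Each pair crossing on edge \<open>i\<close> is charged to a member that ends at station
  \<open>i + 1\<close> and has the other one in its \<open>crossed\<close> set. An inequality
  suffices, since the lower bound below holds for every feasible layout.\<close>

lemma canonical_crossings: "crossing_number n L (canonical el \<sigma>) \<le> (\<Sum>x\<in>L. line_cost n L \<sigma> x)"
proof -
  let ?\<pi> = "canonical el \<sigma>"
  define E where "E i = {x \<in> L. snd x = i + 1}" for i
  have finE: "finite (E i)" for i using finite_lines by (simp add: E_def)
  have fc: "finite (crossed x)" for x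
    using finite_passing by (auto simp: crossed_def passing_below_def passing_above_def)
  have edge: "card {{x, y} |x y. x \<in> lines_on L i \<and> y \<in> lines_on L i \<and> x \<noteq> y \<and> cross_on ?\<pi> i x y}
      \<le> (\<Sum>x\<in>E i. line_cost n L \<sigma> x)" for i
  proof -
    have "{{x, y} |x y. x \<in> lines_on L i \<and> y \<in> lines_on L i \<and> x \<noteq> y \<and> cross_on ?\<pi> i x y}
       \<subseteq> (\<Union>x\<in>E i. (\<lambda>y. {x, y}) ` crossed x)" (is "?S \<subseteq> ?U")
    proof (rule subsetI, elim CollectE exE conjE)
      fix p x y assume p: "p = {x, y}" and xy: "x \<in> lines_on L i" "y \<in> lines_on L i" "x \<noteq> y" "cross_on ?\<pi> i x y"
      have L: "x \<in> L" "y \<in> L" using xy by (auto simp: lines_on_iff)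
      have "left_key n L \<sigma> x \<noteq> left_key n L \<sigma> y" "right_key n L \<sigma> i x \<noteq> right_key n L \<sigma> i y"
        using inj_onD[OF inj_left_key _ L] inj_onD[OF inj_right_key _ L] xy(3) by blast+
      moreover have "(left_key n L \<sigma> x < left_key n L \<sigma> y) \<noteq> (right_key n L \<sigma> i x < right_key n L \<sigma> i y)"
        using xy by (simp add: cross_on_def above_canonical_left above_canonical_right)
      ultimately have "(left_key n L \<sigma> x < left_key n L \<sigma> y \<and> right_key n L \<sigma> i y < right_key n L \<sigma> i x)
         \<or> (left_key n L \<sigma> y < left_key n L \<sigma> x \<and> right_key n L \<sigma> i x < right_key n L \<sigma> i y)" by linarith
      then have "(snd x = i + 1 \<and> y \<in> crossed x) \<or> (snd y = i + 1 \<and> x \<in> crossed y)"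
        using crossing_pair[OF xy(1,2)] crossing_pair[OF xy(2,1)] by blast
      then show "p \<in> ?U"
      proof (elim disjE conjE)
        assume "snd x = i + 1" "y \<in> crossed x"
        then show ?thesis using L(1)
          by (intro UN_I[of x] image_eqI[of _ _ y]) (simp_all add: E_def p)
      next
        assume "snd y = i + 1" "x \<in> crossed y"
        then show ?thesis using L(2)
          by (intro UN_I[of y] image_eqI[of _ _ x]) (simp_all add: E_def p insert_commute)
      qed
    qed
    then have "card ?S \<le> card ?U"
      by (intro card_mono) (auto simp: finE fc)
    also have "\<dots> \<le> (\<Sum>x\<in>E i. card ((\<lambda>y. {x, y}) ` crossed x))"
      by (rule card_UN_le) (rule finE)
    also have "\<dots> \<le> (\<Sum>x\<in>E i. line_cost n L \<sigma> x)"
      by (intro sum_mono) (metis card_crossed card_image_le fc)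
    finally show ?thesis .
  qed
  have "crossing_number n L ?\<pi> \<le> (\<Sum>i\<in>{1..<n}. \<Sum>x\<in>E i. line_cost n L \<sigma> x)"
    unfolding crossing_number_def by (intro sum_mono edge)
  also have "\<dots> = (\<Sum>x\<in>(\<Union>i\<in>{1..<n}. E i). line_cost n L \<sigma> x)"
    by (rule sum.UNION_disjoint[symmetric]) (use finE in \<open>auto simp: E_def\<close>)
  also have "\<dots> \<le> (\<Sum>x\<in>L. line_cost n L \<sigma> x)"
    by (rule sum_mono2) (use finite_lines in \<open>auto simp: E_def\<close>)
  finally show ?thesis .
qed

end

subsection \<open>The lower bound\<close>

context
  fixes \<pi> :: layout
  assumes feas: "feasible n L \<pi>"
begin

text \<open>Where no line passes through the first station, both sides of the periphery condition
  hold vacuously. Declaring all such lines to start above gives those with a common start equal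
  keys, so the keys claim no order that the layout need not have.\<close>

definition starts_below :: "line \<Rightarrow> bool" where
  "starts_below x \<longleftrightarrow> passing L (fst x) \<noteq> {} \<and>
     \<not> (\<forall>y\<in>passing L (fst x). above (left_order \<pi> (fst x)) x y)"

lemma distinct_left: "1 \<le> i \<Longrightarrow> i < n \<Longrightarrow> distinct (left_order \<pi> i)"
  and distinct_right: "1 \<le> i \<Longrightarrow> i < n \<Longrightarrow> distinct (right_order \<pi> i)"
  using feas by (auto simp: feasible_def is_layout_def)

lemma starts_belowD: "x \<in> L \<Longrightarrow> starts_below x \<Longrightarrow> y \<in> passing L (fst x) \<Longrightarrow> above (left_order \<pi> (fst x)) y x"
  using feas by (cases x) (fastforce simp: feasible_def periphery_def starts_below_def)

lemma not_starts_belowD: "\<not> starts_below x \<Longrightarrow> y \<in> passing L (fst x) \<Longrightarrow> above (left_order \<pi> (fst x)) x y"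
  by (auto simp: starts_below_def)

text \<open>With different starts, the line that starts later lies outside the other one on the side
  recorded by its key, which fixes their order on the first common edge.\<close>

lemma start_order:
  assumes "x \<in> L" "y \<in> L" "start_key n starts_below y < start_key n starts_below x"
    and "fst x < snd y" "fst y < snd x"
  shows "above (left_order \<pi> (max (fst x) (fst y))) y x"
proof (cases "fst x" "fst y" rule: linorder_cases)
  case less
  then have "\<not> starts_below y" using assms(3) by (auto simp: start_key_def split: if_splits)
  moreover have "x \<in> passing L (fst y)" using less assms by (auto simp: passing_iff)
  ultimately show ?thesis using not_starts_belowD less by (simp add: max_def)
next
  case greater
  then have "starts_below x" using assms(3) by (auto simp: start_key_def split: if_splits)
  moreover have "y \<in> passing L (fst x)" using greater assms by (auto simp: passing_iff)
  ultimately show ?thesis using starts_belowD assms greater by (simp add: max_def)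
next
  case equal
  then have s: "starts_below x" "\<not> starts_below y"
    using assms(3) by (auto simp: start_key_def split: if_splits)
  \<comment> \<open>\<open>starts_below\<close> is true only if some line passes through the start;
    that line separates the two groups.\<close>
  then obtain z where z: "z \<in> passing L (fst x)" by (auto simp: starts_below_def)
  have "above (left_order \<pi> (fst x)) y z" "above (left_order \<pi> (fst x)) z x"
    using s z starts_belowD[OF assms(1)] not_starts_belowD[OF s(2)] equal by auto
  moreover have "distinct (left_order \<pi> (fst x))"
    using line_bounds[OF assms(1)] by (intro distinct_left) auto
  ultimately show ?thesis using above_trans equal by (metis max.idem)
qed

lemma order_preserved:
  assumes "x \<in> L" "y \<in> L" "max (fst x) (fst y) \<le> e" "e < snd x" "e < snd y"
    and "\<And>i. max (fst x) (fst y) \<le> i \<Longrightarrow> i \<le> e \<Longrightarrow> \<not> cross_on \<pi> i y x"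
  shows "above (left_order \<pi> (max (fst x) (fst y))) y x \<longleftrightarrow> above (right_order \<pi> e) y x"
  using assms(3-6)
proof (induction e rule: dec_induct)
  case base
  then show ?case by (simp add: cross_on_def)
next
  case (step e)
  have "above (left_order \<pi> (max (fst x) (fst y))) y x \<longleftrightarrow> above (right_order \<pi> e) y x"
    using step by simp
  also have "\<dots> \<longleftrightarrow> above (left_order \<pi> (Suc e)) y x"
  proof -
    have "x \<in> passing L (Suc e)" "y \<in> passing L (Suc e)" using step assms(1,2) by (auto simp: passing_iff)
    moreover have "1 < Suc e" "Suc e < n" using step line_bounds[OF assms(1)] by auto
    ultimately show ?thesis using feas unfolding feasible_def admissible_def by (metis diff_Suc_1)
  qed
  also have "\<dots> \<longleftrightarrow> above (right_order \<pi> (Suc e)) y x"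
    using step by (auto simp: cross_on_def)
  finally show ?case .
qed

definition ends_above :: "line \<Rightarrow> bool" where
  "ends_above x \<longleftrightarrow> (\<forall>y\<in>passing L (snd x). above (right_order \<pi> (snd x - 1)) x y)"

definition forced :: "line \<Rightarrow> line set" where
  "forced x = (if ends_above x then passing_above n L starts_below x else passing_below n L starts_below x)"

text \<open>The start keys fix the order of \<open>x\<close> and \<open>y\<close> on their first
  common edge, and the periphery condition at the end of \<open>x\<close> demands the opposite
  order. Without a crossing in between, admissibility would carry the first order all the way to
  that end.\<close>

lemma forced_crosses:
  assumes x: "x \<in> L" and y: "y \<in> forced x"
  shows "\<exists>i\<in>{1..<n}. x \<in> lines_on L i \<and> y \<in> lines_on L i \<and> cross_on \<pi> i x y"
proof -
  have yp: "y \<in> passing L (snd x)" using y by (auto simp: forced_def passing_above_def passing_below_def split: if_splits)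
  then have yL: "y \<in> L" "fst y < snd x" "snd x < snd y" by (auto simp: passing_iff)
  have b: "1 \<le> fst x" "fst x < snd x" "snd y \<le> n" using line_bounds x yL by auto
  let ?m = "max (fst x) (fst y)"
  have dist: "1 \<le> i \<Longrightarrow> i < snd x \<Longrightarrow> distinct (left_order \<pi> i) \<and> distinct (right_order \<pi> i)" for i
    using distinct_left distinct_right yL b by auto
  have "\<exists>i. ?m \<le> i \<and> i \<le> snd x - 1 \<and> (cross_on \<pi> i x y \<or> cross_on \<pi> i y x)"
  proof (rule ccontr)
    assume no: "\<not> ?thesis"
    have 1: "above (left_order \<pi> ?m) y x \<longleftrightarrow> above (right_order \<pi> (snd x - 1)) y x"
      by (rule order_preserved) (use x yL b no in auto)
    have 2: "above (left_order \<pi> ?m) x y \<longleftrightarrow> above (right_order \<pi> (snd x - 1)) x y"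
      unfolding max.commute[of "fst x"] by (rule order_preserved) (use x yL b no in auto)
    show False
    proof (cases "ends_above x")
      case True
      then have "above (left_order \<pi> ?m) y x" using start_order[OF x yL(1)] y b yL 
        by (auto simp: forced_def passing_above_def)
      moreover have "above (right_order \<pi> (snd x - 1)) x y" using True yp by (auto simp: ends_above_def)
      ultimately show False using 1 above_asym dist[of "snd x - 1"] b by fastforce
    next
      case False
      then have "above (left_order \<pi> ?m) x y" using start_order[OF yL(1) x] y b yL
        by (auto simp: forced_def passing_below_def max.commute)
      moreover have "above (right_order \<pi> (snd x - 1)) y x"
        using False yp feas x by (cases x) (fastforce simp: ends_above_def feasible_def periphery_def)
      ultimately show False using 2 above_asym dist[of "snd x - 1"] b by fastforce
    qed
  qed
  then obtain i where i: "?m \<le> i" "i \<le> snd x - 1" "cross_on \<pi> i x y \<or> cross_on \<pi> i y x" by blast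
  have on: "x \<in> lines_on L i" "y \<in> lines_on L i" "1 \<le> i" "i < n" using i x yL b by (auto simp: lines_on_iff)
  \<comment> \<open>\<open>cross_on\<close> compares one direction only; in strict total orders a
    change in one direction is a change in the other.\<close>
  have total: "above xs x y \<longleftrightarrow> \<not> above xs y x" if "distinct xs" "x \<in> set xs" "y \<in> set xs" for xs
  proof -
    obtain p q where "p < length xs" "xs ! p = x" "q < length xs" "xs ! q = y" 
      using \<open>x \<in> set xs\<close> \<open>y \<in> set xs\<close> by (metis in_set_conv_nth)
    moreover have "p \<noteq> q" using calculation yL by auto
    ultimately have "above xs x y \<or> above xs y x" unfolding above_def by (metis linorder_neqE_nat)
    then show ?thesis using above_asym[OF \<open>distinct xs\<close>] by blast
  qed
  have lay: "distinct (left_order \<pi> i)" "set (left_order \<pi> i) = lines_on L i"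
     "distinct (right_order \<pi> i)" "set (right_order \<pi> i) = lines_on L i"
    using feas on by (auto simp: feasible_def is_layout_def)
  have "cross_on \<pi> i x y" using i(3) total[OF lay(1)] total[OF lay(3)] lay on by (auto simp: cross_on_def)
  then show ?thesis using on by auto
qed

lemma crossings_lower_bound: "(\<Sum>x\<in>L. line_cost n L starts_below x) \<le> crossing_number n L \<pi>"
proof -
  let ?C = "\<lambda>i. {{x, y} | x y. x \<in> lines_on L i \<and> y \<in> lines_on L i \<and> x \<noteq> y \<and> cross_on \<pi> i x y}"
  have ff: "finite (forced x)" for x
    using finite_passing by (auto simp: forced_def passing_below_def passing_above_def)
  have fC: "finite (?C i)" for i
    by (rule finite_subset[of _ "Pow (lines_on L i)"]) (use finite_lines_on in auto)
  have gt: "y \<in> forced x \<Longrightarrow> snd x < snd y" for x y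
    by (auto simp: forced_def passing_below_def passing_above_def passing_iff split: if_splits)
  have "(\<Sum>x\<in>L. line_cost n L starts_below x) \<le> (\<Sum>x\<in>L. card (forced x))"
    by (intro sum_mono) (auto simp: line_cost_def forced_def)
  also have "\<dots> = card (Sigma L forced)"
    using finite_lines ff by (simp add: card_SigmaI)
  \<comment> \<open>Lines in \<open>forced x\<close> end later than \<open>x\<close>, so an
    unordered pair still tells which of its members is charged.\<close>
  also have "\<dots> = card ((\<lambda>(x, y). {x, y}) ` Sigma L forced)"
    by (rule card_image[symmetric]) (auto simp: inj_on_def doubleton_eq_iff dest!: gt)
  \<comment> \<open>A pair may cross on several edges; the union counts it once, which is enough for
    a lower bound.\<close>
  also have "\<dots> \<le> card (\<Union>i\<in>{1..<n}. ?C i)"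
  proof (rule card_mono)
    show "finite (\<Union>i\<in>{1..<n}. ?C i)" using fC by blast
    show "(\<lambda>(x, y). {x, y}) ` Sigma L forced \<subseteq> (\<Union>i\<in>{1..<n}. ?C i)"
    proof clarify
      fix a b c d assume xy: "(a, b) \<in> L" "(c, d) \<in> forced (a, b)"
      then show "{(a, b), (c, d)} \<in> (\<Union>i\<in>{1..<n}. ?C i)"
        using forced_crosses[OF xy] gt[OF xy(2)] by fastforce
    qed
  qed
  also have "\<dots> \<le> (\<Sum>i\<in>{1..<n}. card (?C i))" by (rule card_UN_le) simp
  finally show ?thesis by (simp add: crossing_number_def)
qed

end

lemma canonical_optimal:
  assumes "\<And>i. distinct (el i) \<and> set (el i) = lines_on L i"
    and "\<And>\<sigma>'. (\<Sum>x\<in>L. line_cost n L \<sigma> x) \<le> (\<Sum>x\<in>L. line_cost n L \<sigma>' x)"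
  shows "optimal n L (canonical el \<sigma>)"
  unfolding optimal_def
proof (intro conjI allI impI)
  show "feasible n L (canonical el \<sigma>)" using canonical_feasible assms(1) by blast
  fix \<pi> assume "feasible n L \<pi>"
  then have "(\<Sum>x\<in>L. line_cost n L (starts_below \<pi>) x) \<le> crossing_number n L \<pi>"
    by (rule crossings_lower_bound)
  moreover have "crossing_number n L (canonical el \<sigma>) \<le> (\<Sum>x\<in>L. line_cost n L \<sigma> x)"
    using canonical_crossings assms(1) by blast
  ultimately show "crossing_number n L (canonical el \<sigma>) \<le> crossing_number n L \<pi>"
    using assms(2)[of "starts_below \<pi>"] by linarith
qed

end

section \<open>Dynamic programming over the edges\<close>

text \<open>The mask of the sides of a list of lines. The head is the least significant bit, so
  appending lines leaves the lower bits alone.\<close>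

primrec code :: "('a \<Rightarrow> bool) \<Rightarrow> 'a list \<Rightarrow> nat" where
  "code \<sigma> [] = 0"
| "code \<sigma> (x # xs) = of_bool (\<sigma> x) + 2 * code \<sigma> xs"

lemma code_append: "code \<sigma> (xs @ ys) = code \<sigma> xs + 2 ^ length xs * code \<sigma> ys"
  by (induction xs) (auto simp: algebra_simps)

lemma code_less: "code \<sigma> xs < 2 ^ length xs"
  by (induction xs) (auto simp: of_bool_def)

lemma code_eq_iff: "code \<sigma> xs = code \<sigma>' xs \<longleftrightarrow> (\<forall>x\<in>set xs. \<sigma> x = \<sigma>' x)"
proof (induction xs)
  case (Cons x xs)
  have "of_bool a + 2 * b = of_bool c + 2 * (d::nat) \<longleftrightarrow> a = c \<and> b = d" for a b c d
    by (cases a; cases c; simp; presburger)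
  then show ?case using Cons by simp
qed simp

text \<open>Lets a loop over all masks be read as a loop over all assignments; distinctness allows
  every bit to be set independently.\<close>

lemma code_surj: "distinct xs \<Longrightarrow> v < 2 ^ length xs \<Longrightarrow> \<exists>\<sigma>. code \<sigma> xs = v"
proof (induction xs arbitrary: v)
  case (Cons x xs)
  then have "v div 2 < 2 ^ length xs" "distinct xs" by auto
  from Cons.IH[OF this(2,1)] obtain \<sigma> where s: "code \<sigma> xs = v div 2" by blast
  have "code (\<sigma>(x := odd v)) xs = code \<sigma> xs" using Cons.prems by (subst code_eq_iff) auto
  then have "code (\<sigma>(x := odd v)) (x # xs) = v" using s by (simp add: of_bool_def)
  then show ?case by blast
qed simp

lemma code_take_Suc: "j < length xs \<Longrightarrow>
    code \<sigma> (take (Suc j) xs) = code \<sigma> (take j xs) + of_bool (\<sigma> (xs ! j)) * 2 ^ j"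
  by (simp add: take_Suc_conv_app_nth code_append)

locale mlcm_input =
  fixes n :: nat and ls :: "line list"
  assumes n_pos: "1 \<le> n" and dist: "distinct ls" and lset: "line_set n (set ls)"
begin

sublocale path_lines n "set ls" by unfold_locales (rule lset)

text \<open>Reversed because the program builds these lists by insertion at the front.\<close>

definition bucket :: "nat \<Rightarrow> line list" where
  "bucket i = filter (\<lambda>x. fst x = i) (rev ls)"

text \<open>Lines coming from the previous edge precede the new ones, so \<open>pass_list\<close> is
  a prefix and its mask consists of the low bits of the mask of the edge.\<close>

primrec edge_list :: "nat \<Rightarrow> line list" where
  "edge_list 0 = []"
| "edge_list (Suc i) = filter (\<lambda>x. Suc i < snd x) (edge_list i) @ bucket (Suc i)"

definition pass_list :: "nat \<Rightarrow> line list" where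
  "pass_list i = filter (\<lambda>x. i < snd x) (edge_list (i - 1))"

lemma edge_list_Suc: "edge_list (Suc i) = pass_list (Suc i) @ bucket (Suc i)"
  by (simp add: pass_list_def)

lemma pass_list_Suc: "pass_list (Suc i) = filter (\<lambda>x. Suc i < snd x) (edge_list i)"
  by (simp add: pass_list_def)

lemma edge_list: "distinct (edge_list i) \<and> set (edge_list i) = lines_on (set ls) i"
proof (induction i)
  case 0
  then show ?case using line_bounds by (fastforce simp: lines_on_iff)
next
  case (Suc i)
  then show ?case using dist line_bounds
    by (auto simp: bucket_def lines_on_iff)
qed

lemma set_pass_list: "set (pass_list (Suc i)) = passing (set ls) (Suc i)"
  using edge_list[of i] by (auto simp: pass_list_Suc lines_on_iff passing_iff)

lemma pass_list_n: "pass_list n = []"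
  using edge_list[of "n - 1"] line_bounds by (fastforce simp: pass_list_def filter_empty_conv lines_on_iff)

lemma pass_list_1: "pass_list (Suc 0) = []"
  by (simp add: pass_list_def)

definition edge_cost :: "(line \<Rightarrow> bool) \<Rightarrow> nat \<Rightarrow> nat" where
  "edge_cost \<sigma> i = (\<Sum>x | x \<in> set ls \<and> snd x = Suc i. line_cost n (set ls) \<sigma> x)"

definition cost_before :: "(line \<Rightarrow> bool) \<Rightarrow> nat \<Rightarrow> nat" where
  "cost_before \<sigma> i = (\<Sum>j=1..<i. edge_cost \<sigma> j)"

lemma cost_before_Suc: "1 \<le> i \<Longrightarrow> cost_before \<sigma> (Suc i) = cost_before \<sigma> i + edge_cost \<sigma> i"
  by (simp add: cost_before_def)

lemma cost_before_n: "cost_before \<sigma> n = (\<Sum>x\<in>set ls. line_cost n (set ls) \<sigma> x)"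
proof -
  have "cost_before \<sigma> n = (\<Sum>x\<in>(\<Union>i\<in>{1..<n}. {x. x \<in> set ls \<and> snd x = Suc i}). line_cost n (set ls) \<sigma> x)"
    unfolding cost_before_def edge_cost_def
    by (rule sum.UNION_disjoint[symmetric]) auto
  also have "(\<Union>i\<in>{1..<n}. {x. x \<in> set ls \<and> snd x = Suc i}) = set ls"
  proof -
    have "x \<in> set ls \<Longrightarrow> snd x - 1 \<in> {1..<n} \<and> snd x = Suc (snd x - 1)" for x
      using line_bounds[of x] by auto
    then show ?thesis by blast
  qed
  finally show ?thesis .
qed

lemma edge_cost_cong:
  assumes "\<And>x. x \<in> lines_on (set ls) i \<Longrightarrow> \<sigma> x = \<sigma>' x"
  shows "edge_cost \<sigma> i = edge_cost \<sigma>' i"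
proof -
  have s: "start_key n \<sigma> x = start_key n \<sigma>' x" if "x \<in> lines_on (set ls) i" for x
    using assms[OF that] by (simp add: start_key_def)
  have p: "y \<in> lines_on (set ls) i" if "y \<in> passing (set ls) (Suc i)" for y
    using that by (auto simp: passing_iff lines_on_iff)
  have "line_cost n (set ls) \<sigma> x = line_cost n (set ls) \<sigma>' x" if x: "x \<in> set ls" "snd x = Suc i" for x
  proof -
    have "x \<in> lines_on (set ls) i" using line_bounds[of x] x by (auto simp: lines_on_iff)
    then have "passing_above n (set ls) \<sigma> x = passing_above n (set ls) \<sigma>' x"
       "passing_below n (set ls) \<sigma> x = passing_below n (set ls) \<sigma>' x"
      using s p x(2) by (auto simp: passing_above_def passing_below_def)
    then show ?thesis by (simp add: line_cost_def)
  qed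
  then show ?thesis unfolding edge_cost_def by (intro sum.cong) auto
qed

text \<open>Entries of the value table \<open>R\<close> are one more than the cost they stand for, so that
  \<open>0\<close> means unset; \<open>B\<close> is the table of best predecessors.\<close>

definition row_correct :: "(nat \<Rightarrow> nat \<Rightarrow> nat) \<Rightarrow> (nat \<Rightarrow> nat \<Rightarrow> nat) \<Rightarrow> nat \<Rightarrow> bool" where
  "row_correct R B i \<longleftrightarrow> (\<forall>\<sigma>.
     R (Suc i) (code \<sigma> (pass_list (Suc i))) \<le> R i (code \<sigma> (pass_list i)) + edge_cost \<sigma> i \<and>
     (\<exists>\<sigma>'. code \<sigma>' (pass_list (Suc i)) = code \<sigma> (pass_list (Suc i)) \<and>
        B (Suc i) (code \<sigma> (pass_list (Suc i))) = code \<sigma>' (edge_list i) \<and>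
        R (Suc i) (code \<sigma> (pass_list (Suc i))) = R i (code \<sigma>' (pass_list i)) + edge_cost \<sigma>' i))"

lemma table_upper:
  assumes "R 1 0 = 1" "\<And>j. 1 \<le> j \<Longrightarrow> j < i \<Longrightarrow> row_correct R B j" "1 \<le> i"
  shows "R i (code \<sigma> (pass_list i)) \<le> 1 + cost_before \<sigma> i"
  using assms(3,2)
proof (induction i rule: dec_induct)
  case base
  then show ?case using assms(1) by (simp add: pass_list_1)
next
  case (step i)
  then have "R (Suc i) (code \<sigma> (pass_list (Suc i))) \<le> R i (code \<sigma> (pass_list i)) + edge_cost \<sigma> i"
    by (auto simp: row_correct_def)
  moreover have "R i (code \<sigma> (pass_list i)) \<le> 1 + cost_before \<sigma> i" using step by auto
  ultimately show ?case using step(1) cost_before_Suc by fastforce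
qed

text \<open>The best predecessor of a row entry and the assignment behind that predecessor are
  different functions. They agree on the lines passing station \<open>i\<close>, and every line that
  lies on edge \<open>i\<close> and also on an earlier edge passes that station, so the two can be
  glued into a single assignment that also explains all stored choices.\<close>

lemma table_attained:
  assumes "R 1 0 = 1" "\<And>j. 1 \<le> j \<Longrightarrow> j < i \<Longrightarrow> row_correct R B j" "1 \<le> i"
  shows "\<exists>\<sigma>'. code \<sigma>' (pass_list i) = code \<sigma> (pass_list i) \<and>
     (\<forall>j. 1 \<le> j \<and> j < i \<longrightarrow> B (Suc j) (code \<sigma>' (pass_list (Suc j))) = code \<sigma>' (edge_list j)) \<and>
     R i (code \<sigma> (pass_list i)) = 1 + cost_before \<sigma>' i"
  using assms(3,2)
proof (induction i arbitrary: \<sigma> rule: dec_induct)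
  case base
  then show ?case using assms(1) by (auto simp: pass_list_1 cost_before_def)
next
  case (step i)
  obtain \<rho> where \<rho>: "code \<rho> (pass_list (Suc i)) = code \<sigma> (pass_list (Suc i))"
     "B (Suc i) (code \<sigma> (pass_list (Suc i))) = code \<rho> (edge_list i)"
     "R (Suc i) (code \<sigma> (pass_list (Suc i))) = R i (code \<rho> (pass_list i)) + edge_cost \<rho> i"
    using step.prems[of i] step.hyps by (auto simp: row_correct_def)
  obtain \<sigma>' where s: "code \<sigma>' (pass_list i) = code \<rho> (pass_list i)"
     "\<And>j. 1 \<le> j \<Longrightarrow> j < i \<Longrightarrow> B (Suc j) (code \<sigma>' (pass_list (Suc j))) = code \<sigma>' (edge_list j)"
     "R i (code \<rho> (pass_list i)) = 1 + cost_before \<sigma>' i"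
    using step.IH[of \<rho>] step.prems by force
  define \<tau> where "\<tau> x = (if x \<in> set (edge_list i) then \<rho> x else \<sigma>' x)" for x
  obtain i' where i': "i = Suc i'" using step.hyps by (cases i) auto
  have \<tau>\<rho>: "code \<tau> (edge_list i) = code \<rho> (edge_list i)" by (simp add: code_eq_iff \<tau>_def)
  have \<tau>\<rho>': "code \<tau> (pass_list (Suc i)) = code \<rho> (pass_list (Suc i))"
    by (simp add: code_eq_iff \<tau>_def pass_list_Suc)
  \<comment> \<open>To everything left of station \<open>i\<close> the glued assignment looks like
    \<open>\<sigma>'\<close>; the only lines in dispute pass station \<open>i\<close>, where both
    sources have the same code.\<close>
  have old: "\<tau> x = \<sigma>' x" if "x \<in> lines_on (set ls) j" "j < i" for x j
  proof (cases "x \<in> set (edge_list i)")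
    case True
    then have "x \<in> passing (set ls) i" using that edge_list[of i] by (auto simp: passing_iff lines_on_iff)
    then have "x \<in> set (pass_list i)" using set_pass_list[of i'] i' by simp
    then have "\<rho> x = \<sigma>' x" using s(1) code_eq_iff by metis
    then show ?thesis by (simp add: \<tau>_def)
  qed (simp add: \<tau>_def)
  have c: "edge_cost \<tau> j = edge_cost \<sigma>' j" "code \<tau> (edge_list j) = code \<sigma>' (edge_list j)"
    "code \<tau> (pass_list (Suc j)) = code \<sigma>' (pass_list (Suc j))" if "j < i" for j
    using old[OF _ that] edge_list[of j] 
    by (auto intro!: edge_cost_cong simp: code_eq_iff pass_list_Suc)
  have cb: "cost_before \<tau> i = cost_before \<sigma>' i"
    unfolding cost_before_def by (intro sum.cong) (use c in auto)
  have "edge_cost \<tau> i = edge_cost \<rho> i" using edge_list[of i] by (intro edge_cost_cong) (simp add: \<tau>_def)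
  then have R: "R (Suc i) (code \<sigma> (pass_list (Suc i))) = 1 + cost_before \<tau> (Suc i)"
    using \<rho>(3) s(3) cb step.hyps cost_before_Suc by simp
  have "B (Suc j) (code \<tau> (pass_list (Suc j))) = code \<tau> (edge_list j)" if "1 \<le> j" "j < Suc i" for j
  proof (cases "j = i")
    case True
    then show ?thesis using \<rho>(1,2) \<tau>\<rho> \<tau>\<rho>' by simp
  next
    case False
    then show ?thesis using s(2)[of j] c[of j] that by simp
  qed
  then show ?case using R \<tau>\<rho>' \<rho>(1) by (intro exI[of _ \<tau>]) auto
qed

text \<open>No line passes station \<open>n\<close>, so the last row has one relevant entry, which
  bounds the cost of all assignments from below and is attained by one of them.\<close>

lemma table_optimal:
  assumes "R 1 0 = 1" "\<And>j. 1 \<le> j \<Longrightarrow> j < n \<Longrightarrow> row_correct R B j"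
  shows "\<exists>\<sigma>. optimal n (set ls) (canonical edge_list \<sigma>) \<and>
    (\<forall>j. 1 \<le> j \<and> j < n \<longrightarrow> B (Suc j) (code \<sigma> (pass_list (Suc j))) = code \<sigma> (edge_list j))"
proof -
  obtain \<sigma> where s: "\<And>j. 1 \<le> j \<Longrightarrow> j < n \<Longrightarrow> B (Suc j) (code \<sigma> (pass_list (Suc j))) = code \<sigma> (edge_list j)"
      "R n 0 = 1 + cost_before \<sigma> n"
    using table_attained[OF assms n_pos] by (auto simp: pass_list_n)
  have "cost_before \<sigma> n \<le> cost_before \<sigma>' n" for \<sigma>'
    using table_upper[OF assms n_pos, of \<sigma>'] s(2) by (simp add: pass_list_n)
  then have "optimal n (set ls) (canonical edge_list \<sigma>)"
    by (intro canonical_optimal edge_list) (simp add: cost_before_n)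
  then show ?thesis using s by blast
qed

end

section \<open>The program\<close>

abbreviation (input) "vn \<equiv> 2 :: nat"
abbreviation (input) "vL \<equiv> 3 :: nat"
abbreviation (input) "ve \<equiv> 4 :: nat"
abbreviation (input) "veb \<equiv> 5 :: nat"
abbreviation (input) "vi \<equiv> 6 :: nat"
abbreviation (input) "vm \<equiv> 7 :: nat"
abbreviation (input) "vp \<equiv> 8 :: nat"
abbreviation (input) "vpl \<equiv> 9 :: nat"
abbreviation (input) "vrr \<equiv> 10 :: nat"
abbreviation (input) "vrn \<equiv> 11 :: nat"
abbreviation (input) "vW \<equiv> 12 :: nat"
abbreviation (input) "vmask \<equiv> 13 :: nat"
abbreviation (input) "vmb \<equiv> 14 :: nat"
abbreviation (input) "vj \<equiv> 15 :: nat"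
abbreviation (input) "vjb \<equiv> 16 :: nat"
abbreviation (input) "vk \<equiv> 17 :: nat"
abbreviation (input) "vkb \<equiv> 18 :: nat"
abbreviation (input) "vu \<equiv> 19 :: nat"
abbreviation (input) "vd \<equiv> 20 :: nat"
abbreviation (input) "vc \<equiv> 21 :: nat"
abbreviation (input) "vx \<equiv> 22 :: nat"
abbreviation (input) "vy \<equiv> 23 :: nat"
abbreviation (input) "vq \<equiv> 24 :: nat"
abbreviation (input) "vv \<equiv> 25 :: nat"
abbreviation (input) "vt \<equiv> 26 :: nat"
abbreviation (input) "vr \<equiv> 27 :: nat"
abbreviation (input) "vo \<equiv> 28 :: nat"
abbreviation (input) "vwt \<equiv> 29 :: nat"
abbreviation (input) "vnl \<equiv> 30 :: nat"
abbreviation (input) "vnm \<equiv> 31 :: nat"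
abbreviation (input) "aA \<equiv> 2 :: nat"
abbreviation (input) "aB \<equiv> 3 :: nat"
abbreviation (input) "aHead \<equiv> 4 :: nat"
abbreviation (input) "aNext \<equiv> 5 :: nat"
abbreviation (input) "aCnt \<equiv> 6 :: nat"
abbreviation (input) "aPw \<equiv> 7 :: nat"
abbreviation (input) "aLst \<equiv> 8 :: nat"
abbreviation (input) "aLp \<equiv> 9 :: nat"
abbreviation (input) "aLen \<equiv> 10 :: nat"
abbreviation (input) "aPas \<equiv> 11 :: nat"
abbreviation (input) "aRp \<equiv> 12 :: nat"
abbreviation (input) "aR \<equiv> 13 :: nat"
abbreviation (input) "aBest \<equiv> 14 :: nat"
abbreviation (input) "aid \<equiv> 15 :: nat"
abbreviation (input) "aa \<equiv> 16 :: nat"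
abbreviation (input) "ab \<equiv> 17 :: nat"
abbreviation (input) "abit \<equiv> 18 :: nat"
abbreviation (input) "akey \<equiv> 19 :: nat"
abbreviation (input) "atau \<equiv> 20 :: nat"
abbreviation (input) "ak1 \<equiv> 21 :: nat"
abbreviation (input) "ak2 \<equiv> 22 :: nat"
abbreviation (input) "arank \<equiv> 23 :: nat"
abbreviation (input) "aOut \<equiv> 24 :: nat"

text \<open>Variables have prefix \<open>v\<close>, arrays prefix \<open>a\<close>. By line number: \<open>aA\<close>, \<open>aB\<close> ends of the line,
  \<open>atau\<close> whether it ends at the bottom, \<open>aNext\<close> successor in its bucket. By station: \<open>aHead\<close>, \<open>aCnt\<close>
  first line (plus one) and size of the bucket of lines starting there. By edge: \<open>aLp\<close>, \<open>aLen\<close>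
  position in \<open>aLst\<close> and length of its list of line numbers, \<open>aPas\<close> number of lines on it that come
  from the previous edge, \<open>aRp\<close> position of its row in \<open>aR\<close> (values plus one) and \<open>aBest\<close> (best
  masks). By position in the current edge: \<open>aid\<close>, \<open>aa\<close>, \<open>ab\<close> line number and ends, \<open>abit\<close>,
  \<open>akey\<close> side and key of the start, \<open>ak1\<close>, \<open>ak2\<close> lexicographic sort key, \<open>arank\<close> rank.\<close>

definition LOAD :: lcom where
  "LOAD = For vj vjb (Var vm) (
     aid[Var vj] ::= Arr aLst (Var vpl \<oplus> Var vj) ;;
     aa[Var vj] ::= Arr aA (Arr aid (Var vj)) ;;
     ab[Var vj] ::= Arr aB (Arr aid (Var vj)))"

text \<open>Replaces division: going down from the most significant bit, the bit at a position is 0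
  exactly if the remaining value is below the power of two of that position.\<close>

definition DECODE :: lcom where
  "DECODE = vt ::= Var vmask ;; vv ::= Var vm ;; For vj vjb (Var vm) (
     vv ::= Var vv \<ominus> Num 1 ;;
     Cond (Var vt) (Arr aPw (Var vv))
       (abit[Var vv] ::= Num 0 ;; akey[Var vv] ::= Var vn \<ominus> Arr aa (Var vv))
       (abit[Var vv] ::= Num 1 ;; akey[Var vv] ::= Var vn \<oplus> Arr aa (Var vv) ;;
        vt ::= Var vt \<ominus> Arr aPw (Var vv)))"

definition COUNT :: lcom where
  "COUNT = vu ::= Num 0 ;; vd ::= Num 0 ;; For vk vkb (Var vm) (
     Cond (Var vi \<oplus> Num 1) (Arr ab (Var vk))
       (Cond (Arr akey (Var vk)) (Arr akey (Var vj)) (vu ::= Var vu \<oplus> Num 1)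
         (Cond (Arr akey (Var vj)) (Arr akey (Var vk)) (vd ::= Var vd \<oplus> Num 1) Nop))
       Nop)"

text \<open>Every line on edge \<open>i\<close> ends at \<open>i + 1\<close> or later, so comparing
  its end with \<open>i + 2\<close> tests whether it ends at \<open>i + 1\<close>. What
  \<open>atau\<close> holds while masks are enumerated is provisional; the backward sweep runs
  \<open>EVAL\<close> again on the chosen masks.\<close>

definition EVAL :: lcom where
  "EVAL = vc ::= Num 0 ;; For vj vjb (Var vm) (
     Cond (Arr ab (Var vj)) (Var vi \<oplus> Num 2)
       (COUNT ;;
        Cond (Var vd) (Var vu)
          (atau[Arr aid (Var vj)] ::= Num 1 ;; vc ::= Var vc \<oplus> Var vd)
          (atau[Arr aid (Var vj)] ::= Num 0 ;; vc ::= Var vc \<oplus> Var vu))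
       Nop)"

definition CODE_IN :: lcom where
  "CODE_IN = vx ::= Num 0 ;; For vj vjb (Var vp) (
     Cond (Num 0) (Arr abit (Var vj)) (vx ::= Var vx \<oplus> Arr aPw (Var vj)) Nop)"

definition CODE_OUT :: lcom where
  "CODE_OUT = vy ::= Num 0 ;; vq ::= Num 0 ;; For vj vjb (Var vm) (
     Cond (Var vi \<oplus> Num 1) (Arr ab (Var vj))
       (Cond (Num 0) (Arr abit (Var vj)) (vy ::= Var vy \<oplus> Arr aPw (Var vq)) Nop ;;
        vq ::= Var vq \<oplus> Num 1)
       Nop)"

lemma writes_edge [simp]:
  "written_vars LOAD = {vj, vjb}" "written_arrs LOAD = {aid, aa, ab}"
  "written_vars DECODE = {vt, vv, vj, vjb}" "written_arrs DECODE = {abit, akey}"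
  "written_vars COUNT = {vu, vd, vk, vkb}" "written_arrs COUNT = {}"
  "written_vars EVAL = {vc, vj, vjb, vu, vd, vk, vkb}" "written_arrs EVAL = {atau}"
  "written_vars CODE_IN = {vx, vj, vjb}" "written_arrs CODE_IN = {}"
  "written_vars CODE_OUT = {vy, vq, vj, vjb}" "written_arrs CODE_OUT = {}"
  by (auto simp: LOAD_def DECODE_def COUNT_def EVAL_def CODE_IN_def CODE_OUT_def)

section \<open>Correctness of the routines that evaluate one mask on one edge\<close>

lemma card_index_conv:
  assumes "distinct xs"
  shows "card {x \<in> set xs. P x} = card {j. j < length xs \<and> P (xs ! j)}"
proof -
  have "{x \<in> set xs. P x} = (!) xs ` {j. j < length xs \<and> P (xs ! j)}" by (auto simp: in_set_conv_nth)
  moreover have "inj_on ((!) xs) {j. j < length xs \<and> P (xs ! j)}"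
    using assms by (auto simp: inj_on_def nth_eq_iff_index_eq)
  ultimately show ?thesis by (simp add: card_image)
qed

lemma sum_index_conv:
  "distinct xs \<Longrightarrow> (\<Sum>j<length xs. f (xs ! j)) = sum f (set xs)"
  by (simp add: sum_list_distinct_conv_sum_set[symmetric] sum_list_sum_nth atLeast0LessThan)

lemma card_less_Suc_Collect:
  "card {j. j < Suc k \<and> P j} = card {j. j < k \<and> P j} + (if P k then 1 else 0)"
proof -
  have "{j. j < Suc k \<and> P j} = (if P k then insert k {j. j < k \<and> P j} else {j. j < k \<and> P j})"
    by (auto simp: less_Suc_eq)
  then show ?thesis by simp
qed

context mlcm_input
begin

definition input :: "lstate \<Rightarrow> bool" where
  "input s \<longleftrightarrow> var s vn = n \<and> var s vL = length ls \<and>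
     (\<forall>l<length ls. arr s aA l = fst (ls ! l) \<and> arr s aB l = snd (ls ! l)) \<and>
     (\<forall>j\<le>length ls. arr s aPw j = 2 ^ j)"

lemma input_cong:
  assumes "input s" "var t vn = var s vn" "var t vL = var s vL"
    "arr t aA = arr s aA" "arr t aB = arr s aB" "arr t aPw = arr s aPw"
  shows "input t"
  using assms by (simp add: input_def)

lemma input_power: "input s \<Longrightarrow> j \<le> length ls \<Longrightarrow> arr s aPw j = 2 ^ j"
  by (simp add: input_def)

definition loaded :: "lstate \<Rightarrow> line list \<Rightarrow> bool" where
  "loaded s xs \<longleftrightarrow> var s vm = length xs \<and> (\<forall>j<length xs. arr s aa j = fst (xs ! j) \<and>
     arr s ab j = snd (xs ! j) \<and> arr s aid j < length ls \<and> ls ! arr s aid j = xs ! j)"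

lemma loaded_cong:
  assumes "loaded s xs" "var t vm = var s vm" "arr t aa = arr s aa" "arr t ab = arr s ab" "arr t aid = arr s aid"
  shows "loaded t xs"
  using assms by (simp add: loaded_def)

definition keyed :: "lstate \<Rightarrow> (line \<Rightarrow> bool) \<Rightarrow> line list \<Rightarrow> bool" where
  "keyed s \<sigma> xs \<longleftrightarrow>
     (\<forall>j<length xs. arr s abit j = of_bool (\<sigma> (xs ! j)) \<and> arr s akey j = start_key n \<sigma> (xs ! j))"

lemma keyed_cong:
  "keyed s \<sigma> xs \<Longrightarrow> arr t abit = arr s abit \<Longrightarrow> arr t akey = arr s akey \<Longrightarrow> keyed t \<sigma> xs"
  by (simp add: keyed_def)

text \<open>The large constants in this and the following time bounds are generous roundings: a
  doubly nested array access such as \<open>Arr aA (Arr aid (Var vj))\<close> alone costs 2212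
  steps.\<close>

lemma LOAD_spec:
  assumes "input s" "var s vm = length xs"
    and "\<forall>j<length xs. arr s aLst (var s vpl + j) < length ls \<and> ls ! arr s aLst (var s vpl + j) = xs ! j"
  shows "loaded (run LOAD s) xs" "time LOAD s \<le> 10000 * (length xs + 1)"
proof -
  let ?I = "\<lambda>k t. \<forall>j<k. arr t aa j = fst (xs ! j) \<and>
     arr t ab j = snd (xs ! j) \<and> arr t aid j < length ls \<and> ls ! arr t aid j = xs ! j"
  have "?I (length xs) (run LOAD s) \<and> time LOAD s \<le> 6 + lcost (Var vm) + length xs * (7 + 9000)"
    unfolding LOAD_def
    by (rule For_rule[where Inv = ?I]) (use assms in \<open>auto simp: less_Suc_eq input_def\<close>)
  then show "loaded (run LOAD s) xs" "time LOAD s \<le> 10000 * (length xs + 1)"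
    using assms(2) by (auto simp: loaded_def)
qed

lemma DECODE_spec:
  assumes "input s" "loaded s xs" "var s vmask = code \<sigma> xs" "length xs \<le> length ls"
  shows "keyed (run DECODE s) \<sigma> xs" "time DECODE s \<le> 10000 * (length xs + 1)"
proof -
  let ?s = "run (vt ::= Var vmask ;; vv ::= Var vm) s"
  let ?I = "\<lambda>k t. var t vv = length xs - k \<and> var t vt = code \<sigma> (take (length xs - k) xs) \<and>
     (\<forall>j. length xs - k \<le> j \<and> j < length xs \<longrightarrow>
       arr t abit j = of_bool (\<sigma> (xs ! j)) \<and> arr t akey j = start_key n \<sigma> (xs ! j))"
  define P where "P = vv ::= Var vv \<ominus> Num 1 ;;
     Cond (Var vt) (Arr aPw (Var vv))
       (abit[Var vv] ::= Num 0 ;; akey[Var vv] ::= Var vn \<ominus> Arr aa (Var vv))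
       (abit[Var vv] ::= Num 1 ;; akey[Var vv] ::= Var vn \<oplus> Arr aa (Var vv) ;;
        vt ::= Var vt \<ominus> Arr aPw (Var vv))"
  have "?I (length xs) (run (For vj vjb (Var vm) P) ?s) \<and>
      time (For vj vjb (Var vm) P) ?s \<le> 6 + lcost (Var vm) + length xs * (7 + 5000)"
  proof (rule For_rule[where Inv = ?I])
    fix k t assume k: "k < length xs" and I: "?I k t"
      and fr: "\<forall>x. x \<notin> insert vj (insert vjb (written_vars P)) \<longrightarrow> var t x = var ?s x"
        "\<forall>c. c \<notin> written_arrs P \<longrightarrow> arr t c = arr ?s c"
    define h where "h = length xs - Suc k"
    have h: "length xs - k = Suc h" "h < length xs" "h \<le> length ls" using k assms(4) by (auto simp: h_def)
    have e: "arr t aPw h = 2 ^ h" "arr t aa h = fst (xs ! h)" "var t vn = n"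
      using assms h fr by (auto simp: input_def loaded_def P_def)
    have lt: "code \<sigma> (take h xs) < 2 ^ h" using code_less[of \<sigma> "take h xs"] h by simp
    have vt: "var t vt = code \<sigma> (take h xs) + of_bool (\<sigma> (xs ! h)) * 2 ^ h"
      using I h code_take_Suc[of h xs \<sigma>] by simp
    have vv: "var t vv = Suc h" using I h by simp
    have old: "h < j \<Longrightarrow> j < length xs \<Longrightarrow>
       arr t abit j = of_bool (\<sigma> (xs ! j)) \<and> arr t akey j = start_key n \<sigma> (xs ! j)" for j
      using I h by simp
    have "length xs - Suc k = h" by (simp add: h_def)
    then show "?I (Suc k) (upd_var vj (Suc k) (run P t)) \<and> time P t \<le> 5000"
      using vt vv e lt old
      by (cases "\<sigma> (xs ! h)") (auto simp: P_def start_key_def)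
  qed (use assms in \<open>auto simp: loaded_def P_def\<close>)
  then show "keyed (run DECODE s) \<sigma> xs" "time DECODE s \<le> 10000 * (length xs + 1)"
    by (auto simp: DECODE_def P_def keyed_def)
qed

lemma COUNT_spec:
  assumes "loaded s (edge_list i)" "keyed s \<sigma> (edge_list i)" "var s vi = i" "var s vj < length (edge_list i)"
    and x: "x = edge_list i ! var s vj" "snd x = Suc i"
  shows "var (run COUNT s) vu = card (passing_above n (set ls) \<sigma> x)"
    "var (run COUNT s) vd = card (passing_below n (set ls) \<sigma> x)"
    "time COUNT s \<le> 10000 * (length (edge_list i) + 1)"
proof -
  let ?xs = "edge_list i"
  let ?s = "run (vu ::= Num 0 ;; vd ::= Num 0) s"
  define P where "P = Cond (Var vi \<oplus> Num 1) (Arr ab (Var vk))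
       (Cond (Arr akey (Var vk)) (Arr akey (Var vj)) (vu ::= Var vu \<oplus> Num 1)
         (Cond (Arr akey (Var vj)) (Arr akey (Var vk)) (vd ::= Var vd \<oplus> Num 1) Nop))
       Nop"
  let ?a = "\<lambda>j. Suc i < snd (?xs ! j) \<and> start_key n \<sigma> (?xs ! j) < start_key n \<sigma> x"
  let ?b = "\<lambda>j. Suc i < snd (?xs ! j) \<and> start_key n \<sigma> x < start_key n \<sigma> (?xs ! j)"
  let ?I = "\<lambda>k t. var t vu = card {j. j < k \<and> ?a j} \<and> var t vd = card {j. j < k \<and> ?b j}"
  have "?I (length ?xs) (run (For vk vkb (Var vm) P) ?s) \<and>
      time (For vk vkb (Var vm) P) ?s \<le> 6 + lcost (Var vm) + length ?xs * (7 + 5000)"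
  proof (rule For_rule[where Inv = ?I])
    fix k t assume k: "k < length ?xs" and I: "?I k t" and vk: "var t vk = k"
      and fr: "\<forall>x. x \<notin> insert vk (insert vkb (written_vars P)) \<longrightarrow> var t x = var ?s x"
        "\<forall>c. c \<notin> written_arrs P \<longrightarrow> arr t c = arr ?s c"
    have e: "arr t ab k = snd (?xs ! k)" "arr t akey k = start_key n \<sigma> (?xs ! k)"
      "arr t akey (var t vj) = start_key n \<sigma> x" "var t vi = i"
      using assms k fr by (auto simp: loaded_def keyed_def P_def)
    show "?I (Suc k) (upd_var vk (Suc k) (run P t)) \<and> time P t \<le> 5000"
      using I e vk by (auto simp: P_def card_less_Suc_Collect)
  qed (use assms in \<open>auto simp: loaded_def P_def\<close>)
  moreover have "passing (set ls) (Suc i) = {y \<in> set ?xs. Suc i < snd y}"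
    using edge_list[of i] by (auto simp: passing_iff lines_on_iff)
  then have "passing_above n (set ls) \<sigma> x = {y \<in> set ?xs. Suc i < snd y \<and> start_key n \<sigma> y < start_key n \<sigma> x}"
    "passing_below n (set ls) \<sigma> x = {y \<in> set ?xs. Suc i < snd y \<and> start_key n \<sigma> x < start_key n \<sigma> y}"
    using x(2) by (auto simp: passing_above_def passing_below_def)
  then have "card (passing_above n (set ls) \<sigma> x) = card {j. j < length ?xs \<and> ?a j}"
     "card (passing_below n (set ls) \<sigma> x) = card {j. j < length ?xs \<and> ?b j}"
    using card_index_conv[of ?xs] edge_list[of i] by auto
  ultimately show "var (run COUNT s) vu = card (passing_above n (set ls) \<sigma> x)"
    "var (run COUNT s) vd = card (passing_below n (set ls) \<sigma> x)"
    "time COUNT s \<le> 10000 * (length (edge_list i) + 1)"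
    by (auto simp: COUNT_def P_def)
qed

end

section \<open>Minimisation over all masks of one edge\<close>

definition UPDATE :: lcom where
  "UPDATE = vv ::= Arr aR (Var vrr \<oplus> Var vx) \<oplus> Var vc ;;
     Cond (Arr aR (Var vrn \<oplus> Var vy)) (Num 1)
       (aR[Var vrn \<oplus> Var vy] ::= Var vv ;; aBest[Var vrn \<oplus> Var vy] ::= Var vmask)
       (Cond (Var vv) (Arr aR (Var vrn \<oplus> Var vy))
         (aR[Var vrn \<oplus> Var vy] ::= Var vv ;; aBest[Var vrn \<oplus> Var vy] ::= Var vmask)
         Nop)"

definition TRY_MASK :: lcom where
  "TRY_MASK = DECODE ;; EVAL ;; CODE_IN ;; CODE_OUT ;; UPDATE"

lemma writes_table [simp]:
  "written_vars UPDATE = {vv}" "written_arrs UPDATE = {aR, aBest}"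
  "written_vars TRY_MASK = {vt, vv, vj, vjb, vc, vu, vd, vk, vkb, vx, vy, vq}"
  "written_arrs TRY_MASK = {abit, akey, atau, aR, aBest}"
  by (auto simp: UPDATE_def TRY_MASK_def)

context mlcm_input
begin

declare edge_list.simps(2) [simp del]

lemma EVAL_spec:
  assumes ld: "loaded s (edge_list i)" and ky: "keyed s \<sigma> (edge_list i)" and vi: "var s vi = i"
  shows "var (run EVAL s) vc = edge_cost \<sigma> i"
    "arr (run EVAL s) atau l = (if l < length ls \<and> snd (ls ! l) = Suc i
       then of_bool (ends_below n (set ls) \<sigma> (ls ! l)) else arr s atau l)"
    "time EVAL s \<le> 40000 * ((length (edge_list i) + 1) * (length (edge_list i) + 1))"
proof -
  let ?xs = "edge_list i"
  let ?s = "run (vc ::= Num 0) s"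
  define P where "P = Cond (Arr ab (Var vj)) (Var vi \<oplus> Num 2)
       (COUNT ;;
        Cond (Var vd) (Var vu)
          (atau[Arr aid (Var vj)] ::= Num 1 ;; vc ::= Var vc \<oplus> Var vd)
          (atau[Arr aid (Var vj)] ::= Num 0 ;; vc ::= Var vc \<oplus> Var vu))
       Nop"
  let ?f = "\<lambda>x. if snd x = Suc i then line_cost n (set ls) \<sigma> x else 0"
  let ?I = "\<lambda>k t. var t vc = (\<Sum>j<k. ?f (?xs ! j)) \<and>
     (\<forall>l. arr t atau l = (if \<exists>j<k. arr s aid j = l \<and> snd (?xs ! j) = Suc i
       then of_bool (ends_below n (set ls) \<sigma> (ls ! l)) else arr s atau l))"
  have main: "?I (length ?xs) (run (For vj vjb (Var vm) P) ?s) \<and>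
      time (For vj vjb (Var vm) P) ?s \<le> 6 + lcost (Var vm) + length ?xs * (7 + (10000 * (length ?xs + 1) + 10000))"
  proof (rule For_rule[where Inv = ?I])
    fix k t assume k: "k < length ?xs" and I: "?I k t" and vj: "var t vj = k"
      and fr: "\<forall>x. x \<notin> insert vj (insert vjb (written_vars P)) \<longrightarrow> var t x = var ?s x"
        "\<forall>c. c \<notin> written_arrs P \<longrightarrow> arr t c = arr ?s c"
    have e: "arr t ab k = snd (?xs ! k)" "var t vi = i" "arr t aid = arr s aid" "ls ! arr s aid k = ?xs ! k"
      using ld vi k fr by (auto simp: loaded_def P_def)
    have lt: "loaded t ?xs" by (rule loaded_cong[OF ld]) (use fr in \<open>auto simp: P_def\<close>)
    have kt: "keyed t \<sigma> ?xs" by (rule keyed_cong[OF ky]) (use fr in \<open>auto simp: P_def\<close>)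
    have gt: "i < snd (?xs ! k)" using edge_list[of i] nth_mem[OF k] by (auto simp: lines_on_iff)
    show "?I (Suc k) (upd_var vj (Suc k) (run P t)) \<and> time P t \<le> 10000 * (length ?xs + 1) + 10000"
    proof (cases "snd (?xs ! k) = Suc i")
      case False
      then have "\<not> snd (?xs ! k) < i + 2" using gt by simp
      then show ?thesis using False I e vj by (auto simp: P_def less_Suc_eq)
    next
      case True
      have c: "var (run COUNT t) vu = card (passing_above n (set ls) \<sigma> (?xs ! k))"
        "var (run COUNT t) vd = card (passing_below n (set ls) \<sigma> (?xs ! k))"
        "time COUNT t \<le> 10000 * (length ?xs + 1)"
        using COUNT_spec[OF lt kt e(2), of "?xs ! k"] k vj True by auto
      have t: "arr (run P t) atau = (arr t atau)(arr s aid k := of_bool (ends_below n (set ls) \<sigma> (?xs ! k)))"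
        using True e vj c by (simp add: P_def ends_below_def)
      have vc: "var (run P t) vc = var t vc + line_cost n (set ls) \<sigma> (?xs ! k)"
        using True e vj c by (simp add: P_def line_cost_def)
      have tm: "time P t \<le> 10000 * (length ?xs + 1) + 10000"
        using True e vj c(3) by (simp add: P_def)
      show ?thesis using I tm t vc True e(4) by (auto simp: less_Suc_eq)
    qed
  qed (use ld in \<open>auto simp: loaded_def P_def\<close>)
  have ev: "EVAL = vc ::= Num 0 ;; For vj vjb (Var vm) P" by (simp add: EVAL_def P_def)
  have "(\<Sum>j<length ?xs. ?f (?xs ! j)) = (\<Sum>x\<in>set ?xs. ?f x)"
    using edge_list[of i] sum_index_conv[of ?xs ?f] by simp
  also have "\<dots> = (\<Sum>x | x \<in> set ?xs \<and> snd x = Suc i. line_cost n (set ls) \<sigma> x)"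
    by (simp add: sum.inter_filter)
  also have "{x. x \<in> set ?xs \<and> snd x = Suc i} = {x. x \<in> set ls \<and> snd x = Suc i}"
    using edge_list[of i] line_bounds by (fastforce simp: lines_on_iff)
  finally show "var (run EVAL s) vc = edge_cost \<sigma> i" using main by (simp add: ev edge_cost_def)
  \<comment> \<open>Every line ending at station \<open>i + 1\<close> lies on edge \<open>i\<close>,
    and lines are distinct, so the writes to \<open>atau\<close> hit exactly the numbers of these
    lines.\<close>
  have "(\<exists>j<length ?xs. arr s aid j = l \<and> snd (?xs ! j) = Suc i) \<longleftrightarrow> l < length ls \<and> snd (ls ! l) = Suc i"
  proof
    assume "l < length ls \<and> snd (ls ! l) = Suc i"
    then have l: "l < length ls" "snd (ls ! l) = Suc i" "ls ! l \<in> set ?xs"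
      using edge_list[of i] line_bounds[of "ls ! l"] by (auto simp: lines_on_iff)
    then obtain j where j: "j < length ?xs" "?xs ! j = ls ! l" by (metis in_set_conv_nth)
    then have "arr s aid j = l" using ld l dist by (auto simp: loaded_def nth_eq_iff_index_eq)
    then show "\<exists>j<length ?xs. arr s aid j = l \<and> snd (?xs ! j) = Suc i" using j l by auto
  qed (use ld in \<open>auto simp: loaded_def\<close>)
  then show "arr (run EVAL s) atau l = (if l < length ls \<and> snd (ls ! l) = Suc i
       then of_bool (ends_below n (set ls) \<sigma> (ls ! l)) else arr s atau l)"
    using main by (simp add: ev)
  have "time EVAL s \<le> 2 + (6 + lcost (Var vm) + length ?xs * (7 + (10000 * (length ?xs + 1) + 10000)))"
    using main by (simp add: ev)
  also have "\<dots> \<le> 40000 * ((length (edge_list i) + 1) * (length (edge_list i) + 1))"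
    by (simp add: algebra_simps)
  finally show "time EVAL s \<le> 40000 * ((length (edge_list i) + 1) * (length (edge_list i) + 1))" .
qed

lemma CODE_IN_spec:
  assumes "input s" "keyed s \<sigma> (xs @ zs)" "var s vp = length xs" "length xs \<le> length ls"
  shows "var (run CODE_IN s) vx = code \<sigma> xs" "time CODE_IN s \<le> 10000 * (length xs + 1)"
proof -
  let ?s = "run (vx ::= Num 0) s"
  define P where "P = Cond (Num 0) (Arr abit (Var vj)) (vx ::= Var vx \<oplus> Arr aPw (Var vj)) Nop"
  let ?I = "\<lambda>k t. var t vx = code \<sigma> (take k xs)"
  have "?I (length xs) (run (For vj vjb (Var vp) P) ?s) \<and>
      time (For vj vjb (Var vp) P) ?s \<le> 6 + lcost (Var vp) + length xs * (7 + 5000)"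
  proof (rule For_rule[where Inv = ?I])
    fix k t assume k: "k < length xs" and I: "?I k t" and vj: "var t vj = k"
      and fr: "\<forall>x. x \<notin> insert vj (insert vjb (written_vars P)) \<longrightarrow> var t x = var ?s x"
        "\<forall>c. c \<notin> written_arrs P \<longrightarrow> arr t c = arr ?s c"
    have "arr t abit k = of_bool (\<sigma> (xs ! k))" "arr t aPw k = 2 ^ k"
      using assms k fr by (auto simp: keyed_def P_def input_def nth_append)
    then show "?I (Suc k) (upd_var vj (Suc k) (run P t)) \<and> time P t \<le> 5000"
      using I vj k by (auto simp: P_def code_take_Suc)
  qed (use assms in \<open>auto simp: P_def\<close>)
  then show "var (run CODE_IN s) vx = code \<sigma> xs" "time CODE_IN s \<le> 10000 * (length xs + 1)"
    by (auto simp: CODE_IN_def P_def)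
qed

lemma CODE_OUT_spec:
  assumes "input s" "loaded s xs" "keyed s \<sigma> xs" "length xs \<le> length ls" "var s vi = i"
  shows "var (run CODE_OUT s) vy = code \<sigma> (filter (\<lambda>x. Suc i < snd x) xs)"
    "time CODE_OUT s \<le> 10000 * (length xs + 1)"
proof -
  let ?s = "run (vy ::= Num 0 ;; vq ::= Num 0) s"
  define P where "P = Cond (Var vi \<oplus> Num 1) (Arr ab (Var vj))
       (Cond (Num 0) (Arr abit (Var vj)) (vy ::= Var vy \<oplus> Arr aPw (Var vq)) Nop ;;
        vq ::= Var vq \<oplus> Num 1)
       Nop"
  let ?F = "\<lambda>k. filter (\<lambda>x. Suc i < snd x) (take k xs)"
  let ?I = "\<lambda>k t. var t vq = length (?F k) \<and> var t vy = code \<sigma> (?F k)"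
  have "?I (length xs) (run (For vj vjb (Var vm) P) ?s) \<and>
      time (For vj vjb (Var vm) P) ?s \<le> 6 + lcost (Var vm) + length xs * (7 + 5000)"
  proof (rule For_rule[where Inv = ?I])
    fix k t assume k: "k < length xs" and I: "?I k t" and vj: "var t vj = k"
      and fr: "\<forall>x. x \<notin> insert vj (insert vjb (written_vars P)) \<longrightarrow> var t x = var ?s x"
        "\<forall>c. c \<notin> written_arrs P \<longrightarrow> arr t c = arr ?s c"
    have "length (?F k) \<le> length ls" using assms(4) k length_filter_le[of _ "take k xs"] by (metis (no_types, lifting) le_trans length_take min.cobounded1)
    then have "arr t abit k = of_bool (\<sigma> (xs ! k))" "arr t aPw (var t vq) = 2 ^ length (?F k)"
       "arr t ab k = snd (xs ! k)" "var t vi = i"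
      using assms k fr I by (auto simp: keyed_def loaded_def P_def input_def)
    then show "?I (Suc k) (upd_var vj (Suc k) (run P t)) \<and> time P t \<le> 5000"
      using I vj k by (auto simp: P_def take_Suc_conv_app_nth code_append)
  qed (use assms in \<open>auto simp: P_def loaded_def\<close>)
  then show "var (run CODE_OUT s) vy = code \<sigma> (filter (\<lambda>x. Suc i < snd x) xs)"
    "time CODE_OUT s \<le> 10000 * (length xs + 1)"
    by (auto simp: CODE_OUT_def P_def)
qed

lemma edge_list_le: "length (edge_list i) \<le> length ls"
  by (metis edge_list card_mono distinct_card dist finite_lines lines_on_subset)

lemma pass_list_le: "length (pass_list (Suc i)) \<le> length (edge_list (Suc i))"
  by (simp add: edge_list_Suc)

definition extend :: "lstate \<Rightarrow> nat \<Rightarrow> (line \<Rightarrow> bool) \<Rightarrow> nat" where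
  "extend s i \<sigma> = arr s aR (var s vrr + code \<sigma> (pass_list i)) + edge_cost \<sigma> i"

lemma TRY_MASK_spec:
  assumes "input s" "loaded s (edge_list (Suc i))" "var s vi = Suc i" "var s vp = length (pass_list (Suc i))"
    "var s vmask = code \<sigma> (edge_list (Suc i))"
  defines "y \<equiv> var s vrn + code \<sigma> (pass_list (Suc (Suc i)))"
  shows "if arr s aR y = 0 \<or> extend s (Suc i) \<sigma> < arr s aR y
    then arr (run TRY_MASK s) aR = (arr s aR)(y := extend s (Suc i) \<sigma>) \<and>
      arr (run TRY_MASK s) aBest = (arr s aBest)(y := var s vmask)
    else arr (run TRY_MASK s) aR = arr s aR \<and> arr (run TRY_MASK s) aBest = arr s aBest"
    "time TRY_MASK s \<le> 100000 * ((length (edge_list (Suc i)) + 1) * (length (edge_list (Suc i)) + 1))"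
proof -
  let ?xs = "edge_list (Suc i)"
  let ?s1 = "run DECODE s" let ?s2 = "run EVAL ?s1" let ?s3 = "run CODE_IN ?s2" let ?s4 = "run CODE_OUT ?s3"
  note k1 = DECODE_spec[OF assms(1,2,5) edge_list_le]
  have l1: "loaded ?s1 ?xs" by (rule loaded_cong[OF assms(2)]) auto
  have v1: "var ?s1 vi = Suc i" using assms(3) by simp
  note e = EVAL_spec[OF l1 k1(1) v1]
  have i2: "input ?s2" by (rule input_cong[OF assms(1)]) auto
  have k2: "keyed ?s2 \<sigma> (pass_list (Suc i) @ bucket (Suc i))" 
    using k1(1) unfolding edge_list_Suc by (rule keyed_cong) auto
  have p: "var ?s2 vp = length (pass_list (Suc i))" using assms(4) by simp
  have ple: "length (pass_list (Suc i)) \<le> length ls" using pass_list_le edge_list_le le_trans by blast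
  note ci = CODE_IN_spec[OF i2 k2 p ple]
  have i3: "input ?s3" by (rule input_cong[OF assms(1)]) auto
  have l3: "loaded ?s3 ?xs" by (rule loaded_cong[OF assms(2)]) auto
  have k3: "keyed ?s3 \<sigma> ?xs" by (rule keyed_cong[OF k1(1)]) auto
  have v3: "var ?s3 vi = Suc i" using assms(3) by simp
  note co = CODE_OUT_spec[OF i3 l3 k3 edge_list_le v3]
  have run: "run TRY_MASK s = run UPDATE ?s4" by (simp add: TRY_MASK_def)
  have vx: "var ?s4 vx = code \<sigma> (pass_list (Suc i))" "var ?s4 vc = edge_cost \<sigma> (Suc i)"
    "var ?s4 vy = code \<sigma> (pass_list (Suc (Suc i)))"
    using ci(1) e(1) co(1) by (simp_all add: pass_list_Suc[of "Suc i"])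
  have fr: "arr ?s4 aR = arr s aR" "arr ?s4 aBest = arr s aBest" "var ?s4 vrr = var s vrr"
     "var ?s4 vrn = var s vrn" "var ?s4 vmask = var s vmask" by simp_all
  show "if arr s aR y = 0 \<or> extend s (Suc i) \<sigma> < arr s aR y
    then arr (run TRY_MASK s) aR = (arr s aR)(y := extend s (Suc i) \<sigma>) \<and>
      arr (run TRY_MASK s) aBest = (arr s aBest)(y := var s vmask)
    else arr (run TRY_MASK s) aR = arr s aR \<and> arr (run TRY_MASK s) aBest = arr s aBest"
    unfolding run extend_def y_def using vx fr by (simp add: UPDATE_def)
  let ?m = "length ?xs + 1"
  define Q where "Q = ?m * ?m"
  have "time TRY_MASK s = time DECODE s + (time EVAL ?s1 + (time CODE_IN ?s2 + (time CODE_OUT ?s3 + time UPDATE ?s4)))"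
    by (simp add: TRY_MASK_def)
  moreover have "time UPDATE ?s4 \<le> 10000" by (simp add: UPDATE_def)
  moreover have "?m \<le> Q" by (simp add: Q_def)
  ultimately have "time TRY_MASK s \<le> 100000 * Q"
    using k1(2) e(3)[folded Q_def] ci(2) co(2) pass_list_le[of i] by simp
  then show "time TRY_MASK s \<le> 100000 * (?m * ?m)" by (simp only: Q_def)
qed

text \<open>After the masks below \<open>M\<close>, each entry they reach is set and no larger than
  their values, and each nonzero entry of the new row is attained by some assignment.
  \<open>pos\<close> keeps every candidate value positive, so a stored value is never taken for an
  unset one; \<open>zero\<close> says that the new row starts out unset.\<close>

lemma masks_spec:
  assumes inp: "input s" and ld: "loaded s (edge_list (Suc i))" and vi: "var s vi = Suc i"
    and vp: "var s vp = length (pass_list (Suc i))"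
    and pos: "\<And>\<sigma>. arr s aR (var s vrr + code \<sigma> (pass_list (Suc i))) > 0"
    and rn: "var s vrn = var s vrr + 2 ^ length (pass_list (Suc i))"
    and zero: "\<forall>k\<ge>var s vrn. arr s aR k = 0"
  defines "s' \<equiv> run (For vmask vmb (Arr aPw (Var vm)) TRY_MASK) s"
  shows "\<And>k. k < var s vrn \<Longrightarrow> arr s' aR k = arr s aR k \<and> arr s' aBest k = arr s aBest k"
    "\<And>\<sigma>. 0 < arr s' aR (var s vrn + code \<sigma> (pass_list (Suc (Suc i))))"
    "\<And>\<sigma>. arr s' aR (var s vrn + code \<sigma> (pass_list (Suc (Suc i)))) \<le> extend s (Suc i) \<sigma>"
    "\<And>y. arr s' aR (var s vrn + y) \<noteq> 0 \<Longrightarrow> \<exists>\<sigma>. code \<sigma> (pass_list (Suc (Suc i))) = y \<and>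
        arr s' aBest (var s vrn + y) = code \<sigma> (edge_list (Suc i)) \<and> arr s' aR (var s vrn + y) = extend s (Suc i) \<sigma>"
    "time (For vmask vmb (Arr aPw (Var vm)) TRY_MASK) s \<le>
       200000 * (2 ^ length (edge_list (Suc i)) * ((length (edge_list (Suc i)) + 1) * (length (edge_list (Suc i)) + 1)))"
proof -
  let ?xs = "edge_list (Suc i)" and ?pl = "pass_list (Suc i)" and ?pl' = "pass_list (Suc (Suc i))"
  let ?rn = "var s vrn" and ?f = "extend s (Suc i)"
  \<comment> \<open>All quantities depend on an assignment only through its mask on the edge, so the
    invariant may quantify over assignments although the loop runs over masks.\<close>
  have agree: "code \<sigma> ?pl = code \<sigma>' ?pl \<and> code \<sigma> ?pl' = code \<sigma>' ?pl' \<and> edge_cost \<sigma> (Suc i) = edge_cost \<sigma>' (Suc i)"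
    if "code \<sigma> ?xs = code \<sigma>' ?xs" for \<sigma> \<sigma>'
  proof -
    have a: "\<forall>x\<in>set ?xs. \<sigma> x = \<sigma>' x" using that unfolding code_eq_iff .
    have "code \<sigma> ?pl = code \<sigma>' ?pl" unfolding code_eq_iff using a by (simp add: edge_list_Suc)
    moreover have "code \<sigma> ?pl' = code \<sigma>' ?pl'" unfolding code_eq_iff pass_list_Suc[of "Suc i"] using a by simp
    moreover have "edge_cost \<sigma> (Suc i) = edge_cost \<sigma>' (Suc i)"
      using a edge_list[of "Suc i"] by (intro edge_cost_cong) auto
    ultimately show ?thesis by blast
  qed
  have agree': "?f \<sigma> = ?f \<sigma>' \<and> code \<sigma> ?pl' = code \<sigma>' ?pl'" if "code \<sigma> ?xs = code \<sigma>' ?xs" for \<sigma> \<sigma>'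
    using agree[OF that] by (simp add: extend_def)
  have fpos: "0 < ?f \<sigma>" for \<sigma> using pos[of \<sigma>] by (simp add: extend_def)
  let ?I = "\<lambda>M t. (\<forall>k<?rn. arr t aR k = arr s aR k \<and> arr t aBest k = arr s aBest k) \<and>
     (\<forall>\<sigma>. code \<sigma> ?xs < M \<longrightarrow> 0 < arr t aR (?rn + code \<sigma> ?pl') \<and> arr t aR (?rn + code \<sigma> ?pl') \<le> ?f \<sigma>) \<and>
     (\<forall>y. arr t aR (?rn + y) \<noteq> 0 \<longrightarrow> (\<exists>\<sigma>. code \<sigma> ?pl' = y \<and>
        arr t aBest (?rn + y) = code \<sigma> ?xs \<and> arr t aR (?rn + y) = ?f \<sigma>))"
  have pw: "lval (Arr aPw (Var vm)) s = 2 ^ length ?xs"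
    using inp ld edge_list_le by (simp add: input_def loaded_def)
  have main: "?I (2 ^ length ?xs) s' \<and> time (For vmask vmb (Arr aPw (Var vm)) TRY_MASK) s \<le>
      6 + lcost (Arr aPw (Var vm)) + 2 ^ length ?xs * (7 + 100000 * ((length ?xs + 1) * (length ?xs + 1)))"
    unfolding s'_def
  proof (rule For_rule[where Inv = ?I])
    fix M t assume M: "M < 2 ^ length ?xs" and I: "?I M t" and vm: "var t vmask = M"
      and fr: "\<forall>x. x \<notin> insert vmask (insert vmb (written_vars TRY_MASK)) \<longrightarrow> var t x = var s x"
        "\<forall>c. c \<notin> written_arrs TRY_MASK \<longrightarrow> arr t c = arr s c"
    obtain \<sigma> where \<sigma>: "code \<sigma> ?xs = M" using code_surj[OF _ M] edge_list by blast
    have rr: "var t vrr = var s vrr" "var t vrn = ?rn" using fr by auto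
    \<comment> \<open>The previous row ends where the new one begins, so its entries are still those
      of the state before the loop.\<close>
    have "arr t aR (var t vrr + code \<sigma> ?pl) = arr s aR (var s vrr + code \<sigma> ?pl)"
      using I code_less[of \<sigma> ?pl] rn rr by simp
    then have f: "extend t (Suc i) \<sigma> = ?f \<sigma>" by (simp add: extend_def)
    define y where "y = code \<sigma> ?pl'"
    have 1: "input t" by (rule input_cong[OF inp]) (use fr in auto)
    have 2: "loaded t ?xs" by (rule loaded_cong[OF ld]) (use fr in auto)
    have 3: "var t vi = Suc i" "var t vp = length ?pl" "var t vmask = code \<sigma> ?xs" using fr vi vp vm \<sigma> by auto
    note sp = TRY_MASK_spec[OF 1 2 3, unfolded f rr(2) vm, folded y_def]
    let ?t = "run TRY_MASK t"
    have "?I (Suc M) ?t"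
    proof (intro conjI allI impI)
      fix k assume "k < ?rn"
      then show "arr ?t aR k = arr s aR k" "arr ?t aBest k = arr s aBest k"
        using sp(1) I by (auto split: if_splits)
    next
      fix \<sigma>' assume "code \<sigma>' ?xs < Suc M"
      then consider "code \<sigma>' ?xs < M" | "code \<sigma>' ?xs = code \<sigma> ?xs" using \<sigma> by linarith
      then have "0 < arr ?t aR (?rn + code \<sigma>' ?pl') \<and> arr ?t aR (?rn + code \<sigma>' ?pl') \<le> ?f \<sigma>'"
      proof cases
        case 1
        then have *: "0 < arr t aR (?rn + code \<sigma>' ?pl')" "arr t aR (?rn + code \<sigma>' ?pl') \<le> ?f \<sigma>'" using I by auto
        show ?thesis
        proof (cases "arr t aR (?rn + y) = 0 \<or> ?f \<sigma> < arr t aR (?rn + y)")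
          case True
          then have "arr ?t aR = (arr t aR)(?rn + y := ?f \<sigma>)" using sp(1) by auto
          then show ?thesis using * True fpos by auto
        next
          case False
          then have "arr ?t aR = arr t aR" using sp(1) by auto
          then show ?thesis using * by simp
        qed
      next
        case 2
        then have "code \<sigma>' ?pl' = y" "?f \<sigma>' = ?f \<sigma>" using agree'[of \<sigma>' \<sigma>] by (auto simp: y_def)
        then show ?thesis using sp(1) fpos[of \<sigma>] by (auto split: if_splits)
      qed
      then show "0 < arr ?t aR (?rn + code \<sigma>' ?pl')" "arr ?t aR (?rn + code \<sigma>' ?pl') \<le> ?f \<sigma>'" by auto
    next
      fix z assume z: "arr ?t aR (?rn + z) \<noteq> 0"
      show "\<exists>\<sigma>. code \<sigma> ?pl' = z \<and> arr ?t aBest (?rn + z) = code \<sigma> ?xs \<and> arr ?t aR (?rn + z) = ?f \<sigma>"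
      proof (cases "z = y \<and> (arr t aR (?rn + y) = 0 \<or> ?f \<sigma> < arr t aR (?rn + y))")
        case True
        then show ?thesis using sp(1) \<sigma> y_def by (intro exI[of _ \<sigma>]) auto
      next
        case False
        then have "arr ?t aR (?rn + z) = arr t aR (?rn + z)" "arr ?t aBest (?rn + z) = arr t aBest (?rn + z)"
          using sp(1) by (auto split: if_splits)
        then show ?thesis using I z by simp
      qed
    qed
    then show "?I (Suc M) (upd_var vmask (Suc M) ?t) \<and>
        time TRY_MASK t \<le> 100000 * ((length ?xs + 1) * (length ?xs + 1))"
      using sp(2) by simp
  qed (use pw zero in auto)
  have c: "code \<sigma> ?xs < 2 ^ length ?xs" for \<sigma> by (rule code_less)
  show "\<And>k. k < var s vrn \<Longrightarrow> arr s' aR k = arr s aR k \<and> arr s' aBest k = arr s aBest k"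
    "\<And>\<sigma>. 0 < arr s' aR (?rn + code \<sigma> ?pl')" "\<And>\<sigma>. arr s' aR (?rn + code \<sigma> ?pl') \<le> ?f \<sigma>"
    "\<And>y. arr s' aR (?rn + y) \<noteq> 0 \<Longrightarrow> \<exists>\<sigma>. code \<sigma> ?pl' = y \<and>
        arr s' aBest (?rn + y) = code \<sigma> ?xs \<and> arr s' aR (?rn + y) = ?f \<sigma>"
    using main c by blast+
  let ?A = "2 ^ length ?xs :: nat" and ?B = "(length ?xs + 1) * (length ?xs + 1)"
  have "1 \<le> ?A" "1 \<le> ?B" by simp_all
  then have "?A \<le> ?A * ?B" "1 \<le> ?A * ?B" by (metis mult_le_mono nat_mult_1_right order_refl)+
  have "time (For vmask vmb (Arr aPw (Var vm)) TRY_MASK) s \<le> 6 + lcost (Arr aPw (Var vm)) + ?A * (7 + 100000 * ?B)"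
    using main by blast
  also have "\<dots> = 74 + 7 * ?A + 100000 * (?A * ?B)" by (simp add: distrib_left mult.left_commute)
  also have "\<dots> \<le> 200000 * (?A * ?B)" using \<open>?A \<le> ?A * ?B\<close> \<open>1 \<le> ?A * ?B\<close> by linarith
  finally show "time (For vmask vmb (Arr aPw (Var vm)) TRY_MASK) s \<le> 200000 * (?A * ?B)" .
qed

end

section \<open>Line lists of the edges, layout of the tables, and the forward sweep\<close>

definition BUCKETS :: lcom where
  "BUCKETS = For vj vjb (Var vL) (
     aNext[Var vj] ::= Arr aHead (Arr aA (Var vj)) ;;
     aHead[Arr aA (Var vj)] ::= Var vj \<oplus> Num 1 ;;
     aCnt[Arr aA (Var vj)] ::= Arr aCnt (Arr aA (Var vj)) \<oplus> Num 1)"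

definition POWERS :: lcom where
  "POWERS = aPw[Num 0] ::= Num 1 ;; For vj vjb (Var vL) (
     aPw[Var vj \<oplus> Num 1] ::= Arr aPw (Var vj) \<oplus> Arr aPw (Var vj))"

definition KEEP :: lcom where
  "KEEP = For vj vjb (Var vm) (
     vt ::= Arr aLst (Var vpl \<oplus> Var vj) ;;
     Cond (Var vi) (Arr aB (Var vt))
       (aLst[Var vnl \<oplus> Var vnm] ::= Var vt ;; vnm ::= Var vnm \<oplus> Num 1) Nop)"

definition FRESH :: lcom where
  "FRESH = vt ::= Arr aHead (Var vi) ;; For vj vjb (Arr aCnt (Var vi)) (
     vt ::= Var vt \<ominus> Num 1 ;; aLst[Var vnl \<oplus> Var vnm] ::= Var vt ;;
     vnm ::= Var vnm \<oplus> Num 1 ;; vt ::= Arr aNext (Var vt))"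

definition BUILD :: lcom where
  "BUILD = vi ::= Var ve \<oplus> Num 1 ;; vnl ::= Var vpl \<oplus> Var vm ;; vnm ::= Num 0 ;; KEEP ;;
     vp ::= Var vnm ;; FRESH ;; vpl ::= Var vnl ;; vm ::= Var vnm"

definition RECORD :: lcom where
  "RECORD = aLp[Var vi] ::= Var vpl ;; aLen[Var vi] ::= Var vm ;; aPas[Var vi] ::= Var vp ;;
     aRp[Var vi] ::= Var vrr ;; vW ::= Var vW \<oplus> Num 1 \<oplus> Var vm \<oplus> Var vm \<oplus> Var vm \<oplus> Var vm ;;
     vrn ::= Var vrr \<oplus> Arr aPw (Var vp)"

definition EDGE :: lcom where
  "EDGE = BUILD ;; RECORD ;; LOAD ;; For vmask vmb (Arr aPw (Var vm)) TRY_MASK ;; vrr ::= Var vrn"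

text \<open>The entry 1 at position 0 is cost 0 in the shifted values: the single entry of the row
  of station 1, through which no line passes.\<close>

definition FORWARD :: lcom where
  "FORWARD = BUCKETS ;; POWERS ;; aR[Num 0] ::= Num 1 ;; For ve veb (Var vn \<ominus> Num 1) EDGE"

lemma writes_forward [simp]:
  "written_vars BUCKETS = {vj, vjb}" "written_arrs BUCKETS = {aNext, aHead, aCnt}"
  "written_vars POWERS = {vj, vjb}" "written_arrs POWERS = {aPw}"
  "written_vars KEEP = {vj, vjb, vt, vnm}" "written_arrs KEEP = {aLst}"
  "written_vars FRESH = {vj, vjb, vt, vnm}" "written_arrs FRESH = {aLst}"
  "written_vars BUILD = {vi, vnl, vnm, vj, vjb, vt, vp, vpl, vm}" "written_arrs BUILD = {aLst}"
  "written_vars RECORD = {vW, vrn}" "written_arrs RECORD = {aLp, aLen, aPas, aRp}"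
  "written_vars EDGE = {vi, vnl, vnm, vj, vjb, vt, vp, vpl, vm, vW, vrn, vmask, vmb, vv, vc, vu, vd, vk, vkb, vx, vy, vq, vrr}"
  "written_arrs EDGE = {aLst, aLp, aLen, aPas, aRp, aid, aa, ab, abit, akey, atau, aR, aBest}"
  by (auto simp: BUCKETS_def POWERS_def KEEP_def FRESH_def BUILD_def RECORD_def EDGE_def)

context mlcm_input
begin

text \<open>Pointers are line numbers plus one, and 0 ends a list. The bound \<open>b\<close> says
  that only the lines inserted so far occur, so setting the successor of line \<open>b\<close>
  leaves the existing lists intact.\<close>

primrec linked :: "nat \<Rightarrow> (nat \<Rightarrow> nat) \<Rightarrow> nat \<Rightarrow> line list \<Rightarrow> bool" where
  "linked b nx p [] = True"
| "linked b nx p (x # xs) = (0 < p \<and> p \<le> b \<and> ls ! (p - 1) = x \<and> linked b nx (nx (p - 1)) xs)"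

lemma linked_upd: "linked b nx p xs \<Longrightarrow> linked (Suc b) (nx(b := v)) p xs"
  by (induction xs arbitrary: p) auto

definition buckets :: "lstate \<Rightarrow> bool" where
  "buckets s \<longleftrightarrow> (\<forall>a. arr s aCnt a = length (bucket a) \<and>
     linked (length ls) (arr s aNext) (arr s aHead a) (bucket a))"

lemma BUCKETS_spec:
  assumes "var s vL = length ls" "\<And>l. l < length ls \<Longrightarrow> arr s aA l = fst (ls ! l)"
    "arr s aHead = (\<lambda>_. 0)" "arr s aCnt = (\<lambda>_. 0)"
  shows "buckets (run BUCKETS s)" "time BUCKETS s \<le> 10000 * (length ls + 1)"
proof -
  define P where "P = aNext[Var vj] ::= Arr aHead (Arr aA (Var vj)) ;;
     aHead[Arr aA (Var vj)] ::= Var vj \<oplus> Num 1 ;;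
     aCnt[Arr aA (Var vj)] ::= Arr aCnt (Arr aA (Var vj)) \<oplus> Num 1"
  let ?b = "\<lambda>k a. filter (\<lambda>x. fst x = a) (rev (take k ls))"
  let ?I = "\<lambda>k t. \<forall>a. arr t aCnt a = length (?b k a) \<and> linked k (arr t aNext) (arr t aHead a) (?b k a)"
  have "?I (length ls) (run (For vj vjb (Var vL) P) s) \<and>
      time (For vj vjb (Var vL) P) s \<le> 6 + lcost (Var vL) + length ls * (7 + 9000)"
  proof (rule For_rule[where Inv = ?I])
    fix k t assume k: "k < length ls" and I: "?I k t" and vj: "var t vj = k"
      and fr: "\<forall>c. c \<notin> written_arrs P \<longrightarrow> arr t c = arr s c"
    have "arr t aA k = fst (ls ! k)" using assms k fr by (auto simp: P_def)
    then show "?I (Suc k) (upd_var vj (Suc k) (run P t)) \<and> time P t \<le> 9000"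
      using I vj k by (auto simp: P_def take_Suc_conv_app_nth intro: linked_upd)
  qed (use assms in \<open>auto simp: P_def\<close>)
  then show "buckets (run BUCKETS s)" "time BUCKETS s \<le> 10000 * (length ls + 1)"
    by (auto simp: BUCKETS_def P_def buckets_def bucket_def)
qed

lemma POWERS_spec:
  assumes "var s vL = length ls"
  shows "\<And>j. j \<le> length ls \<Longrightarrow> arr (run POWERS s) aPw j = 2 ^ j" "time POWERS s \<le> 10000 * (length ls + 1)"
proof -
  let ?s = "run (aPw[Num 0] ::= Num 1) s"
  define P where "P = aPw[Var vj \<oplus> Num 1] ::= Arr aPw (Var vj) \<oplus> Arr aPw (Var vj)"
  let ?I = "\<lambda>k t. \<forall>j\<le>k. arr t aPw j = 2 ^ j"
  have "?I (length ls) (run (For vj vjb (Var vL) P) ?s) \<and>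
      time (For vj vjb (Var vL) P) ?s \<le> 6 + lcost (Var vL) + length ls * (7 + 5000)"
    by (rule For_rule[where Inv = ?I]) (use assms in \<open>auto simp: P_def le_Suc_eq\<close>)
  then show "\<And>j. j \<le> length ls \<Longrightarrow> arr (run POWERS s) aPw j = 2 ^ j" "time POWERS s \<le> 10000 * (length ls + 1)"
    by (auto simp: POWERS_def P_def)
qed

definition stored :: "(nat \<Rightarrow> nat) \<Rightarrow> nat \<Rightarrow> line list \<Rightarrow> bool" where
  "stored A p xs \<longleftrightarrow> (\<forall>j<length xs. A (p + j) < length ls \<and> ls ! A (p + j) = xs ! j)"

lemma stored_snoc:
  "stored A p xs \<Longrightarrow> l < length ls \<Longrightarrow> stored (A(p + length xs := l)) p (xs @ [ls ! l])"
  by (auto simp: stored_def nth_append less_Suc_eq)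

lemma stored_cong: "stored A p xs \<Longrightarrow> (\<And>k. k < p + length xs \<Longrightarrow> A' k = A k) \<Longrightarrow> stored A' p xs"
  by (simp add: stored_def)

lemma KEEP_spec:
  assumes "input s" "stored (arr s aLst) (var s vpl) xs" "var s vm = length xs" "var s vi = i"
    "var s vnm = 0" "var s vnl = var s vpl + length xs"
  defines "s' \<equiv> run KEEP s"
  shows "stored (arr s' aLst) (var s vnl) (filter (\<lambda>x. i < snd x) xs)"
    "var s' vnm = length (filter (\<lambda>x. i < snd x) xs)"
    "\<And>k. k < var s vnl \<Longrightarrow> arr s' aLst k = arr s aLst k"
    "time KEEP s \<le> 10000 * (length xs + 1)"
proof -
  define P where "P = vt ::= Arr aLst (Var vpl \<oplus> Var vj) ;;
     Cond (Var vi) (Arr aB (Var vt))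
       (aLst[Var vnl \<oplus> Var vnm] ::= Var vt ;; vnm ::= Var vnm \<oplus> Num 1) Nop"
  let ?F = "\<lambda>k. filter (\<lambda>x. i < snd x) (take k xs)"
  let ?I = "\<lambda>k t. stored (arr t aLst) (var s vnl) (?F k) \<and> var t vnm = length (?F k) \<and>
     (\<forall>k<var s vnl. arr t aLst k = arr s aLst k)"
  have main: "?I (length xs) (run (For vj vjb (Var vm) P) s) \<and>
      time (For vj vjb (Var vm) P) s \<le> 6 + lcost (Var vm) + length xs * (7 + 5000)"
  proof (rule For_rule[where Inv = ?I])
    fix k t assume k: "k < length xs" and I: "?I k t" and vj: "var t vj = k"
      and fr: "\<forall>x. x \<notin> insert vj (insert vjb (written_vars P)) \<longrightarrow> var t x = var s x"
        "\<forall>c. c \<notin> written_arrs P \<longrightarrow> arr t c = arr s c"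
    define l where "l = arr s aLst (var s vpl + k)"
    have l: "l < length ls" "ls ! l = xs ! k" using assms(2) k by (auto simp: l_def stored_def)
    have "arr t aLst (var t vpl + k) = l" using I k assms(6) fr by (simp add: l_def P_def)
    moreover have "arr t aB l = snd (xs ! k)" "var t vi = i" "var t vnl = var s vnl" "var t vpl = var s vpl"
      using assms(1,4) l fr by (auto simp: input_def P_def)
    ultimately show "?I (Suc k) (upd_var vj (Suc k) (run P t)) \<and> time P t \<le> 5000"
      using I vj k l stored_snoc[of "arr t aLst" "var s vnl" "?F k" l]
      by (auto simp: P_def take_Suc_conv_app_nth)
  qed (use assms in \<open>auto simp: P_def stored_def\<close>)
  then show "stored (arr s' aLst) (var s vnl) (filter (\<lambda>x. i < snd x) xs)"
    "var s' vnm = length (filter (\<lambda>x. i < snd x) xs)"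
    "\<And>k. k < var s vnl \<Longrightarrow> arr s' aLst k = arr s aLst k"
    "time KEEP s \<le> 10000 * (length xs + 1)"
    by (auto simp: KEEP_def P_def s'_def)
qed

lemma FRESH_spec:
  assumes "buckets s" "stored (arr s aLst) (var s vnl) zs" "var s vi = i" "var s vnm = length zs"
  defines "s' \<equiv> run FRESH s"
  shows "stored (arr s' aLst) (var s vnl) (zs @ bucket i)"
    "var s' vnm = length (zs @ bucket i)"
    "\<And>k. k < var s vnl \<Longrightarrow> arr s' aLst k = arr s aLst k"
    "time FRESH s \<le> 10000 * (length (bucket i) + 1)"
proof -
  let ?s = "run (vt ::= Arr aHead (Var vi)) s"
  define P where "P = vt ::= Var vt \<ominus> Num 1 ;; aLst[Var vnl \<oplus> Var vnm] ::= Var vt ;;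
     vnm ::= Var vnm \<oplus> Num 1 ;; vt ::= Arr aNext (Var vt)"
  let ?ys = "bucket i"
  let ?F = "\<lambda>k. zs @ take k ?ys"
  let ?I = "\<lambda>k t. stored (arr t aLst) (var s vnl) (?F k) \<and> var t vnm = length (?F k) \<and>
     (\<forall>k<var s vnl. arr t aLst k = arr s aLst k) \<and>
     linked (length ls) (arr s aNext) (var t vt) (drop k ?ys)"
  have main: "?I (length ?ys) (run (For vj vjb (Arr aCnt (Var vi)) P) ?s) \<and>
      time (For vj vjb (Arr aCnt (Var vi)) P) ?s \<le> 6 + lcost (Arr aCnt (Var vi)) + length ?ys * (7 + 5000)"
  proof (rule For_rule[where Inv = ?I])
    fix k t assume k: "k < length ?ys" and I: "?I k t" and vj: "var t vj = k"
      and fr: "\<forall>x. x \<notin> insert vj (insert vjb (written_vars P)) \<longrightarrow> var t x = var ?s x"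
        "\<forall>c. c \<notin> written_arrs P \<longrightarrow> arr t c = arr ?s c"
    define l where "l = var t vt - 1"
    have d: "drop k ?ys = ?ys ! k # drop (Suc k) ?ys" using k by (simp add: Cons_nth_drop_Suc)
    have l: "l < length ls" "ls ! l = ?ys ! k" "linked (length ls) (arr s aNext) (arr s aNext l) (drop (Suc k) ?ys)"
      using I unfolding d by (auto simp: l_def)
    have "arr t aNext = arr s aNext" "var t vnl = var s vnl"
      using fr by (auto simp: P_def)
    then show "?I (Suc k) (upd_var vj (Suc k) (run P t)) \<and> time P t \<le> 5000"
      using I vj k l stored_snoc[of "arr t aLst" "var s vnl" "?F k" l]
      by (auto simp: P_def take_Suc_conv_app_nth l_def)
  qed (use assms in \<open>auto simp: P_def buckets_def\<close>)
  then show "stored (arr s' aLst) (var s vnl) (zs @ bucket i)"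
    "var s' vnm = length (zs @ bucket i)"
    "\<And>k. k < var s vnl \<Longrightarrow> arr s' aLst k = arr s aLst k"
    "time FRESH s \<le> 10000 * (length (bucket i) + 1)"
    by (auto simp: FRESH_def P_def s'_def)
qed

lemma BUILD_spec:
  assumes "input s" "buckets s" "stored (arr s aLst) (var s vpl) (edge_list e)"
    "var s vm = length (edge_list e)" "var s ve = e"
  defines "s' \<equiv> run BUILD s"
  shows "stored (arr s' aLst) (var s vpl + length (edge_list e)) (edge_list (Suc e))"
    "var s' vi = Suc e" "var s' vpl = var s vpl + length (edge_list e)"
    "var s' vm = length (edge_list (Suc e))" "var s' vp = length (pass_list (Suc e))"
    "\<And>k. k < var s vpl + length (edge_list e) \<Longrightarrow> arr s' aLst k = arr s aLst k"
    "time BUILD s \<le> 30000 * (length (edge_list e) + length (edge_list (Suc e)) + 1)"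
proof -
  let ?s1 = "run (vi ::= Var ve \<oplus> Num 1 ;; vnl ::= Var vpl \<oplus> Var vm ;; vnm ::= Num 0) s"
  let ?s2 = "run KEEP ?s1"
  let ?s3 = "run (vp ::= Var vnm) ?s2"
  let ?s4 = "run FRESH ?s3"
  have i1: "input ?s1" by (rule input_cong[OF assms(1)]) auto
  have st1: "stored (arr ?s1 aLst) (var ?s1 vpl) (edge_list e)" using assms by simp
  have v1: "var ?s1 vm = length (edge_list e)" "var ?s1 vi = Suc e" "var ?s1 vnm = 0"
     "var ?s1 vnl = var ?s1 vpl + length (edge_list e)" using assms by auto
  note k = KEEP_spec[OF i1 st1 v1, folded pass_list_Suc]
  have b3: "buckets ?s3" using assms(2) by (simp add: buckets_def)
  have nl: "var ?s3 vnl = var ?s1 vnl" "var ?s1 vnl = var s vpl + length (edge_list e)" using assms by auto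
  have st3: "stored (arr ?s3 aLst) (var ?s3 vnl) (pass_list (Suc e))" using k(1) by simp
  have v3: "var ?s3 vi = Suc e" "var ?s3 vnm = length (pass_list (Suc e))"
    using k(2) assms(5) by auto
  note f = FRESH_spec[OF b3 st3 v3, folded edge_list_Suc]
  have r: "run BUILD s = run (vpl ::= Var vnl ;; vm ::= Var vnm) ?s4" by (simp add: BUILD_def)
  show "stored (arr s' aLst) (var s vpl + length (edge_list e)) (edge_list (Suc e))"
    using f(1) nl unfolding s'_def r by simp
  show "var s' vi = Suc e" "var s' vpl = var s vpl + length (edge_list e)"
     "var s' vm = length (edge_list (Suc e))" "var s' vp = length (pass_list (Suc e))"
    using nl f(2) v3 k(2) assms(4,5) unfolding s'_def r by auto
  show "arr s' aLst k = arr s aLst k" if "k < var s vpl + length (edge_list e)" for k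
  proof -
    have "arr ?s4 aLst k = arr ?s3 aLst k" using f(3) nl that by simp
    also have "\<dots> = arr s aLst k" using k(3)[of k] nl that by simp
    finally show ?thesis unfolding s'_def r by simp
  qed
  have "time BUILD s \<le> 100 + time KEEP ?s1 + time FRESH ?s3" by (simp add: BUILD_def)
  moreover have "length (bucket (Suc e)) \<le> length (edge_list (Suc e))" by (simp add: edge_list_Suc)
  ultimately show "time BUILD s \<le> 30000 * (length (edge_list e) + length (edge_list (Suc e)) + 1)"
    using k(4) f(4) by simp
qed

definition list_ptr :: "nat \<Rightarrow> nat" where
  "list_ptr i = (\<Sum>j<i. length (edge_list j))"

text \<open>Rows are packed without gaps, with one entry per mask of the lines passing the
  station.\<close>

definition row_ptr :: "nat \<Rightarrow> nat" where
  "row_ptr i = (\<Sum>j=1..<i. 2 ^ length (pass_list j))"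

text \<open>An edge contributes one number for the count and two numbers per line for each of its
  two orders.\<close>

definition out_ptr :: "nat \<Rightarrow> nat" where
  "out_ptr i = (\<Sum>j=1..<i. 1 + 4 * length (edge_list j))"

lemma list_ptr_Suc: "list_ptr (Suc i) = list_ptr i + length (edge_list i)"
  by (simp add: list_ptr_def)

lemma row_ptr_Suc: "row_ptr (Suc (Suc i)) = row_ptr (Suc i) + 2 ^ length (pass_list (Suc i))"
  by (simp add: row_ptr_def)

lemma out_ptr_Suc: "out_ptr (Suc (Suc i)) = out_ptr (Suc i) + (1 + 4 * length (edge_list (Suc i)))"
  by (simp add: out_ptr_def)

lemma list_ptr_mono: "i \<le> j \<Longrightarrow> list_ptr i \<le> list_ptr j"
  unfolding list_ptr_def by (intro sum_mono2) auto

lemma row_ptr_mono: "i \<le> j \<Longrightarrow> row_ptr i \<le> row_ptr j"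
  unfolding row_ptr_def by (intro sum_mono2) auto

definition row_values :: "lstate \<Rightarrow> nat \<Rightarrow> nat \<Rightarrow> nat" where
  "row_values t i y = arr t aR (row_ptr i + y)"

definition row_choices :: "lstate \<Rightarrow> nat \<Rightarrow> nat \<Rightarrow> nat" where
  "row_choices t i y = arr t aBest (row_ptr i + y)"

lemma row_index: "row_ptr (Suc i) + code \<sigma> (pass_list (Suc i)) < row_ptr (Suc (Suc i))"
  using code_less[of \<sigma> "pass_list (Suc i)"] by (simp add: row_ptr_Suc)

lemma row_correct_cong:
  assumes "row_correct (row_values s) (row_choices s) (Suc i)"
    "\<And>k. k < row_ptr (Suc (Suc (Suc i))) \<Longrightarrow> arr t aR k = arr s aR k \<and> arr t aBest k = arr s aBest k"
  shows "row_correct (row_values t) (row_choices t) (Suc i)"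
proof -
  have "row_values t (Suc i) (code \<sigma> (pass_list (Suc i))) = row_values s (Suc i) (code \<sigma> (pass_list (Suc i)))"
    "row_values t (Suc (Suc i)) (code \<sigma> (pass_list (Suc (Suc i)))) = row_values s (Suc (Suc i)) (code \<sigma> (pass_list (Suc (Suc i))))"
    "row_choices t (Suc (Suc i)) (code \<sigma> (pass_list (Suc (Suc i)))) = row_choices s (Suc (Suc i)) (code \<sigma> (pass_list (Suc (Suc i))))"
    for \<sigma>
    using assms(2) row_index[of i \<sigma>] row_index[of "Suc i" \<sigma>] row_ptr_mono[of "Suc (Suc i)" "Suc (Suc (Suc i))"]
    by (auto simp: row_values_def row_choices_def)
  then show ?thesis using assms(1) by (simp add: row_correct_def)
qed

definition tables :: "nat \<Rightarrow> lstate \<Rightarrow> bool" where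
  "tables e t \<longleftrightarrow> (\<forall>i\<le>e. stored (arr t aLst) (list_ptr i) (edge_list i)) \<and>
     (\<forall>i<e. arr t aLp (Suc i) = list_ptr (Suc i) \<and> arr t aLen (Suc i) = length (edge_list (Suc i)) \<and>
        arr t aPas (Suc i) = length (pass_list (Suc i)) \<and> arr t aRp (Suc i) = row_ptr (Suc i) \<and>
        row_correct (row_values t) (row_choices t) (Suc i))"

text \<open>The row of station \<open>e + 1\<close> is filled for every assignment, and all cells
  behind it are still 0, as the next row requires.\<close>

definition forward_inv :: "nat \<Rightarrow> lstate \<Rightarrow> bool" where
  "forward_inv e t \<longleftrightarrow> tables e t \<and> input t \<and> buckets t \<and>
     var t vm = length (edge_list e) \<and> var t vpl = list_ptr e \<and>
     var t vrr = row_ptr (Suc e) \<and> var t vW = out_ptr (Suc e) \<and> arr t aR 0 = 1 \<and>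
     (\<forall>\<sigma>. 0 < arr t aR (row_ptr (Suc e) + code \<sigma> (pass_list (Suc e)))) \<and>
     (\<forall>k\<ge>row_ptr (Suc (Suc e)). arr t aR k = 0)"

lemma EDGE_spec:
  assumes I: "forward_inv e s" and ve: "var s ve = e"
    and K: "length (edge_list e) \<le> K" "length (edge_list (Suc e)) \<le> K"
  shows "forward_inv (Suc e) (run EDGE s) \<and> time EDGE s \<le> 500000 * (2 ^ K * ((K + 1) * (K + 1)))"
proof -
  have tb: "tables e s" and inp: "input s" and bu: "buckets s" and vm: "var s vm = length (edge_list e)"
    and vpl: "var s vpl = list_ptr e" and vrr: "var s vrr = row_ptr (Suc e)" and vW: "var s vW = out_ptr (Suc e)"
    and R0: "arr s aR 0 = 1" and Rpos: "\<And>\<sigma>. 0 < arr s aR (row_ptr (Suc e) + code \<sigma> (pass_list (Suc e)))"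
    and Rz: "\<And>k. row_ptr (Suc (Suc e)) \<le> k \<Longrightarrow> arr s aR k = 0"
    using I unfolding forward_inv_def by auto
  let ?xs = "edge_list (Suc e)" and ?pl = "pass_list (Suc e)"
  let ?s1 = "run BUILD s"
  have "stored (arr s aLst) (var s vpl) (edge_list e)" using tb vpl by (simp add: tables_def)
  note b = BUILD_spec[OF inp bu this vm ve, unfolded vpl list_ptr_Suc[symmetric]]
  let ?s2 = "run RECORD ?s1"
  have inp1: "input ?s1" by (rule input_cong[OF inp]) auto
  have inp2: "input ?s2" by (rule input_cong[OF inp]) auto
  have ple: "length ?pl \<le> length ls" using pass_list_le edge_list_le le_trans by blast
  have pw: "arr ?s1 aPw (length ?pl) = 2 ^ length ?pl" using input_power[OF inp1 ple] .
  have r2: "var ?s2 vrn = row_ptr (Suc (Suc e))" "var ?s2 vrr = row_ptr (Suc e)"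
     "var ?s2 vW = out_ptr (Suc (Suc e))" 
    using b(4,5) pw vrr vW by (simp_all add: RECORD_def row_ptr_Suc out_ptr_Suc)
  have v2: "var ?s2 vi = Suc e" "var ?s2 vm = length ?xs" "var ?s2 vp = length ?pl" "var ?s2 vpl = list_ptr (Suc e)"
    using b by auto
  have rec: "arr ?s2 aLp = (arr s aLp)(Suc e := list_ptr (Suc e))" "arr ?s2 aLen = (arr s aLen)(Suc e := length ?xs)"
    "arr ?s2 aPas = (arr s aPas)(Suc e := length ?pl)" "arr ?s2 aRp = (arr s aRp)(Suc e := row_ptr (Suc e))"
    using b vrr by (simp_all add: RECORD_def)
  have ld: "\<forall>j<length ?xs. arr ?s2 aLst (var ?s2 vpl + j) < length ls \<and> ls ! arr ?s2 aLst (var ?s2 vpl + j) = ?xs ! j"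
    using b(1) v2(4) by (simp add: stored_def)
  note l = LOAD_spec[OF inp2 v2(2) ld]
  let ?s3 = "run LOAD ?s2"
  let ?M = "For vmask vmb (Arr aPw (Var vm)) TRY_MASK"
  have inp3: "input ?s3" by (rule input_cong[OF inp]) auto
  have v3: "var ?s3 vi = Suc e" "var ?s3 vp = length ?pl" using v2 by auto
  have R3: "arr ?s3 aR = arr s aR" "arr ?s3 aBest = arr s aBest" "var ?s3 vrr = row_ptr (Suc e)"
     "var ?s3 vrn = row_ptr (Suc (Suc e))" using r2 by auto
  have pos3: "\<And>\<sigma>. 0 < arr ?s3 aR (var ?s3 vrr + code \<sigma> ?pl)" using Rpos R3 by simp
  have rn3: "var ?s3 vrn = var ?s3 vrr + 2 ^ length ?pl" using R3 by (simp add: row_ptr_Suc)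
  have z3: "\<forall>k\<ge>var ?s3 vrn. arr ?s3 aR k = 0" using Rz R3 by simp
  note m = masks_spec[OF inp3 l(1) v3 pos3 rn3 z3, unfolded R3]
  let ?s4 = "run ?M ?s3"
  have r: "run EDGE s = run (vrr ::= Var vrn) ?s4" by (simp add: EDGE_def)
  have f4: "arr ?s4 c = arr ?s3 c" if "c \<notin> written_arrs TRY_MASK" for c using that by simp
  have ext: "extend ?s3 (Suc e) \<sigma> = row_values s (Suc e) (code \<sigma> ?pl) + edge_cost \<sigma> (Suc e)" for \<sigma>
    using R3 by (simp add: extend_def row_values_def)
  have same: "row_values ?s4 (Suc e) (code \<sigma> ?pl) = row_values s (Suc e) (code \<sigma> ?pl)" for \<sigma>
    using m(1)[OF row_index[of e \<sigma>]] by (simp add: row_values_def)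
  have new: "row_correct (row_values ?s4) (row_choices ?s4) (Suc e)"
    unfolding row_correct_def
  proof (intro allI conjI)
    fix \<sigma>
    let ?y = "code \<sigma> (pass_list (Suc (Suc e)))"
    show "row_values ?s4 (Suc (Suc e)) ?y \<le> row_values ?s4 (Suc e) (code \<sigma> ?pl) + edge_cost \<sigma> (Suc e)"
      using m(3)[of \<sigma>] ext[of \<sigma>] same[of \<sigma>] by (simp add: row_values_def)
    have "row_values ?s4 (Suc (Suc e)) ?y \<noteq> 0" using m(2)[of \<sigma>] by (simp add: row_values_def)
    then obtain \<sigma>' where "code \<sigma>' (pass_list (Suc (Suc e))) = ?y" "row_choices ?s4 (Suc (Suc e)) ?y = code \<sigma>' ?xs"
      "row_values ?s4 (Suc (Suc e)) ?y = extend ?s3 (Suc e) \<sigma>'"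
      using m(4)[of ?y] by (auto simp: row_values_def row_choices_def)
    then show "\<exists>\<sigma>'. code \<sigma>' (pass_list (Suc (Suc e))) = ?y \<and> row_choices ?s4 (Suc (Suc e)) ?y = code \<sigma>' ?xs \<and>
       row_values ?s4 (Suc (Suc e)) ?y = row_values ?s4 (Suc e) (code \<sigma>' ?pl) + edge_cost \<sigma>' (Suc e)"
      using ext same by (intro exI[of _ \<sigma>']) simp
  qed
  have lst: "stored (arr ?s4 aLst) (list_ptr i) (edge_list i)" if "i \<le> Suc e" for i
  proof (cases "i = Suc e")
    case True
    then show ?thesis using b(1) by simp
  next
    case False
    then have i: "i \<le> e" using that by simp
    then have "stored (arr s aLst) (list_ptr i) (edge_list i)" using tb by (simp add: tables_def)
    moreover have "arr ?s4 aLst k = arr s aLst k" if "k < list_ptr i + length (edge_list i)" for k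
      using b(6)[of k] that list_ptr_mono[of "Suc i" "Suc e"] i by (simp add: list_ptr_Suc)
    ultimately show ?thesis by (rule stored_cong)
  qed
  have tab: "tables (Suc e) ?s4"
    unfolding tables_def
  proof (intro conjI allI impI)
    fix i assume i: "i < Suc e"
    show "arr ?s4 aLp (Suc i) = list_ptr (Suc i)" "arr ?s4 aLen (Suc i) = length (edge_list (Suc i))"
       "arr ?s4 aPas (Suc i) = length (pass_list (Suc i))" "arr ?s4 aRp (Suc i) = row_ptr (Suc i)"
      using rec i tb by (auto simp: less_Suc_eq tables_def)
    show "row_correct (row_values ?s4) (row_choices ?s4) (Suc i)"
    proof (cases "i = e")
      case True
      then show ?thesis using new by simp
    next
      case False
      then have i: "i < e" using i by simp
      have "row_correct (row_values s) (row_choices s) (Suc i)" using tb i by (simp add: tables_def)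
      then show ?thesis
      proof (rule row_correct_cong)
        fix k assume "k < row_ptr (Suc (Suc (Suc i)))"
        then have "k < row_ptr (Suc (Suc e))" using row_ptr_mono[of "Suc (Suc (Suc i))" "Suc (Suc e)"] i by simp
        then show "arr ?s4 aR k = arr s aR k \<and> arr ?s4 aBest k = arr s aBest k" by (rule m(1))
      qed
    qed
  qed (use lst in auto)
  \<comment> \<open>A nonzero cell behind the start of the new row is attained by an assignment, so
    its offset is a code and lies inside the row.\<close>
  have "arr ?s4 aR k = 0" if "row_ptr (Suc (Suc (Suc e))) \<le> k" for k
  proof (rule ccontr)
    assume "arr ?s4 aR k \<noteq> 0"
    moreover have k: "k = row_ptr (Suc (Suc e)) + (k - row_ptr (Suc (Suc e)))"
      using that row_ptr_mono[of "Suc (Suc e)" "Suc (Suc (Suc e))"] by simp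
    ultimately obtain \<sigma> where "code \<sigma> (pass_list (Suc (Suc e))) = k - row_ptr (Suc (Suc e))"
      using m(4)[of "k - row_ptr (Suc (Suc e))"] by auto
    then show False using row_index[of "Suc e" \<sigma>] that k by simp
  qed
  moreover have "arr ?s4 aR 0 = 1"
    using m(1)[of 0] R0 by (simp add: row_ptr_Suc)
  moreover have "input ?s4" by (rule input_cong[OF inp]) auto
  moreover have "buckets ?s4" using bu by (simp add: buckets_def)
  moreover have "var ?s4 vm = length ?xs" "var ?s4 vpl = list_ptr (Suc e)" "var ?s4 vW = out_ptr (Suc (Suc e))"
     "var ?s4 vrn = row_ptr (Suc (Suc e))"
    using v2 r2 by auto
  ultimately have "forward_inv (Suc e) (run EDGE s)"
    using tab m(2) unfolding r forward_inv_def
    by (auto simp: tables_def input_def buckets_def row_values_def[abs_def] row_choices_def[abs_def])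
  moreover have "time EDGE s \<le> 500000 * (2 ^ K * ((K + 1) * (K + 1)))"
  proof -
    let ?Q = "2 ^ K * ((K + 1) * (K + 1)) :: nat"
    have "1 * (1 * (K + 1)) \<le> ?Q" by (intro mult_le_mono) auto
    then have Q: "K + 1 \<le> ?Q" by simp
    have "2 ^ length ?xs * ((length ?xs + 1) * (length ?xs + 1)) \<le> ?Q"
      using K by (intro mult_le_mono power_increasing) auto
    then have "time ?M ?s3 \<le> 200000 * ?Q" using m(5) by (meson le_trans mult_le_mono2)
    moreover have "time BUILD s \<le> 60000 * (K + 1)" using b(7) K by simp
    moreover have "time LOAD ?s2 \<le> 10000 * (K + 1)" using l(2) K by simp
    moreover have "time RECORD ?s1 \<le> 10000" by (simp add: RECORD_def)
    moreover have "time EDGE s = time BUILD s + (time RECORD ?s1 + (time LOAD ?s2 + (time ?M ?s3 + 2)))"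
      by (simp add: EDGE_def)
    moreover define q where "q = ?Q"
    ultimately have "time EDGE s \<le> 500000 * q"
      using Q unfolding q_def[symmetric] by simp
    then show ?thesis by (simp only: q_def)
  qed
  ultimately show ?thesis by blast
qed

lemma FORWARD_spec:
  assumes "var s vn = n" "var s vL = length ls"
    "\<And>l. l < length ls \<Longrightarrow> arr s aA l = fst (ls ! l) \<and> arr s aB l = snd (ls ! l)"
    "arr s aHead = (\<lambda>_. 0)" "arr s aCnt = (\<lambda>_. 0)" "arr s aR = (\<lambda>_. 0)"
    "var s vm = 0" "var s vpl = 0" "var s vrr = 0" "var s vW = 0"
    and K: "\<And>i. i < n \<Longrightarrow> length (edge_list i) \<le> K"
  shows "forward_inv (n - 1) (run FORWARD s)"
    "time FORWARD s \<le> 100000 * (length ls + 1) + n * (600000 * (2 ^ K * ((K + 1) * (K + 1))))"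
proof -
  let ?s1 = "run BUCKETS s" let ?s2 = "run POWERS ?s1" let ?s3 = "run (aR[Num 0] ::= Num 1) ?s2"
  have b: "buckets ?s1" "time BUCKETS s \<le> 10000 * (length ls + 1)"
    using BUCKETS_spec[of s] assms by auto
  have L1: "var ?s1 vL = length ls" using assms by simp
  note p = POWERS_spec[OF L1]
  have "tables 0 (upd_var ve 0 (upd_var veb (n - 1) ?s3))" by (simp add: tables_def stored_def)
  moreover have "input (upd_var ve 0 (upd_var veb (n - 1) ?s3))"
    using p(1) assms by (simp add: input_def)
  moreover have "buckets (upd_var ve 0 (upd_var veb (n - 1) ?s3))" using b by (simp add: buckets_def)
  ultimately have init: "forward_inv 0 (upd_var ve 0 (upd_var veb (n - 1) ?s3))"
    unfolding forward_inv_def using assms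
    by (auto simp: list_ptr_def row_ptr_def out_ptr_def pass_list_1)
  let ?F = "For ve veb (Var vn \<ominus> Num 1) EDGE"
  have main: "forward_inv (n - 1) (run ?F ?s3) \<and> time ?F ?s3 \<le>
     6 + lcost (Var vn \<ominus> Num 1) + (n - 1) * (7 + 500000 * (2 ^ K * ((K + 1) * (K + 1))))"
  proof (rule For_rule[where Inv = forward_inv])
    fix i t assume i: "i < n - 1" "forward_inv i t" "var t ve = i"
    have "forward_inv (Suc i) (run EDGE t) \<and> time EDGE t \<le> 500000 * (2 ^ K * ((K + 1) * (K + 1)))"
      by (rule EDGE_spec) (use i K in auto)
    moreover have "forward_inv (Suc i) (upd_var ve (Suc i) (run EDGE t)) = forward_inv (Suc i) (run EDGE t)"
      by (simp add: forward_inv_def tables_def input_def buckets_def row_values_def[abs_def] row_choices_def[abs_def])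
    ultimately show "forward_inv (Suc i) (upd_var ve (Suc i) (run EDGE t)) \<and>
        time EDGE t \<le> 500000 * (2 ^ K * ((K + 1) * (K + 1)))" by simp
  qed (use assms init in auto)
  then show "forward_inv (n - 1) (run FORWARD s)" by (simp add: FORWARD_def)
  let ?Q = "2 ^ K * ((K + 1) * (K + 1)) :: nat"
  have "(n - 1) * (7 + 500000 * ?Q) \<le> n * (600000 * ?Q)"
  proof (rule mult_le_mono)
    have "0 < ?Q" by simp
    then show "7 + 500000 * ?Q \<le> 600000 * ?Q" by linarith
  qed simp
  moreover have "time FORWARD s = time BUCKETS s + (time POWERS ?s1 + (time (aR[Num 0] ::= Num 1) ?s2 + time ?F ?s3))"
    by (simp add: FORWARD_def)
  ultimately show "time FORWARD s \<le> 100000 * (length ls + 1) + n * (600000 * ?Q)"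
    using b(2) p(2) main by simp
qed

end

section \<open>Sorting by ranks, traceback and output of the layout\<close>

definition KEYS_LEFT :: lcom where
  "KEYS_LEFT = For vj vjb (Var vm) (
     ak1[Var vj] ::= Arr akey (Var vj) ;;
     Cond (Num 0) (Arr atau (Arr aid (Var vj)))
       (ak2[Var vj] ::= Var vn \<oplus> Var vn \<ominus> Arr ab (Var vj))
       (ak2[Var vj] ::= Arr ab (Var vj)))"

text \<open>The second component is the rank in the left order instead of \<open>left_key\<close>:
  ranks compare in the same way, whereas the packed key would need a product.\<close>

definition KEYS_RIGHT :: lcom where
  "KEYS_RIGHT = For vj vjb (Var vm) (
     ak2[Var vj] ::= Arr arank (Var vj) ;;
     Cond (Arr ab (Var vj)) (Var vi \<oplus> Num 2)
       (Cond (Num 0) (Arr atau (Arr aid (Var vj)))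
         (ak1[Var vj] ::= Num 2) (ak1[Var vj] ::= Num 0))
       (ak1[Var vj] ::= Num 1))"

definition RANK_OF :: lcom where
  "RANK_OF = vr ::= Num 0 ;; For vk vkb (Var vm) (
     Cond (Arr ak1 (Var vk)) (Arr ak1 (Var vj)) (vr ::= Var vr \<oplus> Num 1)
       (Cond (Arr ak1 (Var vj)) (Arr ak1 (Var vk)) Nop
         (Cond (Arr ak2 (Var vk)) (Arr ak2 (Var vj)) (vr ::= Var vr \<oplus> Num 1) Nop)))"

text \<open>Counting smaller elements is quadratic, which the time bound can afford, and gives the
  position in the output directly. Stations of a line are written to two consecutive cells, hence
  \<open>vr\<close> is added twice.\<close>

definition RANK :: lcom where
  "RANK = For vj vjb (Var vm) (
     RANK_OF ;; arank[Var vj] ::= Var vr ;;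
     aOut[Var vo \<oplus> Var vr \<oplus> Var vr] ::= Arr aa (Var vj) ;;
     aOut[Var vo \<oplus> Var vr \<oplus> Var vr \<oplus> Num 1] ::= Arr ab (Var vj))"

text \<open>Blocks are produced from the last edge to the first. The forward sweep has left the
  total output length in \<open>vW\<close>, so each block starts where subtracting its own length
  leads.\<close>

definition WRITE :: lcom where
  "WRITE = vW ::= Var vW \<ominus> (Num 1 \<oplus> Var vm \<oplus> Var vm \<oplus> Var vm \<oplus> Var vm) ;;
     aOut[Var vW] ::= Var vm ;; KEYS_LEFT ;; vo ::= Var vW \<oplus> Num 1 ;; RANK ;;
     KEYS_RIGHT ;; vo ::= Var vo \<oplus> Var vm \<oplus> Var vm ;; RANK"

text \<open>Going from right to left, the side on which a line ends is known on all of its edges.\<close>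

definition BACK :: lcom where
  "BACK = vi ::= Var vn \<ominus> Num 1 \<ominus> Var ve ;; vpl ::= Arr aLp (Var vi) ;; vm ::= Arr aLen (Var vi) ;;
     vp ::= Arr aPas (Var vi) ;; vmask ::= Arr aBest (Var vrr \<oplus> Var vy) ;;
     LOAD ;; DECODE ;; EVAL ;; CODE_IN ;; vy ::= Var vx ;; vrr ::= Arr aRp (Var vi) ;; WRITE"

definition BACKWARD :: lcom where
  "BACKWARD = vwt ::= Var vW ;; vy ::= Num 0 ;; For ve veb (Var vn \<ominus> Num 1) BACK"

lemma writes_backward [simp]:
  "written_vars KEYS_LEFT = {vj, vjb}" "written_arrs KEYS_LEFT = {ak1, ak2}"
  "written_vars KEYS_RIGHT = {vj, vjb}" "written_arrs KEYS_RIGHT = {ak1, ak2}"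
  "written_vars RANK_OF = {vr, vk, vkb}" "written_arrs RANK_OF = {}"
  "written_vars RANK = {vr, vk, vkb, vj, vjb}" "written_arrs RANK = {arank, aOut}"
  "written_vars WRITE = {vW, vo, vr, vk, vkb, vj, vjb}" "written_arrs WRITE = {arank, aOut, ak1, ak2}"
  "written_vars BACK = {vi, vpl, vm, vp, vmask, vt, vv, vc, vu, vd, vx, vy, vrr, vW, vo, vr, vk, vkb, vj, vjb}"
  "written_arrs BACK = {aid, aa, ab, abit, akey, atau, arank, aOut, ak1, ak2}"
  by (auto simp: KEYS_LEFT_def KEYS_RIGHT_def RANK_OF_def RANK_def WRITE_def BACK_def)

definition segment :: "(nat \<Rightarrow> nat) \<Rightarrow> nat \<Rightarrow> nat list \<Rightarrow> bool" where
  "segment A p w \<longleftrightarrow> (\<forall>q<length w. A (p + q) = w ! q)"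

lemma segment_Nil: "segment A p []"
  by (simp add: segment_def)

lemma segment_append: "segment A p (v @ w) \<longleftrightarrow> segment A p v \<and> segment A (p + length v) w"
proof -
  have "A (p + length v + q) = w ! q" if "segment A p (v @ w)" "q < length w" for q
    using that unfolding segment_def
    by (auto simp: nth_append dest!: spec[of _ "length v + q"] simp: add.assoc)
  moreover have "A (p + q) = (v @ w) ! q"
    if "\<forall>q<length w. A (p + length v + q) = w ! q" "q < length v + length w" "\<not> q < length v" for q
    using that(2,3) that(1)[rule_format, of "q - length v"] by (simp add: nth_append)
  ultimately show ?thesis unfolding segment_def by (fastforce simp: nth_append)
qed

lemma segment_Cons: "segment A p (x # w) \<longleftrightarrow> A p = x \<and> segment A (Suc p) w"
  using segment_append[of A p "[x]" w] by (simp add: segment_def)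

lemma segment_cong: "segment A p w \<Longrightarrow> (\<And>q. p \<le> q \<Longrightarrow> q < p + length w \<Longrightarrow> A' q = A q) \<Longrightarrow> segment A' p w"
  by (simp add: segment_def)

lemma length_encode_lines [simp]: "length (encode_lines xs) = 2 * length xs"
  by (induction xs) (auto simp: encode_lines_def)

lemma segment_encode_lines:
  assumes "\<And>j. j < length xs \<Longrightarrow> A (p + 2 * j) = fst (xs ! j) \<and> A (p + 2 * j + 1) = snd (xs ! j)"
  shows "segment A p (encode_lines xs)"
  using assms
proof (induction xs arbitrary: p)
  case Nil
  then show ?case by (simp add: encode_lines_def segment_Nil)
next
  case (Cons x xs)
  have "segment A (Suc (Suc p)) (encode_lines xs)"
    by (rule Cons.IH) (use Cons.prems[of "Suc j" for j] in auto)
  moreover have "A p = fst x" "A (Suc p) = snd x" using Cons.prems[of 0] by auto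
  ultimately show ?case by (cases x) (simp add: encode_lines_def segment_Cons)
qed

text \<open>In a strictly sorted list the elements smaller than the one at position p are exactly
  those at the p positions before it.\<close>

lemma sort_key_rank:
  fixes f :: "'a \<Rightarrow> nat"
  assumes "distinct xs" "inj_on f (set xs)" "x \<in> set xs"
  shows "sort_key f xs ! card {y \<in> set xs. f y < f x} = x" "card {y \<in> set xs. f y < f x} < length xs"
proof -
  let ?ys = "sort_key f xs"
  have s: "sorted_wrt (<) (map f ?ys)" using assms by (intro sorted_wrt_sort_key)
  obtain p where p: "p < length ?ys" "?ys ! p = x" using assms(3) by (metis in_set_conv_nth set_sort)
  have less: "f (?ys ! q) < f (?ys ! p) \<longleftrightarrow> q < p" if "q < length ?ys" for q
    using sorted_wrt_nth_less[OF s, of q p] sorted_wrt_nth_less[OF s, of p q] p that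
    by (cases q p rule: linorder_cases) auto
  have "card {y \<in> set xs. f y < f x} = card {y \<in> set ?ys. f y < f x}" by simp
  also have "\<dots> = card {j. j < length ?ys \<and> f (?ys ! j) < f x}"
    using assms by (intro card_index_conv) simp
  also have "{j. j < length ?ys \<and> f (?ys ! j) < f x} = {..<p}" using less p by auto
  finally have "card {y \<in> set xs. f y < f x} = p" by simp
  then show "sort_key f xs ! card {y \<in> set xs. f y < f x} = x" "card {y \<in> set xs. f y < f x} < length xs"
    using p by simp_all
qed

lemma rank_less_iff:
  fixes f :: "'a \<Rightarrow> nat"
  assumes "finite S" "x \<in> S" "z \<in> S"
  shows "card {y \<in> S. f y < f x} < card {y \<in> S. f y < f z} \<longleftrightarrow> f x < f z"
proof (cases "f x < f z")
  case True
  then have "{y \<in> S. f y < f x} \<subset> {y \<in> S. f y < f z}" using assms by auto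
  then show ?thesis using True assms by (simp add: psubset_card_mono)
next
  case False
  then have "card {y \<in> S. f y < f z} \<le> card {y \<in> S. f y < f x}" using assms by (intro card_mono) auto
  then show ?thesis using False by simp
qed

context mlcm_input
begin

lemma RANK_OF_spec:
  assumes "var s vm = length xs" "distinct xs" "var s vj < length xs"
    and keys: "\<And>j k. j < length xs \<Longrightarrow> k < length xs \<Longrightarrow>
      arr s ak1 k < arr s ak1 j \<or> arr s ak1 k = arr s ak1 j \<and> arr s ak2 k < arr s ak2 j \<longleftrightarrow> f (xs ! k) < (f (xs ! j) :: nat)"
  shows "var (run RANK_OF s) vr = card {y \<in> set xs. f y < f (xs ! var s vj)}"
    "time RANK_OF s \<le> 10000 * (length xs + 1)"
proof -
  let ?s = "run (vr ::= Num 0) s"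
  define P where "P = Cond (Arr ak1 (Var vk)) (Arr ak1 (Var vj)) (vr ::= Var vr \<oplus> Num 1)
       (Cond (Arr ak1 (Var vj)) (Arr ak1 (Var vk)) Nop
         (Cond (Arr ak2 (Var vk)) (Arr ak2 (Var vj)) (vr ::= Var vr \<oplus> Num 1) Nop))"
  let ?a = "\<lambda>k. f (xs ! k) < f (xs ! var s vj)"
  let ?I = "\<lambda>k t. var t vr = card {j. j < k \<and> ?a j}"
  have "?I (length xs) (run (For vk vkb (Var vm) P) ?s) \<and>
      time (For vk vkb (Var vm) P) ?s \<le> 6 + lcost (Var vm) + length xs * (7 + 5000)"
  proof (rule For_rule[where Inv = ?I])
    fix k t assume k: "k < length xs" and I: "?I k t" and vk: "var t vk = k"
      and fr: "\<forall>x. x \<notin> insert vk (insert vkb (written_vars P)) \<longrightarrow> var t x = var ?s x"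
        "\<forall>c. c \<notin> written_arrs P \<longrightarrow> arr t c = arr ?s c"
    have e: "arr t ak1 = arr s ak1" "arr t ak2 = arr s ak2" "var t vj = var s vj" using fr by (auto simp: P_def)
    show "?I (Suc k) (upd_var vk (Suc k) (run P t)) \<and> time P t \<le> 5000"
      using I e vk keys[OF assms(3) k] by (auto simp: P_def card_less_Suc_Collect)
  qed (use assms in \<open>auto simp: P_def\<close>)
  then show "var (run RANK_OF s) vr = card {y \<in> set xs. f y < f (xs ! var s vj)}"
    "time RANK_OF s \<le> 10000 * (length xs + 1)"
    using card_index_conv[OF assms(2)] by (auto simp: RANK_OF_def P_def)
qed

lemma RANK_spec:
  assumes ld: "loaded s xs" and d: "distinct xs" and inj: "inj_on f (set xs)"
    and keys: "\<And>j k. j < length xs \<Longrightarrow> k < length xs \<Longrightarrow>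
      arr s ak1 k < arr s ak1 j \<or> arr s ak1 k = arr s ak1 j \<and> arr s ak2 k < arr s ak2 j \<longleftrightarrow> f (xs ! k) < (f (xs ! j) :: nat)"
  defines "s' \<equiv> run RANK s"
  shows "\<And>j. j < length xs \<Longrightarrow> arr s' arank j = card {y \<in> set xs. f y < f (xs ! j)}"
    "segment (arr s' aOut) (var s vo) (encode_lines (sort_key f xs))"
    "\<And>q. q < var s vo \<or> var s vo + 2 * length xs \<le> q \<Longrightarrow> arr s' aOut q = arr s aOut q"
    "time RANK s \<le> 20000 * ((length xs + 1) * (length xs + 1))"
proof -
  define P where "P = RANK_OF ;; arank[Var vj] ::= Var vr ;;
     aOut[Var vo \<oplus> Var vr \<oplus> Var vr] ::= Arr aa (Var vj) ;;
     aOut[Var vo \<oplus> Var vr \<oplus> Var vr \<oplus> Num 1] ::= Arr ab (Var vj)"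
  let ?r = "\<lambda>j. card {y \<in> set xs. f y < f (xs ! j)}"
  let ?o = "var s vo"
  have r: "sort_key f xs ! ?r j = xs ! j" "?r j < length xs" if "j < length xs" for j
    using sort_key_rank[OF d inj nth_mem[OF that]] by auto
  have rinj: "?r j \<noteq> ?r k" if "j < length xs" "k < length xs" "j \<noteq> k" for j k
    using r(1)[of j] r(1)[of k] that d nth_eq_iff_index_eq by metis
  let ?I = "\<lambda>k t. (\<forall>j<k. arr t arank j = ?r j \<and> arr t aOut (?o + 2 * ?r j) = fst (xs ! j) \<and>
       arr t aOut (?o + 2 * ?r j + 1) = snd (xs ! j)) \<and>
     (\<forall>q. q < ?o \<or> ?o + 2 * length xs \<le> q \<longrightarrow> arr t aOut q = arr s aOut q)"
  have main: "?I (length xs) (run (For vj vjb (Var vm) P) s) \<and>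
      time (For vj vjb (Var vm) P) s \<le> 6 + lcost (Var vm) + length xs * (7 + (10000 * (length xs + 1) + 5000))"
  proof (rule For_rule[where Inv = ?I])
    fix k t assume k: "k < length xs" and I: "?I k t" and vj: "var t vj = k"
      and fr: "\<forall>x. x \<notin> insert vj (insert vjb (written_vars P)) \<longrightarrow> var t x = var s x"
        "\<forall>c. c \<notin> written_arrs P \<longrightarrow> arr t c = arr s c"
    have e: "arr t ak1 = arr s ak1" "arr t ak2 = arr s ak2" "var t vm = length xs" "var t vo = ?o"
      "arr t aa k = fst (xs ! k)" "arr t ab k = snd (xs ! k)"
      using fr ld k by (auto simp: P_def loaded_def)
    have ro: "var (run RANK_OF t) vr = ?r k" "time RANK_OF t \<le> 10000 * (length xs + 1)"
      using RANK_OF_spec[OF e(3) d, of f] k vj keys by (auto simp: e)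
    have rk: "arr (run P t) arank = (arr t arank)(k := ?r k)" using ro vj by (simp add: P_def)
    have out: "arr (run P t) aOut = (arr t aOut)(?o + 2 * ?r k := fst (xs ! k), ?o + 2 * ?r k + 1 := snd (xs ! k))"
      using ro vj e by (simp add: P_def mult_2 add.assoc)
    have tm: "time P t \<le> 10000 * (length xs + 1) + 5000" using ro by (simp add: P_def)
    \<comment> \<open>First stations go to even offsets and last stations to odd ones, so the writes
      of lines with different ranks never collide.\<close>
    have odd: "2 * a \<noteq> 2 * b + 1" "2 * a + 1 \<noteq> 2 * b" for a b :: nat by presburger+
    have "?I (Suc k) (run P t)"
    proof (intro conjI allI impI)
      fix j assume j: "j < Suc k"
      show "arr (run P t) arank j = ?r j" using j I rk by (auto simp: less_Suc_eq)
      have "arr (run P t) aOut (?o + 2 * ?r j) = fst (xs ! j) \<and> arr (run P t) aOut (?o + 2 * ?r j + 1) = snd (xs ! j)"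
      proof (cases "j = k")
        case True
        then show ?thesis unfolding out by simp
      next
        case False
        then have "j < k" "?r j \<noteq> ?r k" using j rinj[of j k] k by auto
        then show ?thesis using I odd[of "?r j" "?r k"] unfolding out by auto
      qed
      then show "arr (run P t) aOut (?o + 2 * ?r j) = fst (xs ! j)"
        "arr (run P t) aOut (?o + 2 * ?r j + 1) = snd (xs ! j)" by auto
    next
      fix q assume "q < ?o \<or> ?o + 2 * length xs \<le> q"
      then show "arr (run P t) aOut q = arr s aOut q" using I r(2)[OF k] unfolding out by auto
    qed
    then show "?I (Suc k) (upd_var vj (Suc k) (run P t)) \<and> time P t \<le> 10000 * (length xs + 1) + 5000"
      using tm by simp
  qed (use ld in \<open>auto simp: P_def loaded_def\<close>)
  have R: "RANK = For vj vjb (Var vm) P" by (simp add: RANK_def P_def)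
  show "\<And>j. j < length xs \<Longrightarrow> arr s' arank j = ?r j"
    "\<And>q. q < ?o \<or> ?o + 2 * length xs \<le> q \<Longrightarrow> arr s' aOut q = arr s aOut q"
    using main unfolding s'_def R by auto
  show "segment (arr s' aOut) ?o (encode_lines (sort_key f xs))"
  proof (rule segment_encode_lines)
    fix p assume p: "p < length (sort_key f xs)"
    then have "sort_key f xs ! p \<in> set xs" by (metis nth_mem set_sort)
    then obtain j where j: "j < length xs" "xs ! j = sort_key f xs ! p" by (metis in_set_conv_nth)
    then have "?r j = p" using r[of j] p d nth_eq_iff_index_eq[of "sort_key f xs" "?r j" p] by simp
    then show "arr s' aOut (?o + 2 * p) = fst (sort_key f xs ! p) \<and>
        arr s' aOut (?o + 2 * p + 1) = snd (sort_key f xs ! p)"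
      using main j unfolding s'_def R by auto
  qed
  have "time RANK s \<le> 6 + lcost (Var vm) + length xs * (7 + (10000 * (length xs + 1) + 5000))"
    using main by (simp add: R)
  also have "\<dots> \<le> 20000 * ((length xs + 1) * (length xs + 1))" by (simp add: algebra_simps)
  finally show "time RANK s \<le> 20000 * ((length xs + 1) * (length xs + 1))" .
qed

lemma KEYS_LEFT_spec:
  assumes "input s" "loaded s xs" "keyed s \<sigma> xs"
    and "\<forall>j<length xs. arr s atau (arr s aid j) = of_bool (ends_below n (set ls) \<sigma> (xs ! j))"
  shows "\<forall>j<length xs. arr (run KEYS_LEFT s) ak1 j = start_key n \<sigma> (xs ! j) \<and>
      arr (run KEYS_LEFT s) ak2 j = end_key n (set ls) \<sigma> (xs ! j)"
    "time KEYS_LEFT s \<le> 10000 * (length xs + 1)"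
proof -
  let ?I = "\<lambda>k t. \<forall>j<k. arr t ak1 j = start_key n \<sigma> (xs ! j) \<and> arr t ak2 j = end_key n (set ls) \<sigma> (xs ! j)"
  have "?I (length xs) (run KEYS_LEFT s) \<and> time KEYS_LEFT s \<le> 6 + lcost (Var vm) + length xs * (7 + 9000)"
    unfolding KEYS_LEFT_def
    by (rule For_rule[where Inv = ?I])
      (use assms in \<open>auto simp: less_Suc_eq input_def loaded_def keyed_def end_key_def\<close>)
  then show "?I (length xs) (run KEYS_LEFT s)" "time KEYS_LEFT s \<le> 10000 * (length xs + 1)" by auto
qed

lemma KEYS_RIGHT_spec:
  assumes "loaded s (edge_list i)" "var s vi = i"
    and "\<forall>j<length (edge_list i). arr s atau (arr s aid j) = of_bool (ends_below n (set ls) \<sigma> (edge_list i ! j))"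
  shows "\<forall>j<length (edge_list i). arr (run KEYS_RIGHT s) ak1 j = side_key n (set ls) \<sigma> i (edge_list i ! j) \<and>
      arr (run KEYS_RIGHT s) ak2 j = arr s arank j"
    "time KEYS_RIGHT s \<le> 10000 * (length (edge_list i) + 1)"
proof -
  let ?xs = "edge_list i"
  have gt: "i < snd (?xs ! k)" if "k < length ?xs" for k
    using edge_list[of i] nth_mem[OF that] by (auto simp: lines_on_iff)
  let ?I = "\<lambda>k t. \<forall>j<k. arr t ak1 j = side_key n (set ls) \<sigma> i (?xs ! j) \<and> arr t ak2 j = arr s arank j"
  have "?I (length ?xs) (run KEYS_RIGHT s) \<and> time KEYS_RIGHT s \<le> 6 + lcost (Var vm) + length ?xs * (7 + 9000)"
    unfolding KEYS_RIGHT_def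
  proof (rule For_rule[where Inv = ?I], goal_cases)
    case (5 k t)
    then have "snd (?xs ! k) < i + 2 \<longleftrightarrow> snd (?xs ! k) = i + 1" using gt[of k] by auto
    with 5 show ?case using assms by (auto simp: less_Suc_eq loaded_def side_key_def)
  qed (use assms in \<open>auto simp: loaded_def\<close>)
  then show "?I (length ?xs) (run KEYS_RIGHT s)" "time KEYS_RIGHT s \<le> 10000 * (length ?xs + 1)" by auto
qed

definition block :: "layout \<Rightarrow> nat \<Rightarrow> nat list" where
  "block \<pi> i = length (left_order \<pi> i) # encode_lines (left_order \<pi> i) @ encode_lines (right_order \<pi> i)"

lemma WRITE_spec:
  assumes inp: "input s" and ld: "loaded s (edge_list i)" and ky: "keyed s \<sigma> (edge_list i)" and vi: "var s vi = i"
    and tau: "\<forall>j<length (edge_list i). arr s atau (arr s aid j) = of_bool (ends_below n (set ls) \<sigma> (edge_list i ! j))"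
    and W: "var s vW = W + (1 + 4 * length (edge_list i))"
  defines "s' \<equiv> run WRITE s"
  shows "var s' vW = W" "segment (arr s' aOut) W (block (canonical edge_list \<sigma>) i)"
    "\<And>q. W + (1 + 4 * length (edge_list i)) \<le> q \<Longrightarrow> arr s' aOut q = arr s aOut q"
    "time WRITE s \<le> 100000 * ((length (edge_list i) + 1) * (length (edge_list i) + 1))"
proof -
  let ?xs = "edge_list i" and ?m = "length (edge_list i)"
  have d: "distinct ?xs" and L: "set ?xs \<subseteq> set ls" using edge_list[of i] lines_on_subset by auto
  have nth: "j < ?m \<Longrightarrow> ?xs ! j \<in> set ls" for j using L nth_mem by blast
  let ?s1 = "run (vW ::= Var vW \<ominus> (Num 1 \<oplus> Var vm \<oplus> Var vm \<oplus> Var vm \<oplus> Var vm) ;; aOut[Var vW] ::= Var vm) s"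
  have m: "var s vm = ?m" using ld by (simp add: loaded_def)
  have s1: "var ?s1 vW = W" "arr ?s1 aOut = (arr s aOut)(W := ?m)" using W m by auto
  let ?s2 = "run KEYS_LEFT ?s1"
  have 1: "input ?s1" by (rule input_cong[OF inp]) auto
  have 2: "loaded ?s1 ?xs" by (rule loaded_cong[OF ld]) auto
  have 3: "keyed ?s1 \<sigma> ?xs" by (rule keyed_cong[OF ky]) auto
  have 4: "\<forall>j<?m. arr ?s1 atau (arr ?s1 aid j) = of_bool (ends_below n (set ls) \<sigma> (?xs ! j))" using tau by simp
  note kl = KEYS_LEFT_spec[OF 1 2 3 4]
  let ?s3 = "run (vo ::= Var vW \<oplus> Num 1) ?s2"
  let ?s4 = "run RANK ?s3"
  have ld3: "loaded ?s3 ?xs" by (rule loaded_cong[OF ld]) auto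
  have lk: "inj_on (left_key n (set ls) \<sigma>) (set ?xs)" using inj_left_key inj_on_subset L by blast
  have keys3: "arr ?s3 ak1 k < arr ?s3 ak1 j \<or> arr ?s3 ak1 k = arr ?s3 ak1 j \<and> arr ?s3 ak2 k < arr ?s3 ak2 j
      \<longleftrightarrow> left_key n (set ls) \<sigma> (?xs ! k) < left_key n (set ls) \<sigma> (?xs ! j)" if "j < ?m" "k < ?m" for j k
    using kl(1) that nth left_key_less_iff by simp
  have r4: "\<And>j. j < ?m \<Longrightarrow> arr ?s4 arank j = card {y \<in> set ?xs. left_key n (set ls) \<sigma> y < left_key n (set ls) \<sigma> (?xs ! j)}"
    "segment (arr ?s4 aOut) (var ?s3 vo) (encode_lines (sort_key (left_key n (set ls) \<sigma>) ?xs))"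
    "\<And>q. q < var ?s3 vo \<or> var ?s3 vo + 2 * ?m \<le> q \<Longrightarrow> arr ?s4 aOut q = arr ?s3 aOut q"
    "time RANK ?s3 \<le> 20000 * ((?m + 1) * (?m + 1))"
    using RANK_spec[OF ld3 d lk] keys3 by blast+
  have vo3: "var ?s3 vo = W + 1" using s1 by simp
  let ?s5 = "run KEYS_RIGHT ?s4"
  have ld4: "loaded ?s4 ?xs" by (rule loaded_cong[OF ld]) auto
  have vi4: "var ?s4 vi = i" using vi by simp
  have tau4: "\<forall>j<?m. arr ?s4 atau (arr ?s4 aid j) = of_bool (ends_below n (set ls) \<sigma> (?xs ! j))" using tau by simp
  note kr = KEYS_RIGHT_spec[OF ld4 vi4 tau4]
  let ?s6 = "run (vo ::= Var vo \<oplus> Var vm \<oplus> Var vm) ?s5"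
  let ?s7 = "run RANK ?s6"
  have ld6: "loaded ?s6 ?xs" by (rule loaded_cong[OF ld]) auto
  have rk: "inj_on (right_key n (set ls) \<sigma> i) (set ?xs)" using inj_right_key inj_on_subset L by blast
  have rless: "arr ?s4 arank k < arr ?s4 arank j \<longleftrightarrow> left_key n (set ls) \<sigma> (?xs ! k) < left_key n (set ls) \<sigma> (?xs ! j)"
    if "j < ?m" "k < ?m" for j k
    unfolding r4(1)[OF that(1)] r4(1)[OF that(2)] by (rule rank_less_iff) (use that in auto)
  have keys6: "arr ?s6 ak1 k < arr ?s6 ak1 j \<or> arr ?s6 ak1 k = arr ?s6 ak1 j \<and> arr ?s6 ak2 k < arr ?s6 ak2 j
      \<longleftrightarrow> right_key n (set ls) \<sigma> i (?xs ! k) < right_key n (set ls) \<sigma> i (?xs ! j)" if "j < ?m" "k < ?m" for j k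
    using kr(1) that nth right_key_less_iff rless[OF that] by simp
  have r7: "segment (arr ?s7 aOut) (var ?s6 vo) (encode_lines (sort_key (right_key n (set ls) \<sigma> i) ?xs))"
    "\<And>q. q < var ?s6 vo \<or> var ?s6 vo + 2 * ?m \<le> q \<Longrightarrow> arr ?s7 aOut q = arr ?s6 aOut q"
    "time RANK ?s6 \<le> 20000 * ((?m + 1) * (?m + 1))"
    using RANK_spec[OF ld6 d rk] keys6 by blast+
  have vo6: "var ?s6 vo = W + 1 + 2 * ?m" using vo3 m by simp
  have r: "run WRITE s = ?s7" by (simp add: WRITE_def)
  show "var s' vW = W" unfolding s'_def r using s1 by simp
  have o6: "arr ?s6 aOut = arr ?s4 aOut" "arr ?s3 aOut = arr ?s1 aOut" by simp_all
  have "arr ?s7 aOut W = ?m" using r7(2)[of W] r4(3)[of W] vo3 vo6 s1(2) o6 by simp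
  moreover have "segment (arr ?s7 aOut) (W + 1) (encode_lines (sort_key (left_key n (set ls) \<sigma>) ?xs))"
    by (rule segment_cong[OF r4(2)[unfolded vo3]]) (use r7(2) vo6 o6 in auto)
  ultimately show "segment (arr s' aOut) W (block (canonical edge_list \<sigma>) i)"
    using r7(1)[unfolded vo6] unfolding s'_def r
    by (simp add: block_def canonical_def segment_Cons segment_append)
  show "arr s' aOut q = arr s aOut q" if "W + (1 + 4 * ?m) \<le> q" for q
    unfolding s'_def r using r7(2)[of q] r4(3)[of q] vo3 vo6 s1(2) o6 that by simp
  have "time WRITE s \<le> 5000 + (time KEYS_LEFT ?s1 + (time RANK ?s3 + (time KEYS_RIGHT ?s4 + time RANK ?s6)))"
    by (simp add: WRITE_def)
  moreover define Q where "Q = (?m + 1) * (?m + 1)"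
  moreover have "?m + 1 \<le> Q" by (simp add: Q_def)
  ultimately have "time WRITE s \<le> 100000 * Q"
    using kl(2) r4(4)[folded Q_def] kr(2) r7(3)[folded Q_def] unfolding Q_def[symmetric] by simp
  then show "time WRITE s \<le> 100000 * ((?m + 1) * (?m + 1))" by (simp only: Q_def)
qed

text \<open>The blocks of the edges from \<open>i\<close> on are in place. The end sides are known
  for the lines ending beyond station \<open>i\<close>, which include all lines on edge
  \<open>i\<close>.\<close>

definition backward_inv :: "(line \<Rightarrow> bool) \<Rightarrow> nat \<Rightarrow> lstate \<Rightarrow> bool" where
  "backward_inv \<sigma> i t \<longleftrightarrow> var t vy = code \<sigma> (pass_list i) \<and> var t vrr = row_ptr i \<and> var t vW = out_ptr i \<and>
     segment (arr t aOut) (out_ptr i) (concat (map (block (canonical edge_list \<sigma>)) [i..<n])) \<and>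
     (\<forall>l<length ls. i < snd (ls ! l) \<longrightarrow> arr t atau l = of_bool (ends_below n (set ls) \<sigma> (ls ! l)))"

lemma BACK_spec:
  assumes I: "backward_inv \<sigma> (Suc (Suc i)) s" and tb: "tables (n - 1) s" and inp: "input s"
    and ve: "n - 1 - var s ve = Suc i" and i: "Suc i < n"
    and best: "row_choices s (Suc (Suc i)) (code \<sigma> (pass_list (Suc (Suc i)))) = code \<sigma> (edge_list (Suc i))"
  shows "backward_inv \<sigma> (Suc i) (run BACK s)"
    "time BACK s \<le> 300000 * ((length (edge_list (Suc i)) + 1) * (length (edge_list (Suc i)) + 1))"
proof -
  let ?xs = "edge_list (Suc i)" and ?m = "length (edge_list (Suc i))" and ?pl = "pass_list (Suc i)"
  let ?s1 = "run (vi ::= Var vn \<ominus> Num 1 \<ominus> Var ve ;; vpl ::= Arr aLp (Var vi) ;; vm ::= Arr aLen (Var vi) ;;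
     vp ::= Arr aPas (Var vi) ;; vmask ::= Arr aBest (Var vrr \<oplus> Var vy)) s"
  have tab: "stored (arr s aLst) (list_ptr (Suc i)) ?xs" "arr s aLp (Suc i) = list_ptr (Suc i)"
    "arr s aLen (Suc i) = ?m" "arr s aPas (Suc i) = length ?pl" "arr s aRp (Suc i) = row_ptr (Suc i)"
    using tb i by (auto simp: tables_def)
  have vn: "var s vn = n" using inp by (simp add: input_def)
  have vy: "var s vy = code \<sigma> (pass_list (Suc (Suc i)))" "var s vrr = row_ptr (Suc (Suc i))"
     "var s vW = out_ptr (Suc (Suc i))"
    using I by (auto simp: backward_inv_def)
  have vi': "n - Suc 0 - var s ve = Suc i" using ve by simp
  have v1: "var ?s1 vi = Suc i" "var ?s1 vpl = list_ptr (Suc i)" "var ?s1 vm = ?m" "var ?s1 vp = length ?pl"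
     "var ?s1 vmask = code \<sigma> ?xs"
    using vi' vn tab vy best by (simp_all add: row_choices_def)
  have inp1: "input ?s1" by (rule input_cong[OF inp]) auto
  have st1: "\<forall>j<?m. arr ?s1 aLst (var ?s1 vpl + j) < length ls \<and> ls ! arr ?s1 aLst (var ?s1 vpl + j) = ?xs ! j"
    using tab(1) v1(2) by (simp add: stored_def)
  note l = LOAD_spec[OF inp1 v1(3) st1]
  let ?s2 = "run LOAD ?s1" let ?s3 = "run DECODE ?s2" let ?s4 = "run EVAL ?s3" let ?s5 = "run CODE_IN ?s4"
  have inp2: "input ?s2" by (rule input_cong[OF inp]) auto
  have v2: "var ?s2 vmask = code \<sigma> ?xs" using v1 by simp
  note k = DECODE_spec[OF inp2 l(1) v2 edge_list_le]
  have ld3: "loaded ?s3 ?xs" by (rule loaded_cong[OF l(1)]) auto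
  have v3: "var ?s3 vi = Suc i" using v1 by simp
  note e = EVAL_spec[OF ld3 k(1) v3]
  have inp4: "input ?s4" by (rule input_cong[OF inp]) auto
  have k4: "keyed ?s4 \<sigma> (?pl @ bucket (Suc i))" using k(1) unfolding edge_list_Suc by (rule keyed_cong) auto
  have v4: "var ?s4 vp = length ?pl" using v1 by simp
  have ple: "length ?pl \<le> length ls" using pass_list_le edge_list_le le_trans by blast
  note c = CODE_IN_spec[OF inp4 k4 v4 ple]
  let ?s6 = "run (vy ::= Var vx ;; vrr ::= Arr aRp (Var vi)) ?s5"
  have v6: "var ?s6 vy = code \<sigma> ?pl" "var ?s6 vrr = row_ptr (Suc i)" "var ?s6 vi = Suc i"
     "var ?s6 vW = out_ptr (Suc i) + (1 + 4 * ?m)"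
    using c(1) tab(5) v1 vy(3) by (simp_all add: out_ptr_Suc)
  have inp6: "input ?s6" by (rule input_cong[OF inp]) auto
  have ld6: "loaded ?s6 ?xs" by (rule loaded_cong[OF l(1)]) auto
  have k6: "keyed ?s6 \<sigma> ?xs" by (rule keyed_cong[OF k(1)]) auto
  \<comment> \<open>Lines ending at \<open>Suc (Suc i)\<close> get their side from this run of
    \<open>EVAL\<close>; lines ending later got it before and are left untouched.\<close>
  have tau: "arr ?s6 atau l = of_bool (ends_below n (set ls) \<sigma> (ls ! l))" if "l < length ls" "Suc i < snd (ls ! l)" for l
  proof -
    have "arr ?s6 atau l = arr ?s4 atau l" by simp
    also have "\<dots> = of_bool (ends_below n (set ls) \<sigma> (ls ! l))"
      using e(2)[of l] I that by (auto simp: backward_inv_def)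
    finally show ?thesis .
  qed
  have tau6: "\<forall>j<?m. arr ?s6 atau (arr ?s6 aid j) = of_bool (ends_below n (set ls) \<sigma> (?xs ! j))"
  proof (intro allI impI)
    fix j assume j: "j < ?m"
    then have "?xs ! j \<in> lines_on (set ls) (Suc i)" using edge_list[of "Suc i"] nth_mem by blast
    then show "arr ?s6 atau (arr ?s6 aid j) = of_bool (ends_below n (set ls) \<sigma> (?xs ! j))"
      using tau[of "arr ?s6 aid j"] ld6 j unfolding loaded_def by (auto simp: lines_on_iff)
  qed
  note w = WRITE_spec[OF inp6 ld6 k6 v6(3) tau6 v6(4)]
  let ?s7 = "run WRITE ?s6"
  have r: "run BACK s = ?s7" by (simp add: BACK_def)
  have len: "length (block (canonical edge_list \<sigma>) (Suc i)) = 1 + 4 * ?m" by (simp add: block_def canonical_def)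
  have "segment (arr ?s7 aOut) (out_ptr (Suc i) + (1 + 4 * ?m)) (concat (map (block (canonical edge_list \<sigma>)) [Suc (Suc i)..<n]))"
  proof (rule segment_cong)
    show "segment (arr s aOut) (out_ptr (Suc i) + (1 + 4 * ?m)) (concat (map (block (canonical edge_list \<sigma>)) [Suc (Suc i)..<n]))"
      using I by (simp add: backward_inv_def out_ptr_Suc)
    show "\<And>q. out_ptr (Suc i) + (1 + 4 * ?m) \<le> q \<Longrightarrow> arr ?s7 aOut q = arr s aOut q"
      using w(3) by simp
  qed
  then have "segment (arr ?s7 aOut) (out_ptr (Suc i)) (concat (map (block (canonical edge_list \<sigma>)) [Suc i..<n]))"
    using w(2) i len by (simp add: upt_conv_Cons segment_append)
  then show "backward_inv \<sigma> (Suc i) (run BACK s)"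
    using w(1) v6(1,2) tau unfolding backward_inv_def r by simp
  have "time BACK s \<le> 10000 + (time LOAD ?s1 + (time DECODE ?s2 + (time EVAL ?s3 + (time CODE_IN ?s4 + time WRITE ?s6))))"
    by (simp add: BACK_def)
  moreover define Q where "Q = (?m + 1) * (?m + 1)"
  moreover have "?m + 1 \<le> Q" by (simp add: Q_def)
  ultimately have "time BACK s \<le> 300000 * Q"
    using l(2) k(2) e(3)[folded Q_def] c(2) w(4)[folded Q_def] pass_list_le[of i] unfolding Q_def[symmetric] by simp
  then show "time BACK s \<le> 300000 * ((?m + 1) * (?m + 1))" by (simp only: Q_def)
qed

lemma BACKWARD_spec:
  assumes F: "forward_inv (n - 1) s" and K: "\<And>i. i < n \<Longrightarrow> length (edge_list i) \<le> K"
  shows "\<exists>\<pi>. optimal n (set ls) \<pi> \<and> segment (arr (run BACKWARD s) aOut) 0 (encode_layout n \<pi>) \<and>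
     var (run BACKWARD s) vwt = length (encode_layout n \<pi>)"
    "var (run BACKWARD s) vwt = out_ptr n"
    "time BACKWARD s \<le> 1000 + n * (400000 * ((K + 1) * (K + 1)))"
proof -
  have tb: "tables (n - 1) s" and inp: "input s" and n1: "Suc (n - 1) = n"
    using F n_pos by (auto simp: forward_inv_def)
  have "row_values s 1 0 = 1" using F by (simp add: forward_inv_def row_values_def row_ptr_def)
  moreover have "row_correct (row_values s) (row_choices s) j" if "1 \<le> j" "j < n" for j
    using tb that by (cases j) (auto simp: tables_def)
  ultimately have "\<exists>\<sigma>. optimal n (set ls) (canonical edge_list \<sigma>) \<and> (\<forall>j. 1 \<le> j \<and> j < n \<longrightarrow>
      row_choices s (Suc j) (code \<sigma> (pass_list (Suc j))) = code \<sigma> (edge_list j))"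
    by (rule table_optimal)
  then obtain \<sigma> where opt: "optimal n (set ls) (canonical edge_list \<sigma>)"
    and best: "\<And>j. 1 \<le> j \<Longrightarrow> j < n \<Longrightarrow> row_choices s (Suc j) (code \<sigma> (pass_list (Suc j))) = code \<sigma> (edge_list j)"
    by blast
  let ?\<pi> = "canonical edge_list \<sigma>"
  let ?s1 = "run (vwt ::= Var vW ;; vy ::= Num 0) s"
  let ?F = "For ve veb (Var vn \<ominus> Num 1) BACK"
  let ?I = "\<lambda>e t. backward_inv \<sigma> (n - e) t"
  have main: "?I (n - 1) (run ?F ?s1) \<and> time ?F ?s1 \<le>
     6 + lcost (Var vn \<ominus> Num 1) + (n - 1) * (7 + 300000 * ((K + 1) * (K + 1)))"
  proof (rule For_rule[where Inv = ?I])
    \<comment> \<open>No line ends beyond station \<open>n\<close>, so initially no end side has to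
      be known.\<close>
    have "\<not> n < snd (ls ! l)" if "l < length ls" for l using line_bounds[of "ls ! l"] that by auto
    then show "?I 0 (upd_var ve 0 (upd_var veb (n - 1) ?s1))"
      using F n1 by (auto simp: backward_inv_def forward_inv_def pass_list_n segment_Nil)
  next
    fix e t assume e: "e < n - 1" and I: "?I e t" and ve: "var t ve = e"
      and fr: "\<forall>x. x \<notin> insert ve (insert veb (written_vars BACK)) \<longrightarrow> var t x = var ?s1 x"
        "\<forall>c. c \<notin> written_arrs BACK \<longrightarrow> arr t c = arr ?s1 c"
    define i where "i = n - e - 2"
    have i: "n - e = Suc (Suc i)" using e by (simp add: i_def)
    then have i': "n - Suc e = Suc i" "Suc i < n" "n - 1 - e = Suc i" by auto
    have inpt: "input t" by (rule input_cong[OF inp]) (use fr in auto)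
    have ch: "row_choices t = row_choices s" "row_values t = row_values s"
      using fr by (auto simp: row_choices_def row_values_def fun_eq_iff)
    have tbt: "tables (n - 1) t" using tb fr unfolding tables_def ch by simp
    have I': "backward_inv \<sigma> (Suc (Suc i)) t" using I i by simp
    have b: "row_choices t (Suc (Suc i)) (code \<sigma> (pass_list (Suc (Suc i)))) = code \<sigma> (edge_list (Suc i))"
      using best[of "Suc i"] i' ch by simp
    have ve': "n - 1 - var t ve = Suc i" using ve i' by simp
    note B = BACK_spec[OF I' tbt inpt ve' i'(2) b]
    have "(length (edge_list (Suc i)) + 1) * (length (edge_list (Suc i)) + 1) \<le> (K + 1) * (K + 1)"
      using K[OF i'(2)] by (intro mult_le_mono) auto
    then have "time BACK t \<le> 300000 * ((K + 1) * (K + 1))" using B(2) by (meson le_trans mult_le_mono2)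
    then show "?I (Suc e) (upd_var ve (Suc e) (run BACK t)) \<and> time BACK t \<le> 300000 * ((K + 1) * (K + 1))"
      using B(1) i' by (simp add: backward_inv_def)
  qed (use inp in \<open>auto simp: input_def\<close>)
  have r: "run BACKWARD s = run ?F ?s1" by (simp add: BACKWARD_def)
  have enc: "encode_layout n ?\<pi> = concat (map (block ?\<pi>) [1..<n])" by (simp add: encode_layout_def block_def[abs_def])
  have "length (concat (map (block ?\<pi>) [1..<n])) = out_ptr n"
  proof -
    have "length (block ?\<pi> j) = 1 + 4 * length (edge_list j)" for j by (simp add: block_def canonical_def)
    then show ?thesis by (simp add: length_concat comp_def out_ptr_def interv_sum_list_conv_sum_set_nat)
  qed
  moreover show "var (run BACKWARD s) vwt = out_ptr n"
    using F n1 unfolding r by (simp add: forward_inv_def)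
  moreover have "segment (arr (run BACKWARD s) aOut) 0 (concat (map (block ?\<pi>) [1..<n]))"
    using main n_pos unfolding r by (simp add: backward_inv_def out_ptr_def)
  ultimately show "\<exists>\<pi>. optimal n (set ls) \<pi> \<and> segment (arr (run BACKWARD s) aOut) 0 (encode_layout n \<pi>) \<and>
     var (run BACKWARD s) vwt = length (encode_layout n \<pi>)"
    using opt enc by (intro exI[of _ ?\<pi>]) simp
  let ?Q = "(K + 1) * (K + 1)"
  have "(n - 1) * (7 + 300000 * ?Q) \<le> n * (400000 * ?Q)"
  proof (rule mult_le_mono)
    have "0 < ?Q" by simp
    then show "7 + 300000 * ?Q \<le> 400000 * ?Q" by linarith
  qed simp
  moreover have "time BACKWARD s = 4 + time ?F ?s1" by (simp add: BACKWARD_def)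
  ultimately show "time BACKWARD s \<le> 1000 + n * (400000 * ?Q)" using main by simp
qed

end

section \<open>Reading the input, emitting the output, and the total running time\<close>

definition READ :: com where
  "READ = Seq (Assign vn (Mem (Lit 0))) (Seq (Assign vL (Mem (Lit 1)))
     (Seq (Assign 1 (Plus (Lit 2) (dbl (Reg vL))))
     (WhileLess (Reg vj) (Reg vL)
       (Seq (Store (addr aA (Reg vj)) (Mem (Plus (Lit 2) (dbl (Reg vj)))))
       (Seq (Store (addr aB (Reg vj)) (Mem (Plus (Lit 3) (dbl (Reg vj)))))
         (Assign vj (Plus (Reg vj) (Lit 1))))))))"

definition MAIN :: lcom where
  "MAIN = FORWARD ;; BACKWARD"

text \<open>Copying the output down to address 0 is safe: no cell is overwritten before it is read,
  because entry \<open>i\<close> of an array lies at an address above \<open>i\<close>.\<close>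

definition EMIT :: com where
  "EMIT = Seq (Assign vj (Lit 0)) (WhileLess (Reg vj) (Reg vwt)
     (Seq (Store (Reg vj) (Mem (addr aOut (Reg vj)))) (Assign vj (Plus (Reg vj) (Lit 1)))))"

definition PROGRAM :: com where
  "PROGRAM = Seq READ (Seq (compile MAIN) EMIT)"

lemma wf_MAIN: "wf_com MAIN"
  unfolding MAIN_def FORWARD_def BACKWARD_def BACK_def WRITE_def EDGE_def
  by (simp add: BUCKETS_def POWERS_def BUILD_def KEEP_def FRESH_def RECORD_def LOAD_def
      TRY_MASK_def DECODE_def COUNT_def EVAL_def CODE_IN_def CODE_OUT_def UPDATE_def
      KEYS_LEFT_def KEYS_RIGHT_def RANK_def RANK_OF_def)

lemma MAIN_keeps_0: "0 \<notin> written_vars MAIN"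
  by (simp add: MAIN_def FORWARD_def BACKWARD_def)

lemma nth_encode_lines:
  "l < length ls \<Longrightarrow> encode_lines ls ! (2 * l) = fst (ls ! l) \<and> encode_lines ls ! (2 * l + 1) = snd (ls ! l)"
proof (induction ls arbitrary: l)
  case (Cons x ls)
  show ?case
  proof (cases l)
    case 0
    then show ?thesis by (cases x) (simp add: encode_lines_def)
  next
    case (Suc k)
    then show ?thesis using Cons.IH[of k] Cons.prems by (cases x) (simp add: encode_lines_def)
  qed
qed simp

definition read_state :: "nat \<Rightarrow> line list \<Rightarrow> nat \<Rightarrow> lstate" where
  "read_state n ls i = State ((\<lambda>_. 0)(vn := n, vL := length ls, 1 := 2 + 2 * length ls, vj := i))
     (\<lambda>c l. if c = aA \<and> l < i then fst (ls ! l) else if c = aB \<and> l < i then snd (ls ! l) else 0)"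

text \<open>The base \<open>2 + 2 * N\<close> lies just behind the input word, so filling the arrays
  never destroys unread input. \<open>represents\<close> is silent about those cells, which is why
  the loop invariant records them separately.\<close>

lemma READ_spec:
  fixes n ls
  defines "N \<equiv> length ls"
  shows "\<exists>s'. exec READ (initial (encode_instance (n, ls))) (15 + N * 155) s' \<and> represents s' (read_state n ls N)"
proof -
  let ?w = "encode_instance (n, ls)"
  have len: "length ?w = 2 + 2 * N" by (simp add: N_def)
  have w: "?w ! (2 + 2 * l) = fst (ls ! l)" "?w ! (3 + 2 * l) = snd (ls ! l)" if "l < N" for l
    using nth_encode_lines[of l ls] that by (simp_all add: N_def numeral_eq_Suc)
  let ?s0 = "initial ?w"
  let ?s1 = "((fst ?s0)(vn := n), snd ?s0)"
  let ?s2 = "((fst ?s1)(vL := N), snd ?s0)"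
  let ?s3 = "((fst ?s2)(1 := 2 + 2 * N), snd ?s0)"
  let ?P = "Seq (Store (addr aA (Reg vj)) (Mem (Plus (Lit 2) (dbl (Reg vj)))))
       (Seq (Store (addr aB (Reg vj)) (Mem (Plus (Lit 3) (dbl (Reg vj)))))
         (Assign vj (Plus (Reg vj) (Lit 1))))"
  let ?I = "\<lambda>i s. represents s (read_state n ls i) \<and> (\<forall>p<2 + 2 * N. snd s p = ?w ! p)"
  have e1: "exec (Assign vn (Mem (Lit 0))) ?s0 3 ?s1"
    using exec.Assign[of vn "Mem (Lit 0)" ?s0] by (simp add: initial_def numeral_eq_Suc)
  have e2: "exec (Assign vL (Mem (Lit 1))) ?s1 3 ?s2"
    using exec.Assign[of vL "Mem (Lit 1)" ?s1] by (simp add: initial_def numeral_eq_Suc N_def)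
  have e3: "exec (Assign 1 (Plus (Lit 2) (dbl (Reg vL)))) ?s2 6 ?s3"
    using exec.Assign[of 1 "Plus (Lit 2) (dbl (Reg vL))" ?s2] by (simp add: mult_2 numeral_eq_Suc)
  have "\<exists>s'. exec (WhileLess (Reg vj) (Reg vL) ?P) ?s3 (3 + (\<Sum>i<N. 3 + 152)) s' \<and> ?I N s'"
  proof (rule exec_while[where Inv = ?I])
    show "?I 0 ?s3" using len
      by (auto simp: represents_def read_state_def initial_def N_def fun_eq_iff)
    show "\<not> fst s vj < fst s vL" if "?I N s" for s
      using that by (simp add: represents_def read_state_def N_def)
    fix i s assume i: "i < N" and I: "?I i s"
    let ?h = "read_state n ls i"
    have r: "represents s ?h" and m: "\<And>p. p < 2 + 2 * N \<Longrightarrow> snd s p = ?w ! p" using I by auto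
    have v: "fst s = var ?h" "fst s vj = i" "fst s vL = N" "fst s 1 = 2 + 2 * N"
      using r by (auto simp: represents_def read_state_def N_def)
    have "snd s (2 + 2 * i) = fst (ls ! i)" "snd s (3 + 2 * i) = snd (ls ! i)"
      using m[of "2 + 2 * i"] m[of "3 + 2 * i"] w i by auto
    then have mi: "snd s (2 + (i + i)) = fst (ls ! i)" "snd s (3 + (i + i)) = snd (ls ! i)"
      by (simp_all only: mult_2)
    let ?a = "2 + 2 * N + (aA + 32 * i)" and ?b = "2 + 2 * N + (aB + 32 * i)"
    let ?t1 = "(fst s, (snd s)(?a := fst (ls ! i)))"
    let ?t2 = "(fst s, (snd ?t1)(?b := snd (ls ! i)))"
    let ?t3 = "((fst s)(vj := Suc i), snd ?t2)"
    have x1: "exec (Store (addr aA (Reg vj)) (Mem (Plus (Lit 2) (dbl (Reg vj))))) s 74 ?t1"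
      using exec.Store[of "addr aA (Reg vj)" "Mem (Plus (Lit 2) (dbl (Reg vj)))" s] v(2,4) mi(1)
      by simp
    have ne: "3 + (i + i) \<noteq> ?a" using i by linarith
    have x2: "exec (Store (addr aB (Reg vj)) (Mem (Plus (Lit 3) (dbl (Reg vj))))) ?t1 74 ?t2"
      using exec.Store[of "addr aB (Reg vj)" "Mem (Plus (Lit 3) (dbl (Reg vj)))" ?t1] v(2,4) mi(2) ne
      by simp
    have x3: "exec (Assign vj (Plus (Reg vj) (Lit 1))) ?t2 4 ?t3"
      using exec_increment[of vj ?t2] v(2) by simp
    have "exec ?P s (74 + (74 + 4)) ?t3" by (intro exec.Seq[OF x1] exec.Seq[OF x2] x3)
    moreover have "represents ?t3 (read_state n ls (Suc i))"
    proof -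
      have h1: "var ?h 1 = 2 + 2 * N" by (simp add: read_state_def N_def)
      have "represents ?t1 (upd_arr aA i (fst (ls ! i)) ?h)"
        using represents_upd_arr[OF r, of aA i] h1 by simp
      from represents_upd_arr[OF this, of aB i "snd (ls ! i)"]
      have "represents ?t2 (upd_arr aB i (snd (ls ! i)) (upd_arr aA i (fst (ls ! i)) ?h))" using h1 by simp
      from represents_upd_var[OF this, of vj "Suc i"]
      have "represents ?t3 (upd_var vj (Suc i) (upd_arr aB i (snd (ls ! i)) (upd_arr aA i (fst (ls ! i)) ?h)))" by simp
      moreover have "upd_var vj (Suc i) (upd_arr aB i (snd (ls ! i)) (upd_arr aA i (fst (ls ! i)) ?h)) = read_state n ls (Suc i)"
        by (rule lstate.expand) (auto simp: read_state_def fun_eq_iff)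
      ultimately show ?thesis by simp
    qed
    moreover have "\<forall>p<2 + 2 * N. snd ?t3 p = ?w ! p" using m by simp
    ultimately show "fst s vj < fst s vL \<and> (\<exists>s'. exec ?P s 152 s' \<and> ?I (Suc i) s')"
      using v(2,3) i by (intro conjI exI[of _ ?t3]) auto
  qed
  then obtain s' where s': "exec (WhileLess (Reg vj) (Reg vL) ?P) ?s3 (3 + (\<Sum>i<N. 3 + 152)) s'"
    "represents s' (read_state n ls N)" by blast
  have "exec READ ?s0 (3 + (3 + (6 + (3 + (\<Sum>i<N. 3 + 152))))) s'"
    unfolding READ_def by (intro exec.Seq[OF e1] exec.Seq[OF e2] exec.Seq[OF e3] s'(1))
  then show ?thesis using s'(2) by (intro exI[of _ s']) (simp add: add.commute)
qed

lemma EMIT_spec: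
  assumes r: "represents s h" and W: "var h vwt = length w" and out: "segment (arr h aOut) 0 w" and 0: "var h 0 = 0"
  shows "\<exists>s'. exec EMIT s (5 + length w * 77) s' \<and> outputs s' w"
proof -
  let ?P = "Seq (Store (Reg vj) (Mem (addr aOut (Reg vj)))) (Assign vj (Plus (Reg vj) (Lit 1)))"
  let ?s0 = "((fst s)(vj := 0), snd s)"
  let ?I = "\<lambda>i t. fst t = (fst s)(vj := i) \<and> (\<forall>p<i. snd t p = w ! p) \<and> (\<forall>p\<ge>i. snd t p = snd s p)"
  have f: "fst s = var h" "\<And>i. snd s (fst s 1 + (aOut + 32 * i)) = arr h aOut i"
    using r by (auto simp: represents_def)
  have e: "exec (Assign vj (Lit 0)) s 2 ?s0" using exec.Assign[of vj "Lit 0" s] by (simp add: numeral_eq_Suc)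
  have "\<exists>s'. exec (WhileLess (Reg vj) (Reg vwt) ?P) ?s0 (3 + (\<Sum>i<length w. 3 + 74)) s' \<and> ?I (length w) s'"
  proof (rule exec_while[where Inv = ?I])
    show "?I 0 ?s0" by simp
    show "\<not> fst t vj < fst t vwt" if "?I (length w) t" for t using that f W by simp
    fix i t assume i: "i < length w" and I: "?I i t"
    let ?a = "fst s 1 + (aOut + 32 * i)"
    have "snd t ?a = arr h aOut i" using I f(2)[of i] by simp
    also have "\<dots> = w ! i" using out i by (simp add: segment_def)
    finally have ti: "snd t ?a = w ! i" .
    let ?t1 = "(fst t, (snd t)(i := w ! i))"
    have x1: "exec (Store (Reg vj) (Mem (addr aOut (Reg vj)))) t 70 ?t1"
      using exec.Store[of "Reg vj" "Mem (addr aOut (Reg vj))" t] I ti by simp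
    have x2: "exec (Assign vj (Plus (Reg vj) (Lit 1))) ?t1 4 ((fst t)(vj := Suc i), snd ?t1)"
      using exec_increment[of vj ?t1] I by simp
    have "exec ?P t (70 + 4) ((fst t)(vj := Suc i), snd ?t1)" by (rule exec.Seq[OF x1 x2])
    then show "fst t vj < fst t vwt \<and> (\<exists>s'. exec ?P t 74 s' \<and> ?I (Suc i) s')"
      using I i f W by (intro conjI exI[of _ "((fst t)(vj := Suc i), snd ?t1)"]) (auto simp: less_Suc_eq)
  qed
  then obtain s' where s': "exec (WhileLess (Reg vj) (Reg vwt) ?P) ?s0 (3 + (\<Sum>i<length w. 3 + 74)) s'" "?I (length w) s'"
    by blast
  have "exec EMIT s (2 + (3 + (\<Sum>i<length w. 3 + 74))) s'" unfolding EMIT_def by (rule exec.Seq[OF e s'(1)])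
  moreover have "outputs s' w" using s'(2) f 0 by (simp add: outputs_def)
  ultimately show ?thesis by (intro exI[of _ s']) simp
qed

context mlcm_input
begin

lemma multiplicity_bound: "i < n \<Longrightarrow> length (edge_list i) \<le> multiplicity n (set ls)"
proof (cases i)
  case (Suc j)
  assume "i < n"
  have "length (edge_list i) = card (lines_on (set ls) i)" using edge_list[of i] distinct_card by metis
  also have "\<dots> \<le> multiplicity n (set ls)"
    unfolding multiplicity_def using \<open>i < n\<close> Suc by (intro Max_ge) auto
  finally show ?thesis .
qed simp

text \<open>Every line traverses the edge at its first station, so the edges cover the line set.
  This absorbs the time spent per line into the bound by stations and multiplicity.\<close>

lemma line_count: "length ls \<le> n * multiplicity n (set ls)"
proof -
  have "length ls = card (set ls)" using dist by (simp add: distinct_card)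
  also have "\<dots> \<le> card (\<Union>i\<in>{1..<n}. lines_on (set ls) i)"
  proof (rule card_mono)
    show "set ls \<subseteq> (\<Union>i\<in>{1..<n}. lines_on (set ls) i)"
    proof
      fix x assume x: "x \<in> set ls"
      then have "x \<in> lines_on (set ls) (fst x)" "fst x \<in> {1..<n}"
        using line_bounds[OF x] by (auto simp: lines_on_iff)
      then show "x \<in> (\<Union>i\<in>{1..<n}. lines_on (set ls) i)" by blast
    qed
  qed (use finite_lines_on in blast)
  also have "\<dots> \<le> (\<Sum>i\<in>{1..<n}. card (lines_on (set ls) i))" by (rule card_UN_le) simp
  also have "\<dots> \<le> (\<Sum>i\<in>{1..<n}. multiplicity n (set ls))"
    by (intro sum_mono) (metis multiplicity_bound edge_list distinct_card atLeastLessThan_iff)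
  also have "\<dots> \<le> n * multiplicity n (set ls)" by simp
  finally show ?thesis .
qed

lemma out_ptr_bound: "out_ptr n \<le> n * (1 + 4 * multiplicity n (set ls))"
proof -
  have "out_ptr n \<le> (\<Sum>i\<in>{1..<n}. 1 + 4 * multiplicity n (set ls))"
    unfolding out_ptr_def by (intro sum_mono) (use multiplicity_bound in auto)
  also have "\<dots> = (n - 1) * (1 + 4 * multiplicity n (set ls))" by simp
  also have "\<dots> \<le> n * (1 + 4 * multiplicity n (set ls))" by (rule mult_le_mono1) simp
  finally show ?thesis .
qed

text \<open>\<open>max 1 k\<close> is there for instances without lines: with \<open>k = 0\<close>
  the plain cubic term would be 0, while the program still takes some steps.\<close>

lemma PROGRAM_spec:
  fixes k
  defines "k \<equiv> multiplicity n (set ls)"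
  shows "\<exists>t s'. exec PROGRAM (initial (encode_instance (n, ls))) t s' \<and>
    t \<le> 8000000 * (max 1 k ^ 3 * 2 ^ k * n) \<and> (\<exists>w. mlcm_solution (n, ls) w \<and> outputs s' w)"
proof -
  let ?N = "length ls"
  let ?h0 = "read_state n ls ?N"
  obtain s1 where s1: "exec READ (initial (encode_instance (n, ls))) (15 + ?N * 155) s1" "represents s1 ?h0"
    using READ_spec by blast
  have k: "\<And>i. i < n \<Longrightarrow> length (edge_list i) \<le> k" using multiplicity_bound by (simp add: k_def)
  have F1: "forward_inv (n - 1) (run FORWARD ?h0)"
    by (rule FORWARD_spec(1)[where K = k]) (use k in \<open>auto simp: read_state_def\<close>)
  have F2: "time FORWARD ?h0 \<le> 100000 * (?N + 1) + n * (600000 * (2 ^ k * ((k + 1) * (k + 1))))"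
    by (rule FORWARD_spec(2)) (use k in \<open>auto simp: read_state_def\<close>)
  let ?h1 = "run FORWARD ?h0" let ?h2 = "run MAIN ?h0"
  have h2: "?h2 = run BACKWARD ?h1" by (simp add: MAIN_def)
  note B = BACKWARD_spec[OF F1 k, folded h2]
  obtain \<pi> where \<pi>: "optimal n (set ls) \<pi>" "segment (arr ?h2 aOut) 0 (encode_layout n \<pi>)"
    "var ?h2 vwt = length (encode_layout n \<pi>)" using B(1) by auto
  obtain s2 where s2: "exec (compile MAIN) s1 (time MAIN ?h0) s2" "represents s2 ?h2"
    using exec_compile[OF wf_MAIN s1(2)] by blast
  have "var ?h2 0 = 0" using MAIN_keeps_0 by (simp add: read_state_def)
  from EMIT_spec[OF s2(2) \<pi>(3,2) this] obtain s3 where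
    s3: "exec EMIT s2 (5 + length (encode_layout n \<pi>) * 77) s3" "outputs s3 (encode_layout n \<pi>)" by blast
  let ?t = "(15 + ?N * 155) + (time MAIN ?h0 + (5 + length (encode_layout n \<pi>) * 77))"
  have "exec PROGRAM (initial (encode_instance (n, ls))) ?t s3"
    unfolding PROGRAM_def by (rule exec.Seq[OF s1(1) exec.Seq[OF s2(1) s3(1)]])
  moreover have "?t \<le> 8000000 * (max 1 k ^ 3 * 2 ^ k * n)"
  proof -
    define q where "q = n * (2 ^ k * ((k + 1) * (k + 1)))"
    define p where "p = n * ((k + 1) * (k + 1))"
    have one: "1 \<le> (2::nat) ^ k" by simp
    have "p \<le> q" unfolding p_def q_def using one by (intro mult_le_mono2) (metis mult_le_mono1 nat_mult_1)
    have "n * (k + 1) \<le> p" unfolding p_def by (intro mult_le_mono2) simp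
    have "?N \<le> n * (k + 1)" using line_count by (simp add: k_def)
    have "n \<le> n * (k + 1)" by simp
    have "length (encode_layout n \<pi>) \<le> 4 * (n * (k + 1))"
      using out_ptr_bound \<pi>(3) B(2) by (simp add: k_def algebra_simps)
    have "time MAIN ?h0 = time FORWARD ?h0 + time BACKWARD ?h1" by (simp add: MAIN_def)
    moreover have "time FORWARD ?h0 \<le> 100000 * ?N + 100000 + 600000 * q"
      using F2 by (simp add: q_def algebra_simps)
    moreover have "time BACKWARD ?h1 \<le> 1000 + 400000 * p"
      using B(3) by (simp add: p_def algebra_simps)
    ultimately have "?t \<le> 2000000 * q"
      using \<open>p \<le> q\<close> \<open>n * (k + 1) \<le> p\<close> \<open>?N \<le> n * (k + 1)\<close> \<open>n \<le> n * (k + 1)\<close>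
        \<open>length (encode_layout n \<pi>) \<le> 4 * (n * (k + 1))\<close> n_pos by linarith
    \<comment> \<open>From \<open>k + 1 \<le> 2 * max 1 k\<close>, squared. The factor 4 times the
      2000000 of the preceding step is the constant 8000000.\<close>
    moreover have "q \<le> 4 * (max 1 k ^ 3 * 2 ^ k * n)"
    proof -
      let ?m = "max 1 k"
      have "(k + 1) * (k + 1) \<le> (2 * ?m) * (2 * ?m)" by (intro mult_le_mono) auto
      also have "\<dots> = 4 * (?m * ?m * 1)" by simp
      also have "\<dots> \<le> 4 * (?m * ?m * ?m)" by (intro mult_le_mono2) simp
      also have "\<dots> = 4 * ?m ^ 3" by (simp only: power3_eq_cube)
      finally have "q \<le> n * (2 ^ k * (4 * ?m ^ 3))" unfolding q_def by (intro mult_le_mono2)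
      also have "\<dots> = 4 * (?m ^ 3 * 2 ^ k * n)" by (simp only: mult_ac)
      finally show ?thesis .
    qed
    ultimately show ?thesis by linarith
  qed
  ultimately show ?thesis using \<pi>(1) s3(2) by (metis mlcm_solution.simps)
qed

end

theorem theorem4:
  shows "fixed_parameter_tractable MLCM_P_PATH instance_size instance_multiplicity \<and>
    solvable_in_bigo_time MLCM_P_PATH
      (\<lambda>x. (max 1 (instance_multiplicity x)) ^ 3 * 2 ^ instance_multiplicity x * stations x)"
proof -
  have solve: "\<exists>t s'. exec PROGRAM (initial (encode_instance (n, ls))) t s' \<and>
    t \<le> 8000000 * (max 1 (multiplicity n (set ls)) ^ 3 * 2 ^ multiplicity n (set ls) * n) \<and>
    (\<exists>w. mlcm_solution (n, ls) w \<and> outputs s' w)" if "(n, ls) \<in> mlcm_instances" for n ls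
  proof -
    interpret mlcm_input n ls using that by unfold_locales (auto simp: mlcm_instances_def)
    show ?thesis by (rule PROGRAM_spec)
  qed
  have 1: "solves_in_time PROGRAM MLCM_P_PATH (\<lambda>x. 8000000 *
      ((max 1 (instance_multiplicity x)) ^ 3 * 2 ^ instance_multiplicity x * stations x))"
    unfolding solves_in_time_def MLCM_P_PATH_def using solve by (auto split: prod.splits)
  \<comment> \<open>\<open>stations\<close> never exceeds \<open>instance_size\<close>, so
    everything depending on the multiplicity goes into the parameter function and the first power of
    the size suffices.\<close>
  have 2: "solves_in_time PROGRAM MLCM_P_PATH (\<lambda>x.
      (8000000 * ((max 1 (instance_multiplicity x)) ^ 3 * 2 ^ instance_multiplicity x)) * instance_size x ^ 1)"
    unfolding solves_in_time_def MLCM_P_PATH_def prod.case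
  proof
    fix x :: mlcm_instance assume "x \<in> mlcm_instances"
    moreover obtain n ls where x: "x = (n, ls)" by (cases x)
    ultimately obtain t s' where t: "exec PROGRAM (initial (encode_instance (n, ls))) t s'"
       "t \<le> 8000000 * (max 1 (multiplicity n (set ls)) ^ 3 * 2 ^ multiplicity n (set ls) * n)"
       "\<exists>w. mlcm_solution (n, ls) w \<and> outputs s' w" using solve by blast
    have "8000000 * (max 1 (multiplicity n (set ls)) ^ 3 * 2 ^ multiplicity n (set ls) * n) \<le>
        8000000 * (max 1 (multiplicity n (set ls)) ^ 3 * 2 ^ multiplicity n (set ls)) * (n + length ls)"
      by (simp add: algebra_simps)
    then have "t \<le> 8000000 * (max 1 (multiplicity n (set ls)) ^ 3 * 2 ^ multiplicity n (set ls)) * (n + length ls)"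
      using t(2) by (rule le_trans[rotated])
    with t(1,3) show "\<exists>t s'. exec PROGRAM (initial (encode_instance x)) t s' \<and>
        t \<le> 8000000 * ((max 1 (instance_multiplicity x)) ^ 3 * 2 ^ instance_multiplicity x) * instance_size x ^ 1 \<and>
        (\<exists>w. mlcm_solution x w \<and> outputs s' w)"
      unfolding x by (intro exI[of _ t] exI[of _ s'])
        (simp only: instance_multiplicity.simps instance_size.simps power_one_right simp_thms)
  qed
  from 2 have "fixed_parameter_tractable MLCM_P_PATH instance_size instance_multiplicity"
    unfolding fixed_parameter_tractable_def
    by (intro exI[of _ PROGRAM] exI[of _ "\<lambda>k. 8000000 * (max 1 k ^ 3 * 2 ^ k)"] exI[of _ 1])
  with 1 show ?thesis unfolding solvable_in_bigo_time_def by blast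
qed

end
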